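(* Let $(\mathcal{X},\mathcal{A},P)$ be a probability space, $f\in L_2(P)$ real-valued, and $h=(h_1,\ldots,h_m)^T$ control variates $h_j\in L_2(P)$ with $P(h_j)=0$. Fix a minimizer $\beta^\star(f)\in\arg\min_{\beta\in\mathbb{R}^m}P[(f-P(f)-\beta^Th)^2]$, let $\epsilon=f-P(f)-\beta^\star(f)^Th$, $S^\star=\operatorname{supp}(\beta^\star(f))$, assumed nonempty, $\ell^\star=|S^\star|$. Assume: (i) $\epsilon\in\mathcal{G}(\tau^2)$ for some $\tau>0$; (ii) $U_h:=\max_j\sup_x|h_j(x)|<\infty$; (iii) the $h_k$, $k\in S^\star$, are linearly independent in $L_2(P)$, so $G_{S^\star}=P(h_{S^\star}h_{S^\star}^T)$ is positive definite with smallest eigenvalue $\gamma^{\star\star}>0$; (iv) $P(h_jh_k)=0$ for all $j\notin S^\star$, $k\in S^\star$. Put $\xi^\star=\ell^\star U_h^2/\gamma^{\star\star}$ and $B^\star=\sup_{x\in\mathcal{X}}h_{S^\star}(x)^TG_{S^\star}^{-1}h_{S^\star}(x)$. Let $X_1,\ldots,X_n$ be i.i.d. $P$. Then for all $\delta\in(0,1)$, every integer $N\in\{1,\ldots,n\}$ with $N\ge75(\xi^\star)^2\log(20\ell^\star m/\delta)$, and every $\lambda$ with $$13U_h\sqrt{\log(20m/\delta)}\frac{\tau}{\sqrt N}\le\lambda\le\frac{\gamma^{\star\star}}{3\sqrt{\ell^\star}}\min_{k\in S^\star}|\beta_k^\star(f)|,$$ with probability at least $1-\delta$, $$|\hat\alpha_n^{\mathrm{lslasso}}(f)-P(f)|\le\sqrt{2\log(16/\delta)}\frac{\tau}{\sqrt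 n}+58\sqrt{B^\star\ell^\star\log(16\ell^\star/\delta)\log(8/\delta)}\,\frac{\tau}{n}.$$
   Context: A centered random variable $Y$ is in $\mathcal{G}(\tau^2)$ if $\log\mathbb{E}[e^{\lambda Y}]\le\lambda^2\tau^2/2$ for all real $\lambda$; for a function $\epsilon$ this means $\int e^{\lambda\epsilon}dP\le e^{\lambda^2\tau^2/2}$ for all $\lambda$. $h_S=(h_k)_{k\in S}$. For a sample size $k$, let $f^{(k)}=(f(X_i))_{i\le k}$, $H^{(k)}=(h_j(X_i))_{i\le k,j\le m}$, $f_c^{(k)}=f^{(k)}-\mathbb{1}_k(\mathbb{1}_k^Tf^{(k)})/k$, $H_c^{(k)}=H^{(k)}-\mathbb{1}_k(\mathbb{1}_k^TH^{(k)})/k$. The LASSO coefficient on the subsample $X_1,\ldots,X_N$ is $\hat\beta_N^{\mathrm{lasso}}(f)\in\arg\min_{\beta\in\mathbb{R}^m}\frac{1}{2N}\|f_c^{(N)}-H_c^{(N)}\beta\|_2^2+\lambda\|\beta\|_1$, with support $\hat S_N=\{j:\hat\beta^{\mathrm{lasso}}_{N,j}(f)\neq0\}$ of cardinality $\hat\ell$. The LSLASSO estimator is defined by $(\hat\alpha_n^{\mathrm{lslasso}}(f),\hat\beta_n^{\mathrm{lslasso}}(f))\in\arg\min_{(\alpha,\beta)\in\mathbb{R}\times\mathbb{R}^{\hat\ell}}\|f^{(n)}-\alpha\mathbb{1}_n-H^{(n)}_{\hat S_N}\beta\|_2^2$, where $H^{(n)}_{\hat S_N}=(h_j(X_i))_{i\le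 n,\,j\in\hat S_N}$ (OLS on the full sample using only the selected control variates). *)

theory Defs
  imports "HOL-Probability.Probability" "Jordan_Normal_Form.Matrix" "Jordan_Normal_Form.Char_Poly" "Jordan_Normal_Form.Gauss_Jordan_Elimination"
begin

definition subgaussian :: "'a measure \<Rightarrow> ('a \<Rightarrow> real) \<Rightarrow> real \<Rightarrow> bool" where
  "subgaussian P e tau2 \<longleftrightarrow>
     (\<forall>lam::real. integrable P (\<lambda>x. exp (lam * e x)) \<and>
        (\<integral>x. exp (lam * e x) \<partial>P) \<le> exp (lam\<^sup>2 * tau2 / 2))"

definition supp_m :: "nat \<Rightarrow> (nat \<Rightarrow> real) \<Rightarrow> nat set" where
  "supp_m m b = {j. j < m \<and> b j \<noteq> 0}"

definition U_h :: "'a measure \<Rightarrow> (nat \<Rightarrow> 'a \<Rightarrow> real) \<Rightarrow> nat \<Rightarrow> real" where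
  "U_h P h m = (SUP jx \<in> {..<m} \<times> space P. \<bar>h (fst jx) (snd jx)\<bar>)"

definition idx :: "nat set \<Rightarrow> nat list" where
  "idx S = sorted_list_of_set S"

definition gram_mat :: "'a measure \<Rightarrow> (nat \<Rightarrow> 'a \<Rightarrow> real) \<Rightarrow> nat set \<Rightarrow> real mat" where
  "gram_mat P h S = mat (card S) (card S)
     (\<lambda>(i,k). \<integral>x. h (idx S ! i) x * h (idx S ! k) x \<partial>P)"

definition h_vec :: "(nat \<Rightarrow> 'a \<Rightarrow> real) \<Rightarrow> nat set \<Rightarrow> 'a \<Rightarrow> real vec" where
  "h_vec h S x = vec (card S) (\<lambda>i. h (idx S ! i) x)"

definition min_eigenvalue :: "real mat \<Rightarrow> real" where
  "min_eigenvalue A = Min {e. eigenvalue A e}"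

definition B_star :: "'a measure \<Rightarrow> (nat \<Rightarrow> 'a \<Rightarrow> real) \<Rightarrow> nat set \<Rightarrow> real" where
  "B_star P h S = (SUP x \<in> space P.
      scalar_prod (h_vec h S x) (the (mat_inverse (gram_mat P h S)) *\<^sub>v h_vec h S x))"

definition lasso_obj :: "('a \<Rightarrow> real) \<Rightarrow> (nat \<Rightarrow> 'a \<Rightarrow> real) \<Rightarrow> nat \<Rightarrow> (nat \<Rightarrow> 'a) \<Rightarrow> nat
      \<Rightarrow> real \<Rightarrow> (nat \<Rightarrow> real) \<Rightarrow> real" where
  "lasso_obj f h m Xs N lam b =
     1 / (2 * real N) *
       (\<Sum>i<N. ((f (Xs i) - (\<Sum>i'<N. f (Xs i')) / real N)
                 - (\<Sum>j<m. (h j (Xs i) - (\<Sum>i'<N. h j (Xs i')) / real N) * b j))\<^sup>2)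
     + lam * (\<Sum>j<m. \<bar>b j\<bar>)"

definition is_lasso :: "('a \<Rightarrow> real) \<Rightarrow> (nat \<Rightarrow> 'a \<Rightarrow> real) \<Rightarrow> nat \<Rightarrow> (nat \<Rightarrow> 'a) \<Rightarrow> nat
      \<Rightarrow> real \<Rightarrow> (nat \<Rightarrow> real) \<Rightarrow> bool" where
  "is_lasso f h m Xs N lam b \<longleftrightarrow>
     (\<forall>j\<ge>m. b j = 0) \<and> (\<forall>b'. lasso_obj f h m Xs N lam b \<le> lasso_obj f h m Xs N lam b')"

definition is_ols :: "('a \<Rightarrow> real) \<Rightarrow> (nat \<Rightarrow> 'a \<Rightarrow> real) \<Rightarrow> (nat \<Rightarrow> 'a) \<Rightarrow> nat
      \<Rightarrow> nat set \<Rightarrow> real \<Rightarrow> (nat \<Rightarrow> real) \<Rightarrow> bool" where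
  "is_ols f h Xs n S a b \<longleftrightarrow>
     (\<forall>a' b'. (\<Sum>i<n. (f (Xs i) - a - (\<Sum>j\<in>S. b j * h j (Xs i)))\<^sup>2)
            \<le> (\<Sum>i<n. (f (Xs i) - a' - (\<Sum>j\<in>S. b' j * h j (Xs i)))\<^sup>2))"

end

theory Submission
  imports Defs
begin

text \<open>
  Let \<open>S\<close> be the support of \<open>bstar\<close> and \<open>l\<close> its size. On one event of probability at least
  \<open>1 - delta\<close>, the empirical Gram entries \<open>(j, k)\<close> with \<open>k \<in> S\<close> are within
  \<open>\<gamma> / (5 l)\<close> of their expectations and the empirical correlations with the noise are at most
  \<open>lam / 4\<close>. There the stationarity conditions of any LASSO minimiser force its error \<open>d\<close> into
  a cone: the \<open>l1\<close> norm off \<open>S\<close> is at most \<open>5/3\<close> of the \<open>l1\<close> norm on \<open>S\<close>. Hence the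
  Euclidean norm of \<open>d\<close> on \<open>S\<close> is below \<open>3 lam sqrt l / \<gamma>\<close>, too small to kill a coefficient of
  \<open>bstar\<close>, while a nonzero coefficient outside \<open>S\<close> would require a residual correlation of size
  \<open>lam\<close>; so the selected support is exactly \<open>S\<close>.

  For OLS on \<open>S\<close> the intercept error is the mean noise minus \<open>d\<close> applied to the mean of \<open>h\<close>.
  The latter is at most the \<open>G\<close>-norm of \<open>d\<close> times the \<open>K\<close>-norm of the mean of \<open>h\<close>, where \<open>K\<close>
  is the inverse of the Gram matrix \<open>G\<close>, and the normal equations bound the former essentially by the
  \<open>K\<close>-norm of the mean of \<open>h eps\<close>. Both means are averages of independent centred vectors in a
  Hilbert space, to which Pinelis' inequality for \<open>cosh\<close> of the norm applies. The squared \<open>K\<close>-norm of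
  \<open>h\<close> is at most \<open>B_star\<close> and has expectation \<open>l\<close>, whence the factors \<open>sqrt B_star\<close> and
  \<open>sqrt l\<close>.
\<close>

section \<open>Hyperbolic cosine of a Hilbert norm\<close>

text \<open>The gap \<open>g\<close> vanishes at 0. With \<open>y = exp x\<close> its derivative is
  \<open>y (y - 1) + (1 - 1 / y^2)\<close>, and both summands have the sign of \<open>x\<close>, so
  0 is a global minimum.\<close>

lemma exp_le_add_cosh: "exp x \<le> x + cosh (2 * x)" for x :: real
proof -
  define g :: "real \<Rightarrow> real" where "g = (\<lambda>x. cosh (2 * x) + x - exp x)"
  define g' :: "real \<Rightarrow> real" where "g' = (\<lambda>x. 2 * sinh (2 * x) + 1 - exp x)"
  have deriv: "(g has_real_derivative g' x) (at x)" for x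
    unfolding g_def g'_def by (auto intro!: derivative_eq_intros)
  have sinh2: "2 * sinh (2 * x) = exp x * exp x - exp (-x) * exp (-x)" for x :: real
    by (simp add: sinh_def flip: exp_add)
  have pos: "g' x \<ge> 0" if "x \<ge> 0" for x
  proof -
    have "exp x \<ge> 1" "exp (-x) \<le> 1" using that by simp_all
    moreover have "exp x * exp x \<ge> exp x * 1"
      using \<open>exp x \<ge> 1\<close> by (intro mult_left_mono) auto
    moreover have "exp (-x) * exp (-x) \<le> 1 * 1"
      using \<open>exp (-x) \<le> 1\<close> by (intro mult_mono) auto
    ultimately show ?thesis unfolding g'_def sinh2 by linarith
  qed
  have neg: "g' x \<le> 0" if "x \<le> 0" for x
  proof -
    have "exp x \<le> 1" "exp (-x) \<ge> 1" using that by simp_all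
    moreover have "exp x * exp x \<le> exp x * 1"
      using \<open>exp x \<le> 1\<close> by (intro mult_left_mono) auto
    moreover have "exp (-x) * exp (-x) \<ge> 1 * 1"
      using \<open>exp (-x) \<ge> 1\<close> by (intro mult_mono) auto
    ultimately show ?thesis unfolding g'_def sinh2 by linarith
  qed
  have "g 0 \<le> g x"
  proof (cases "x \<ge> 0")
    case True
    show ?thesis
      by (rule DERIV_nonneg_imp_nondecreasing[OF True]) (use deriv pos in blast)
  next
    case False
    then show ?thesis
      by (intro DERIV_nonpos_imp_nonincreasing[of x 0]) (use deriv neg in \<open>auto\<close>)
  qed
  then show ?thesis by (simp add: g_def)
qed

lemma exp_sub_self_nonneg: "0 \<le> exp x - x" for x :: real
  using exp_ge_add_one_self[of x] by linarith

text \<open>Only even powers occur in the series of \<open>cosh\<close>, so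
  \<open>cosh (sqrt u)\<close> is a power series in \<open>u\<close> itself, with positive
  coefficients.\<close>

lemma cosh_sqrt_sums:
  assumes "u \<ge> 0"
  shows "(\<lambda>k. u ^ k /\<^sub>R fact (2 * k)) sums cosh (sqrt u)"
proof -
  let ?f = "\<lambda>n. if even n then sqrt u ^ n /\<^sub>R fact n else 0"
  have "?f sums cosh (sqrt u)" by (rule cosh_converges)
  also have "?f sums cosh (sqrt u) \<longleftrightarrow> (\<lambda>k. ?f (2 * k)) sums cosh (sqrt u)"
    by (rule sums_mono_reindex[symmetric]) (auto simp: strict_mono_def elim!: evenE)
  finally show ?thesis using assms by (simp add: power_mult)
qed

text \<open>On the nonnegative half-line each power is convex, and the positive coefficients of
  \<open>cosh_sqrt_sums\<close> preserve this term by term.\<close>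

lemma convex_on_cosh_sqrt: "convex_on {0..} (\<lambda>u::real. cosh (sqrt u))"
proof (rule convex_onI)
  fix t x y :: real
  assume t: "0 < t" "t < 1" and "x \<in> {0..}" "y \<in> {0..}"
  then have xy: "0 \<le> x" "0 \<le> y" by auto
  let ?z = "(1 - t) *\<^sub>R x + t *\<^sub>R y"
  have z: "0 \<le> ?z" using xy t by simp
  have "(\<lambda>k. (1 - t) * (x ^ k /\<^sub>R fact (2 * k)) + t * (y ^ k /\<^sub>R fact (2 * k)))
      sums ((1 - t) * cosh (sqrt x) + t * cosh (sqrt y))"
    by (intro sums_add sums_mult cosh_sqrt_sums xy)
  moreover have "?z ^ k /\<^sub>R fact (2 * k)
      \<le> (1 - t) * (x ^ k /\<^sub>R fact (2 * k)) + t * (y ^ k /\<^sub>R fact (2 * k))" for k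
  proof -
    have "convex_on {0..} (\<lambda>u::real. u ^ k)"
      by (cases "even k") (auto intro: convex_power_odd convex_on_subset[OF convex_power_even])
    from convex_onD[OF this, of t x y] t xy
    have "?z ^ k \<le> (1 - t) * x ^ k + t * y ^ k" by simp
    then show ?thesis by (simp add: divide_simps)
  qed
  ultimately show "cosh (sqrt ?z) \<le> (1 - t) * cosh (sqrt x) + t * cosh (sqrt y)"
    by (intro sums_le[OF _ cosh_sqrt_sums[OF z]])
qed simp

text \<open>One step of the Pinelis argument. Read \<open>a\<close> and \<open>b\<close> as squared
  norms of vectors \<open>s\<close> and \<open>v\<close>, and \<open>c\<close> as their inner
  product: the left side is \<open>cosh\<close> of the norm of \<open>s + v\<close>. The right side
  is linear in \<open>c\<close>, hence loses its first term when \<open>v\<close> is averaged to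
  zero, and the rest has no first-order part in the norm of \<open>v\<close>. For fixed norms the
  left side is convex in \<open>c\<close>, so it lies below its chord between the extreme values
  allowed by Cauchy-Schwarz.\<close>

lemma cosh_sqrt_add_le:
  fixes a b c :: real
  assumes a: "a \<ge> 0" and b: "b \<ge> 0" and c: "c\<^sup>2 \<le> a * b"
  shows "cosh (sqrt (a + 2 * c + b))
       \<le> c * (sinh (sqrt a) / sqrt a) + cosh (sqrt a) * (exp (sqrt b) - sqrt b)"
proof -
  define p q where "p = sqrt a" and "q = sqrt b"
  have p: "p \<ge> 0" "a = p\<^sup>2" and q: "q \<ge> 0" "b = q\<^sup>2" using a b by (auto simp: p_def q_def)
  have sq: "q \<le> sinh q" using q(1) real_le_x_sinh[of q] by (simp add: sinh_field_def exp_minus)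
  have eq: "exp q = cosh q + sinh q" by (simp add: cosh_plus_sinh)
  have "sqrt (c\<^sup>2) \<le> sqrt (a * b)" using c by (rule real_sqrt_le_mono)
  then have cb: "\<bar>c\<bar> \<le> p * q" by (simp add: p_def q_def real_sqrt_mult)
  have "cosh (sqrt (p\<^sup>2 + 2 * c + q\<^sup>2)) \<le> c * (sinh p / p) + cosh p * (exp q - q)"
  proof (cases "p = 0 \<or> q = 0")
    case True
    then have "c = 0" using cb by auto
    then show ?thesis using True sq eq p q by auto
  next
    case False
    then have pq: "p > 0" "q > 0" using p q by auto
    \<comment> \<open>The position of \<open>c\<close> in the interval from \<open>- p q\<close> to
      \<open>p q\<close>; the endpoints correspond to the squared norms \<open>(p - q)^2\<close> and
      \<open>(p + q)^2\<close>.\<close>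
    define t where "t = (1 + c / (p * q)) / 2"
    have "\<bar>c / (p * q)\<bar> \<le> 1" using cb pq by (simp add: abs_divide divide_le_eq abs_mult)
    then have t: "0 \<le> t" "t \<le> 1" unfolding t_def abs_le_iff by auto
    have c_eq: "c = (2 * t - 1) * (p * q)" using pq by (simp add: t_def add_divide_distrib)
    have "cosh (sqrt (p\<^sup>2 + 2 * c + q\<^sup>2)) = cosh (sqrt ((1 - t) *\<^sub>R (p - q)\<^sup>2 + t *\<^sub>R (p + q)\<^sup>2))"
    proof -
      have "p\<^sup>2 + 2 * c + q\<^sup>2 = (1 - t) *\<^sub>R (p - q)\<^sup>2 + t *\<^sub>R (p + q)\<^sup>2"
        unfolding c_eq by (simp add: power2_eq_square) (simp add: algebra_simps)
      then show ?thesis by (rule arg_cong)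
    qed
    also have "\<dots> \<le> (1 - t) * cosh (sqrt ((p - q)\<^sup>2)) + t * cosh (sqrt ((p + q)\<^sup>2))"
      by (rule convex_onD[OF convex_on_cosh_sqrt]) (use t in auto)
    also have "\<dots> = (1 - t) * cosh (p - q) + t * cosh (p + q)"
      by (simp only: real_sqrt_abs cosh_real_abs)
    also have "\<dots> = cosh p * cosh q + (2 * t - 1) * (sinh p * sinh q)"
      by (simp add: cosh_diff cosh_add algebra_simps)
    \<comment> \<open>Replacing \<open>sinh q\<close> by \<open>q\<close> in the last summand costs
      at most \<open>cosh p * (sinh q - q)\<close>, which together with
      \<open>cosh p * cosh q\<close> is exactly \<open>cosh p * (exp q - q)\<close>.\<close>
    also have "\<dots> \<le> (2 * t - 1) * q * sinh p + cosh p * (exp q - q)"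
    proof -
      have "(2 * t - 1) * sinh p * (sinh q - q) \<le> cosh p * (sinh q - q)"
      proof (rule mult_right_mono)
        have "(2 * t - 1) * sinh p \<le> 1 * sinh p"
          using t pq by (intro mult_right_mono) auto
        also have "\<dots> \<le> cosh p" by (simp add: sinh_le_cosh_real less_imp_le)
        finally show "(2 * t - 1) * sinh p \<le> cosh p" .
      qed (use sq in simp)
      then show ?thesis unfolding eq by (simp add: algebra_simps)
    qed
    also have "(2 * t - 1) * q * sinh p = c * (sinh p / p)" using pq by (simp add: c_eq)
    finally show ?thesis .
  qed
  then show ?thesis unfolding p(2)[symmetric] q(2)[symmetric] unfolding p_def q_def .
qed

section \<open>Support of a LASSO minimiser\<close>

text \<open>The first-order condition at a minimum of a quadratic. It yields both the population and
  the empirical normal equations.\<close>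

lemma linear_term_zero:
  fixes A B :: real
  assumes "\<And>t. 0 \<le> t\<^sup>2 * B - 2 * t * A"
  shows "A = 0"
proof (rule ccontr)
  assume "A \<noteq> 0"
  have B: "0 \<le> B"
    using assms[of 1] assms[of "-1"] by simp
  \<comment> \<open>The exact minimiser would be \<open>A / B\<close>; adding 1 to the denominator
    also covers \<open>B = 0\<close>.\<close>
  have "0 \<le> (A / (B + 1))\<^sup>2 * B - 2 * (A / (B + 1)) * A" by (rule assms)
  also have "\<dots> = - (A\<^sup>2 * (B + 2) / (B + 1)\<^sup>2)"
  proof -
    have "B + 1 \<noteq> 0" using B by simp
    then show ?thesis by (simp add: divide_simps power2_eq_square) (simp add: algebra_simps)
  qed
  also have "\<dots> < 0" using B \<open>A \<noteq> 0\<close> by (simp add: divide_pos_pos)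
  finally show False by simp
qed

lemma le_of_le_add_small:
  fixes x y K :: real
  assumes "\<And>s. 0 < s \<Longrightarrow> s \<le> 1 \<Longrightarrow> x \<le> y + s * K"
  shows "x \<le> y"
proof (rule tendsto_lowerbound)
  have "((\<lambda>s. y + s * K) \<longlongrightarrow> y + 0 * K) (at_right 0)" by (intro tendsto_intros)
  then show "((\<lambda>s. y + s * K) \<longlongrightarrow> y) (at_right 0)" by simp
  show "\<forall>\<^sub>F s in at_right 0. x \<le> y + s * K"
    unfolding eventually_at_right_field using assms by (intro exI[of _ 1]) auto
qed simp

text \<open>The two conclusions say that \<open>\<rho>\<close> lies in \<open>\<mu>\<close> times
  the subdifferential of the absolute value at \<open>\<beta>\<close>. The first comes from steps
  \<open>t = s\<close> and \<open>t = - s\<close>. The second comes from shrinking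
  \<open>\<beta>\<close> by the factor \<open>1 - s\<close>, which lowers the penalty by exactly
  \<open>s * \<mu> * \<bar>\<beta>\<bar>\<close>. In each case one divides by \<open>s\<close> and
  lets it tend to 0.\<close>

lemma soft_threshold_optimality:
  fixes \<rho> \<beta> C \<mu> :: real
  assumes opt: "\<And>t. 0 \<le> - t * \<rho> + t\<^sup>2 * C / 2 + \<mu> * (\<bar>\<beta> + t\<bar> - \<bar>\<beta>\<bar>)" and mu: "0 \<le> \<mu>"
  shows "\<bar>\<rho>\<bar> \<le> \<mu>" "\<beta> * \<rho> = \<mu> * \<bar>\<beta>\<bar>"
proof -
  have step: "0 \<le> - t * \<rho> + t\<^sup>2 * C / 2 + \<mu> * \<bar>t\<bar>" for t
  proof -
    have "\<mu> * (\<bar>\<beta> + t\<bar> - \<bar>\<beta>\<bar>) \<le> \<mu> * \<bar>t\<bar>" by (intro mult_left_mono mu) linarith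
    then show ?thesis using opt[of t] by simp
  qed
  have "\<rho> \<le> \<mu>"
  proof (rule le_of_le_add_small)
    fix s :: real assume "0 < s" "s \<le> 1"
    then have "s * \<rho> \<le> s * (\<mu> + s * (C / 2))"
      using step[of s] by (simp add: power2_eq_square algebra_simps)
    then show "\<rho> \<le> \<mu> + s * (C / 2)" using \<open>0 < s\<close> by simp
  qed
  moreover have "- \<rho> \<le> \<mu>"
  proof (rule le_of_le_add_small)
    fix s :: real assume "0 < s" "s \<le> 1"
    then have "s * (- \<rho>) \<le> s * (\<mu> + s * (C / 2))"
      using step[of "-s"] by (simp add: power2_eq_square algebra_simps)
    then show "- \<rho> \<le> \<mu> + s * (C / 2)" using \<open>0 < s\<close> by (simp only: mult_le_cancel_left_pos)
  qed
  ultimately show "\<bar>\<rho>\<bar> \<le> \<mu>" by linarith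
  have "\<mu> * \<bar>\<beta>\<bar> \<le> \<beta> * \<rho>"
  proof (rule le_of_le_add_small)
    fix s :: real assume s: "0 < s" "s \<le> 1"
    have "\<beta> + - s * \<beta> = (1 - s) * \<beta>" by (simp add: algebra_simps)
    then have "\<bar>\<beta> + - s * \<beta>\<bar> = (1 - s) * \<bar>\<beta>\<bar>" using s by (simp only: abs_mult)
    then have "\<bar>\<beta> + - s * \<beta>\<bar> - \<bar>\<beta>\<bar> = - s * \<bar>\<beta>\<bar>" by (simp add: algebra_simps)
    then have "0 \<le> s * \<beta> * \<rho> + (s * \<beta>)\<^sup>2 * C / 2 - s * (\<mu> * \<bar>\<beta>\<bar>)"
      using opt[of "- s * \<beta>"] by (simp add: mult.left_commute)
    then have "s * (\<mu> * \<bar>\<beta>\<bar>) \<le> s * (\<beta> * \<rho> + s * (\<beta>\<^sup>2 * C / 2))"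
      by (simp add: power2_eq_square algebra_simps)
    then show "\<mu> * \<bar>\<beta>\<bar> \<le> \<beta> * \<rho> + s * (\<beta>\<^sup>2 * C / 2)" using \<open>0 < s\<close> by (simp only: mult_le_cancel_left_pos)
  qed
  moreover have "\<beta> * \<rho> \<le> \<mu> * \<bar>\<beta>\<bar>"
  proof -
    have "\<beta> * \<rho> \<le> \<bar>\<beta>\<bar> * \<bar>\<rho>\<bar>" by (metis abs_ge_self abs_mult)
    also have "\<dots> \<le> \<bar>\<beta>\<bar> * \<mu>" using \<open>\<bar>\<rho>\<bar> \<le> \<mu>\<close> by (intro mult_left_mono) auto
    finally show ?thesis by (simp add: mult.commute)
  qed
  ultimately show "\<beta> * \<rho> = \<mu> * \<bar>\<beta>\<bar>" by linarith
qed

text \<open>Moving only the coefficient \<open>j\<close> by \<open>t\<close> leaves a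
  one-dimensional problem as in \<open>soft_threshold_optimality\<close>: the correlation of column
  \<open>j\<close> with the residual is the slope, the mean square of that column the
  curvature.\<close>

lemma lasso_stationarity:
  fixes Z :: "nat \<Rightarrow> nat \<Rightarrow> real" and y b :: "nat \<Rightarrow> real" and \<mu> :: real
  assumes min: "\<And>b'. 1 / (2 * real N) * (\<Sum>i<N. (y i - (\<Sum>j<m. Z i j * b j))\<^sup>2) + \<mu> * (\<Sum>j<m. \<bar>b j\<bar>)
      \<le> 1 / (2 * real N) * (\<Sum>i<N. (y i - (\<Sum>j<m. Z i j * b' j))\<^sup>2) + \<mu> * (\<Sum>j<m. \<bar>b' j\<bar>)"
    and j: "j < m" and N: "N > 0" and mu: "0 \<le> \<mu>"
  defines "\<rho> \<equiv> (\<Sum>i<N. Z i j * (y i - (\<Sum>j<m. Z i j * b j))) / real N"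
  shows "\<bar>\<rho>\<bar> \<le> \<mu>" "b j * \<rho> = \<mu> * \<bar>b j\<bar>"
proof -
  define r where "r i = y i - (\<Sum>j<m. Z i j * b j)" for i
  have opt: "0 \<le> - t * \<rho> + t\<^sup>2 * ((\<Sum>i<N. (Z i j)\<^sup>2) / real N) / 2 + \<mu> * (\<bar>b j + t\<bar> - \<bar>b j\<bar>)" for t
  proof -
    let ?b = "b(j := b j + t)"
    have "(\<Sum>k<m. Z i k * ?b k) = (\<Sum>k<m. Z i k * b k) + Z i j * t" for i
      using j by (subst (1 2) sum.remove[of _ j]) (auto simp: algebra_simps intro!: sum.cong)
    then have "(\<Sum>i<N. (y i - (\<Sum>k<m. Z i k * ?b k))\<^sup>2) = (\<Sum>i<N. (r i - Z i j * t)\<^sup>2)"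
      by (simp add: r_def algebra_simps)
    also have "\<dots> = (\<Sum>i<N. (r i)\<^sup>2 - 2 * t * (Z i j * r i) + t\<^sup>2 * (Z i j)\<^sup>2)"
      by (intro sum.cong) (auto simp: power2_eq_square algebra_simps)
    also have "\<dots> = (\<Sum>i<N. (r i)\<^sup>2) - 2 * t * (\<Sum>i<N. Z i j * r i) + t\<^sup>2 * (\<Sum>i<N. (Z i j)\<^sup>2)"
      by (simp add: sum.distrib sum_subtractf sum_distrib_left)
    finally have 1: "(\<Sum>i<N. (y i - (\<Sum>k<m. Z i k * ?b k))\<^sup>2)
      = (\<Sum>i<N. (r i)\<^sup>2) - 2 * t * (real N * \<rho>) + t\<^sup>2 * (\<Sum>i<N. (Z i j)\<^sup>2)"
      using N by (simp add: \<rho>_def r_def)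
    have 2: "(\<Sum>k<m. \<bar>?b k\<bar>) = (\<Sum>k<m. \<bar>b k\<bar>) + (\<bar>b j + t\<bar> - \<bar>b j\<bar>)"
      using j by (subst (1 2) sum.remove[of _ j]) (auto simp: algebra_simps intro!: sum.cong)
    show ?thesis
    proof -
      have "1 / (2 * real N) * (\<Sum>i<N. (r i)\<^sup>2) + \<mu> * (\<Sum>k<m. \<bar>b k\<bar>)
        \<le> 1 / (2 * real N) * ((\<Sum>i<N. (r i)\<^sup>2) - 2 * t * (real N * \<rho>) + t\<^sup>2 * (\<Sum>i<N. (Z i j)\<^sup>2))
          + \<mu> * ((\<Sum>k<m. \<bar>b k\<bar>) + (\<bar>b j + t\<bar> - \<bar>b j\<bar>))"
        using min[of ?b] unfolding 1 2 by (simp add: r_def)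
      also have "1 / (2 * real N) * ((\<Sum>i<N. (r i)\<^sup>2) - 2 * t * (real N * \<rho>) + t\<^sup>2 * (\<Sum>i<N. (Z i j)\<^sup>2))
        = 1 / (2 * real N) * (\<Sum>i<N. (r i)\<^sup>2) - t * \<rho> + t\<^sup>2 * ((\<Sum>i<N. (Z i j)\<^sup>2) / real N) / 2"
        using N by (simp add: algebra_simps add_divide_distrib)
      finally show ?thesis by (simp add: algebra_simps)
    qed
  qed
  from soft_threshold_optimality[OF opt mu] show "\<bar>\<rho>\<bar> \<le> \<mu>" "b j * \<rho> = \<mu> * \<bar>b j\<bar>" by auto
qed

lemma sum_abs_le_sqrt_card:
  fixes d :: "'i \<Rightarrow> real"
  shows "(\<Sum>j\<in>S. \<bar>d j\<bar>) \<le> sqrt (real (card S)) * sqrt (\<Sum>j\<in>S. (d j)\<^sup>2)"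
proof -
  have "(\<Sum>j\<in>S. 1 * \<bar>d j\<bar>)\<^sup>2 \<le> (\<Sum>j\<in>S. 1\<^sup>2) * (\<Sum>j\<in>S. \<bar>d j\<bar>\<^sup>2)"
    by (rule Cauchy_Schwarz_ineq_sum)
  then have "(\<Sum>j\<in>S. \<bar>d j\<bar>)\<^sup>2 \<le> real (card S) * (\<Sum>j\<in>S. (d j)\<^sup>2)" by simp
  then show ?thesis by (simp add: real_le_rsqrt flip: real_sqrt_mult)
qed

text \<open>The deterministic core of support recovery. \<open>C\<close> stands for the centred
  empirical Gram matrix, \<open>W\<close> for the empirical correlations with the noise,
  \<open>\<rho>\<close> for those with the LASSO residual and \<open>\<beta>\<close> for the true
  coefficients. The identity \<open>C d = W - \<rho>\<close> is paired with the whole error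
  \<open>d\<close>, with its part on \<open>S\<close>, and with its part off \<open>S\<close>. These
  give in turn the cone condition, the size of the error on \<open>S\<close>, and the absence of
  false positives.\<close>

lemma lasso_support:
  fixes C :: "nat \<Rightarrow> nat \<Rightarrow> real" and W b \<beta> :: "nat \<Rightarrow> real" and \<mu> \<gamma> :: real
  assumes S: "S \<subseteq> {..<m}" "S \<noteq> {}"
    and \<beta>: "\<And>j. j < m \<Longrightarrow> j \<notin> S \<Longrightarrow> \<beta> j = 0"
    and \<mu>: "\<mu> > 0" and \<gamma>: "\<gamma> > 0"
    and kkt: "\<And>j. j < m \<Longrightarrow> \<bar>\<rho> j\<bar> \<le> \<mu>" "\<And>j. j < m \<Longrightarrow> b j * \<rho> j = \<mu> * \<bar>b j\<bar>"
    and \<rho>: "\<And>j. j < m \<Longrightarrow> \<rho> j = W j - (\<Sum>k<m. C j k * (b k - \<beta> k))"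
    and psd: "\<And>d. 0 \<le> (\<Sum>j<m. \<Sum>k<m. d j * C j k * d k)"
    and low: "\<And>d. 4 / 5 * \<gamma> * (\<Sum>j\<in>S. (d j)\<^sup>2) \<le> (\<Sum>j\<in>S. \<Sum>k\<in>S. d j * C j k * d k)"
    and cross: "\<And>j k. j < m \<Longrightarrow> j \<notin> S \<Longrightarrow> k \<in> S \<Longrightarrow> \<bar>C j k\<bar> \<le> \<gamma> / (5 * real (card S))"
    and sym: "\<And>j k. C j k = C k j"
    and W: "\<And>j. j < m \<Longrightarrow> \<bar>W j\<bar> \<le> \<mu> / 4"
    and big: "\<And>k. k \<in> S \<Longrightarrow> 3 * sqrt (real (card S)) * \<mu> \<le> \<gamma> * \<bar>\<beta> k\<bar>"
  shows "{j. j < m \<and> b j \<noteq> 0} = S"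
proof -
  define d where "d j = b j - \<beta> j" for j
  define T where "T = {..<m} - S"
  define A where "A = (\<Sum>j\<in>S. \<bar>d j\<bar>)"
  define R where "R = (\<Sum>j\<in>T. \<bar>b j\<bar>)"
  define D where "D = sqrt (\<Sum>j\<in>S. (d j)\<^sup>2)"
  define l where "l = real (card S)"
  have fin: "finite S" "finite T" using S by (auto simp: T_def intro: finite_subset)
  have l: "l > 0" using S fin by (auto simp: l_def card_gt_0_iff)
  have split: "(\<Sum>j<m. F j) = (\<Sum>j\<in>S. F j) + (\<Sum>j\<in>T. F j)" for F :: "nat \<Rightarrow> real"
    unfolding T_def using S by (metis add.commute finite_lessThan sum.subset_diff)
  have dT: "d j = b j" if "j \<in> T" for j using that \<beta> by (auto simp: d_def T_def)
  have A0: "A \<ge> 0" and R0: "R \<ge> 0" and D0: "D \<ge> 0" by (auto simp: A_def R_def D_def sum_nonneg)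
  have AD: "A \<le> sqrt l * D" unfolding A_def l_def D_def by (rule sum_abs_le_sqrt_card)
  have Wrho: "(\<Sum>k<m. C j k * d k) = W j - \<rho> j" if "j < m" for j
    using \<rho>[OF that] by (simp add: d_def)
  \<comment> \<open>On \<open>S\<close> the sign of \<open>d j * \<rho> j\<close> is unknown, so
    noise and residual correlation add up: \<open>1/4 + 1 = 5/4\<close>.\<close>
  have onS: "(\<Sum>j\<in>S. d j * (W j - \<rho> j)) \<le> 5 / 4 * \<mu> * A"
  proof -
    have "d j * (W j - \<rho> j) \<le> 5 / 4 * \<mu> * \<bar>d j\<bar>" if "j \<in> S" for j
    proof -
      have "\<bar>W j - \<rho> j\<bar> \<le> 5 / 4 * \<mu>"
      proof -
        have "j < m" using that S by blast
        from W[OF this] kkt(1)[OF this] show ?thesis by linarith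
      qed
      then have "\<bar>d j\<bar> * \<bar>W j - \<rho> j\<bar> \<le> \<bar>d j\<bar> * (5 / 4 * \<mu>)" by (intro mult_left_mono) auto
      then show ?thesis by (simp add: abs_mult[symmetric] mult.commute)
    qed
    then have "(\<Sum>j\<in>S. d j * (W j - \<rho> j)) \<le> (\<Sum>j\<in>S. 5 / 4 * \<mu> * \<bar>d j\<bar>)" by (rule sum_mono)
    then show ?thesis by (simp add: A_def sum_distrib_left)
  qed
  \<comment> \<open>Off \<open>S\<close> the error is \<open>b\<close> itself, and complementarity
    \<open>b j * \<rho> j = \<mu> * \<bar>b j\<bar>\<close> gives a gain that exceeds the noise:
    \<open>1/4 - 1 = -3/4\<close>.\<close>
  have onT: "(\<Sum>j\<in>T. d j * (W j - \<rho> j)) \<le> - (3 / 4 * \<mu> * R)"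
  proof -
    have "d j * (W j - \<rho> j) \<le> - (3 / 4 * \<mu> * \<bar>b j\<bar>)" if "j \<in> T" for j
    proof -
      have jm: "j < m" using that by (simp add: T_def)
      have "\<bar>b j\<bar> * \<bar>W j\<bar> \<le> \<bar>b j\<bar> * (\<mu> / 4)" using W[OF jm] by (intro mult_left_mono) auto
      then have "b j * W j \<le> \<mu> / 4 * \<bar>b j\<bar>" by (simp add: abs_mult[symmetric] mult.commute)
      then show ?thesis using kkt(2)[OF jm] by (simp add: dT[OF that] algebra_simps)
    qed
    then have "(\<Sum>j\<in>T. d j * (W j - \<rho> j)) \<le> (\<Sum>j\<in>T. - (3 / 4 * \<mu> * \<bar>b j\<bar>))" by (rule sum_mono)
    then show ?thesis by (simp add: R_def sum_distrib_left sum_negf)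
  qed
  have "0 \<le> (\<Sum>j<m. \<Sum>k<m. d j * C j k * d k)" by (rule psd)
  also have "\<dots> = (\<Sum>j<m. d j * (W j - \<rho> j))"
    by (intro sum.cong refl) (simp add: Wrho[symmetric] sum_distrib_left mult.assoc)
  also have "\<dots> \<le> 5 / 4 * \<mu> * A - 3 / 4 * \<mu> * R" using onS onT by (simp add: split)
  finally have "\<mu> * (3 / 4 * R) \<le> \<mu> * (5 / 4 * A)" by (simp add: algebra_simps)
  then have cone: "R \<le> 5 / 3 * A" using \<mu> by simp
  have crossTS: "\<bar>\<Sum>j\<in>T. \<Sum>k\<in>S. b j * C j k * d k\<bar> \<le> \<gamma> / (5 * l) * R * A"
  proof -
    have "\<bar>\<Sum>j\<in>T. \<Sum>k\<in>S. b j * C j k * d k\<bar> \<le> (\<Sum>j\<in>T. \<Sum>k\<in>S. \<bar>b j * C j k * d k\<bar>)"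
      by (rule order_trans[OF sum_abs]) (intro sum_mono sum_abs)
    also have "\<dots> \<le> (\<Sum>j\<in>T. \<Sum>k\<in>S. \<bar>b j\<bar> * (\<gamma> / (5 * l)) * \<bar>d k\<bar>)"
    proof (intro sum_mono)
      fix j k assume "j \<in> T" "k \<in> S"
      then have "\<bar>C j k\<bar> \<le> \<gamma> / (5 * l)" using cross[of j k] by (simp add: T_def l_def)
      then show "\<bar>b j * C j k * d k\<bar> \<le> \<bar>b j\<bar> * (\<gamma> / (5 * l)) * \<bar>d k\<bar>"
        unfolding abs_mult by (intro mult_right_mono mult_left_mono) auto
    qed
    also have "\<dots> = \<gamma> / (5 * l) * R * A"
      by (simp add: R_def A_def sum_product sum_distrib_left mult_ac flip: sum_divide_distrib)
    finally show ?thesis .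
  qed
  \<comment> \<open>The cone bounds the cross term by \<open>1/3 * \<gamma> * D^2\<close>, to be
    subtracted from the curvature \<open>4/5\<close>. This leaves \<open>7/15\<close>, and
    \<open>(5/4) / (7/15) = 75/28\<close>.\<close>
  have Dbound: "\<gamma> * D \<le> 75 / 28 * \<mu> * sqrt l"
  proof -
    have "4 / 5 * \<gamma> * D\<^sup>2 \<le> (\<Sum>j\<in>S. \<Sum>k\<in>S. d j * C j k * d k)"
      using low[of d] by (simp add: D_def sum_nonneg)
    also have "\<dots> = (\<Sum>j\<in>S. d j * (W j - \<rho> j)) - (\<Sum>j\<in>S. \<Sum>k\<in>T. d j * C j k * b k)"
    proof -
      have "d j * (W j - \<rho> j) = (\<Sum>k\<in>S. d j * C j k * d k) + (\<Sum>k\<in>T. d j * C j k * b k)"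
        if "j \<in> S" for j
        using that S by (subst Wrho[symmetric])
          (auto simp: split sum_distrib_left algebra_simps dT intro!: arg_cong2[of _ _ _ _ "(+)"] sum.cong)
      then show ?thesis by (simp add: sum.distrib)
    qed
    also have "(\<Sum>j\<in>S. \<Sum>k\<in>T. d j * C j k * b k) = (\<Sum>j\<in>T. \<Sum>k\<in>S. b j * C j k * d k)"
      by (subst sum.swap) (intro sum.cong refl, subst sym, simp)
    also have "(\<Sum>j\<in>S. d j * (W j - \<rho> j)) - \<dots> \<le> 5 / 4 * \<mu> * A + \<gamma> / (5 * l) * R * A"
      using onS crossTS by linarith
    also have "\<gamma> / (5 * l) * R * A \<le> \<gamma> / (5 * l) * (5 / 3 * (sqrt l * D)) * (sqrt l * D)"
      using cone AD A0 R0 \<gamma> l by (intro mult_mono) auto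
    also have "\<dots> = \<gamma> / 3 * D\<^sup>2" using l by (simp add: power2_eq_square field_simps)
    also have "5 / 4 * \<mu> * A \<le> 5 / 4 * \<mu> * (sqrt l * D)" using AD \<mu> by (intro mult_left_mono) auto
    finally have *: "D * (\<gamma> * D) \<le> D * (75 / 28 * \<mu> * sqrt l)"
      by (simp add: power2_eq_square algebra_simps)
    show ?thesis
    proof (cases "D = 0")
      case True then show ?thesis using \<mu> l by simp
    next
      case False then show ?thesis using * D0 by (simp only: mult_le_cancel_left_pos)
    qed
  qed
  \<comment> \<open>Pairing with the part of \<open>b\<close> off \<open>S\<close> alone: the gain
    \<open>3/4 * \<mu> * R\<close> would have to be compensated by the cross term, which by
    \<open>Dbound\<close> is at most \<open>15/28 * \<mu> * R\<close>.\<close>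
  have "R = 0"
  proof (rule ccontr)
    assume "R \<noteq> 0"
    then have R: "R > 0" using R0 by simp
    have "0 \<le> (\<Sum>j<m. \<Sum>k<m. (if j \<in> T then b j else 0) * C j k * (if k \<in> T then b k else 0))"
      by (rule psd)
    also have "\<dots> = (\<Sum>j\<in>T. \<Sum>k\<in>T. b j * C j k * b k)"
    proof -
      have "(\<Sum>j\<in>S. F j) = 0" if "\<And>j. j \<in> S \<Longrightarrow> F j = 0" for F :: "nat \<Rightarrow> real" using that by simp
      then show ?thesis by (auto simp: split T_def)
    qed
    also have "\<dots> = (\<Sum>j\<in>T. d j * (W j - \<rho> j)) - (\<Sum>j\<in>T. \<Sum>k\<in>S. b j * C j k * d k)"
    proof -
      have "d j * (W j - \<rho> j) = (\<Sum>k\<in>S. b j * C j k * d k) + (\<Sum>k\<in>T. b j * C j k * b k)"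
        if "j \<in> T" for j
      proof -
        have "j < m" using that by (simp add: T_def)
        from Wrho[OF this] show ?thesis
          using that by (subst Wrho[symmetric])
          (auto simp: split sum_distrib_left algebra_simps dT T_def intro!: arg_cong2[of _ _ _ _ "(+)"] sum.cong)
      qed
      then show ?thesis by (simp add: sum.distrib)
    qed
    also have "\<dots> \<le> - (3 / 4 * \<mu> * R) + \<gamma> / (5 * l) * R * A" using onT crossTS by linarith
    finally have "R * (3 / 4 * \<mu>) \<le> R * (\<gamma> / (5 * l) * A)" by (simp add: algebra_simps)
    then have "3 / 4 * \<mu> \<le> \<gamma> / (5 * l) * A" using R by (simp only: mult_le_cancel_left_pos)
    also have "\<dots> \<le> \<gamma> / (5 * l) * (sqrt l * D)" using AD \<gamma> l by (intro mult_left_mono) auto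
    also have "\<dots> = sqrt l * (\<gamma> * D) / (5 * l)" by simp
    also have "\<dots> \<le> sqrt l * (75 / 28 * \<mu> * sqrt l) / (5 * l)"
      using Dbound l by (intro divide_right_mono mult_left_mono) auto
    also have "\<dots> = 15 / 28 * \<mu>" using l by simp
    finally show False using \<mu> by simp
  qed
  then have T0: "b j = 0" if "j \<in> T" for j
    using that fin unfolding R_def by (subst (asm) sum_nonneg_eq_0_iff) auto
  \<comment> \<open>A lost coefficient would make \<open>\<bar>\<beta> j\<bar>\<close> at most
    \<open>D\<close>, which \<open>big\<close> forbids because \<open>75/28 < 3\<close>.\<close>
  have "b j \<noteq> 0" if "j \<in> S" for j
  proof
    assume "b j = 0"
    then have "\<bar>\<beta> j\<bar> = \<bar>d j\<bar>" by (simp add: d_def)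
    also have "\<dots> \<le> D" unfolding D_def
      using that fin by (intro real_le_rsqrt) (auto intro!: member_le_sum[of j S "\<lambda>j. (d j)\<^sup>2"])
    finally have "\<gamma> * \<bar>\<beta> j\<bar> \<le> \<gamma> * D" using \<gamma> by simp
    then have "3 * sqrt l * \<mu> \<le> 75 / 28 * \<mu> * sqrt l" using big[OF that] Dbound unfolding l_def by linarith
    then have "(sqrt l * \<mu>) * (3 - 75 / 28) \<le> 0" by (simp add: algebra_simps)
    moreover have "sqrt l * \<mu> > 0" using l \<mu> by simp
    ultimately have "3 - 75 / 28 \<le> (0::real)" using mult_pos_pos[of "sqrt l * \<mu>" "3 - 75 / 28"] by linarith
    then show False by simp
  qed
  then show ?thesis using T0 S by (auto simp: T_def)
qed

section \<open>Dual quadratic forms\<close>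

text \<open>Functions on an index set take the place of matrices and vectors, so that the support
  has to be enumerated only when the link with \<open>gram_mat\<close> is made.\<close>

definition bform :: "nat set \<Rightarrow> (nat \<Rightarrow> nat \<Rightarrow> real) \<Rightarrow> (nat \<Rightarrow> real) \<Rightarrow> (nat \<Rightarrow> real) \<Rightarrow> real" where
  "bform S G u v = (\<Sum>j\<in>S. \<Sum>k\<in>S. u j * G j k * v k)"

lemma bform_commute:
  assumes "\<And>j k. j \<in> S \<Longrightarrow> k \<in> S \<Longrightarrow> G j k = G k j"
  shows "bform S G u v = bform S G v u"
  unfolding bform_def by (subst sum.swap, intro sum.cong refl) (simp add: assms)

lemma bform_line:
  assumes "bform S G u v = bform S G v u"
  shows "bform S G (\<lambda>j. u j + t * v j) (\<lambda>j. u j + t * v j)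
       = bform S G u u + 2 * t * bform S G u v + t\<^sup>2 * bform S G v v"
proof -
  have "bform S G (\<lambda>j. u j + t * v j) (\<lambda>j. u j + t * v j)
      = bform S G u u + t * bform S G u v + t * bform S G v u + t\<^sup>2 * bform S G v v"
    unfolding bform_def sum_distrib_left sum.distrib[symmetric]
    by (intro sum.cong refl) (simp add: algebra_simps power2_eq_square)
  then show ?thesis using assms by simp
qed

lemma bform_scale: "bform S G (\<lambda>j. t * u j) (\<lambda>j. t * u j) = t\<^sup>2 * bform S G u u"
  unfolding bform_def by (simp add: sum_distrib_left power2_eq_square mult_ac)

lemma bform_Cauchy_Schwarz:
  assumes sym: "bform S G u v = bform S G v u" and psd: "\<And>d. 0 \<le> bform S G d d"
  shows "(bform S G u v)\<^sup>2 \<le> bform S G u u * bform S G v v"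
proof -
  define a b c where "a = bform S G u u" and "b = bform S G u v" and "c = bform S G v v"
  have q: "0 \<le> a + 2 * t * b + t\<^sup>2 * c" for t
    using psd[of "\<lambda>j. u j + t * v j"] bform_line[OF sym] by (simp add: a_def b_def c_def)
  have c: "0 \<le> c" by (simp add: c_def psd)
  have "b\<^sup>2 \<le> a * c"
  proof (cases "c = 0")
    case True
    have "b = 0"
    proof (rule ccontr)
      assume "b \<noteq> 0"
      \<comment> \<open>With \<open>c = 0\<close> the polynomial is affine in \<open>t\<close>, and
        this witness gives it the value \<open>-1\<close>.\<close>
      then show False using q[of "- (a + 1) / (2 * b)"] True by (simp add: field_simps)
    qed
    then show ?thesis using True by simp
  next
    case False
    then have "0 \<le> (a + 2 * (- b / c) * b + (- b / c)\<^sup>2 * c) * c"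
      using q[of "- b / c"] c by (intro mult_nonneg_nonneg) auto
    also have "\<dots> = a * c - b\<^sup>2" using False by (simp add: field_simps power2_eq_square)
    finally show ?thesis by simp
  qed
  then show ?thesis by (simp add: a_def b_def c_def)
qed

text \<open>\<open>K\<close> enters through the identity \<open>G K = I\<close> on \<open>S\<close>
  alone. Its symmetry and positivity are inherited from \<open>G\<close> through
  \<open>bform_K_eq\<close>.\<close>

locale inverse_form =
  fixes S :: "nat set" and G K :: "nat \<Rightarrow> nat \<Rightarrow> real"
  assumes fin: "finite S"
    and G_sym: "\<And>j k. j \<in> S \<Longrightarrow> k \<in> S \<Longrightarrow> G j k = G k j"
    and G_psd: "\<And>d. 0 \<le> bform S G d d"
    and G_inv: "\<And>j k. j \<in> S \<Longrightarrow> k \<in> S \<Longrightarrow> (\<Sum>l\<in>S. G j l * K l k) = (if j = k then 1 else 0)"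
begin

lemma bform_G_inverse: "bform S G v (\<lambda>l. \<Sum>k\<in>S. K l k * u k) = (\<Sum>j\<in>S. v j * u j)"
proof -
  have "bform S G v (\<lambda>l. \<Sum>k\<in>S. K l k * u k) = (\<Sum>j\<in>S. v j * (\<Sum>l\<in>S. \<Sum>k\<in>S. G j l * K l k * u k))"
    by (simp add: bform_def sum_distrib_left mult.assoc)
  also have "\<dots> = (\<Sum>j\<in>S. v j * (\<Sum>k\<in>S. (\<Sum>l\<in>S. G j l * K l k) * u k))"
    unfolding sum_distrib_right by (intro sum.cong refl arg_cong2[of _ _ _ _ "(*)"] sum.swap)
  also have "\<dots> = (\<Sum>j\<in>S. v j * u j)"
    by (intro sum.cong refl) (simp add: G_inv fin if_distrib[of "\<lambda>x. x * _"] cong: if_cong)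
  finally show ?thesis .
qed

text \<open>The right side is the form of \<open>G\<close> at \<open>K v\<close> and
  \<open>K u\<close>, which collapses to the product of \<open>K v\<close> with \<open>u\<close>
  because \<open>G (K u) = u\<close>. The swapped order of the arguments avoids presupposing that
  \<open>K\<close> is symmetric.\<close>

lemma bform_K_eq: "bform S K u v
    = bform S G (\<lambda>l. \<Sum>k\<in>S. K l k * v k) (\<lambda>l. \<Sum>k\<in>S. K l k * u k)"
  unfolding bform_G_inverse by (simp add: bform_def sum_distrib_left sum_distrib_right mult_ac)

lemma K_psd: "0 \<le> bform S K u u"
  unfolding bform_K_eq by (rule G_psd)

lemma bform_K_commute: "bform S K u v = bform S K v u"
  unfolding bform_K_eq by (rule bform_commute) (rule G_sym)

text \<open>Cauchy-Schwarz for the form of \<open>G\<close>, applied to \<open>d\<close> and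
  \<open>K u\<close>: the norm of \<open>K\<close> is dual to that of \<open>G\<close>.\<close>

lemma dual_norm_le: "\<bar>\<Sum>j\<in>S. d j * u j\<bar> \<le> sqrt (bform S G d d) * sqrt (bform S K u u)"
proof -
  have "(bform S G d (\<lambda>l. \<Sum>k\<in>S. K l k * u k))\<^sup>2 \<le> bform S G d d * bform S K u u"
    unfolding bform_K_eq using G_sym by (intro bform_Cauchy_Schwarz bform_commute G_psd) auto
  then have "sqrt ((\<Sum>j\<in>S. d j * u j)\<^sup>2) \<le> sqrt (bform S G d d * bform S K u u)"
    unfolding bform_G_inverse by (rule real_sqrt_le_mono)
  then show ?thesis by (simp add: real_sqrt_mult)
qed

text \<open>By symmetry of \<open>G\<close> this is the trace of \<open>G K = I\<close>. It gives
  the expected squared \<open>K\<close>-norm of the control variates.\<close>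

lemma trace_K_G: "(\<Sum>j\<in>S. \<Sum>k\<in>S. K j k * G j k) = real (card S)"
proof -
  have "(\<Sum>j\<in>S. \<Sum>k\<in>S. K j k * G j k) = (\<Sum>k\<in>S. \<Sum>j\<in>S. G k j * K j k)"
    by (subst sum.swap, intro sum.cong refl) (simp add: G_sym mult.commute)
  then show ?thesis by (simp add: G_inv)
qed

text \<open>Put \<open>e = K u\<close>. The value \<open>q\<close> is both the product of
  \<open>e\<close> with \<open>u\<close> and the form of \<open>G\<close> at \<open>e\<close>, so
  Cauchy-Schwarz and the lower bound on \<open>G\<close> give \<open>q^2\<close> at most
  \<open>q / \<gamma>\<close> times the squared norm of \<open>u\<close>.\<close>

lemma K_le_of_G_ge:
  assumes "\<gamma> > 0" and low: "\<And>d. \<gamma> * (\<Sum>j\<in>S. (d j)\<^sup>2) \<le> bform S G d d"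
  shows "bform S K u u \<le> (\<Sum>j\<in>S. (u j)\<^sup>2) / \<gamma>"
proof -
  define e where "e = (\<lambda>l. \<Sum>k\<in>S. K l k * u k)"
  define q where "q = bform S K u u"
  have q: "q = (\<Sum>j\<in>S. e j * u j)" "q = bform S G e e" "q \<ge> 0"
    using bform_K_eq[of u u] bform_G_inverse[of e u] K_psd[of u] by (auto simp: e_def q_def)
  have "q\<^sup>2 \<le> (\<Sum>j\<in>S. (e j)\<^sup>2) * (\<Sum>j\<in>S. (u j)\<^sup>2)"
    unfolding q(1) by (rule Cauchy_Schwarz_ineq_sum)
  also have "\<dots> \<le> (q / \<gamma>) * (\<Sum>j\<in>S. (u j)\<^sup>2)"
    using low[of e] \<open>\<gamma> > 0\<close> unfolding q(2)[symmetric]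
    by (intro mult_right_mono) (auto simp: field_simps sum_nonneg)
  finally have "q * q \<le> q * ((\<Sum>j\<in>S. (u j)\<^sup>2) / \<gamma>)" by (simp add: power2_eq_square)
  moreover have "0 \<le> (\<Sum>j\<in>S. (u j)\<^sup>2) / \<gamma>" using \<open>\<gamma> > 0\<close> by (simp add: sum_nonneg)
  ultimately show ?thesis using q(3) unfolding q_def[symmetric]
    by (metis less_le mult_le_cancel_left_pos)
qed

end

section \<open>Least squares\<close>

text \<open>Moving the intercept or one coefficient by \<open>t\<close> changes the residual by
  \<open>t\<close> times the constant 1 or one regressor; \<open>linear_term_zero\<close> is the
  resulting first-order condition.\<close>

lemma is_ols_normal_equations:
  assumes ols: "is_ols f h x n S a b" and fin: "finite S"
  defines "r \<equiv> \<lambda>i. f (x i) - a - (\<Sum>j\<in>S. b j * h j (x i))"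
  shows "(\<Sum>i<n. r i) = 0" and "k \<in> S \<Longrightarrow> (\<Sum>i<n. h k (x i) * r i) = 0"
proof -
  have expand: "(\<Sum>i<n. (r i - t * z i)\<^sup>2)
      = (\<Sum>i<n. (r i)\<^sup>2) + (t\<^sup>2 * (\<Sum>i<n. (z i)\<^sup>2) - 2 * t * (\<Sum>i<n. z i * r i))" for t and z :: "nat \<Rightarrow> real"
    by (simp add: power2_diff sum.distrib sum_subtractf sum_distrib_left power_mult_distrib mult_ac)
  show "(\<Sum>i<n. r i) = 0"
  proof (rule linear_term_zero)
    fix t :: real
    have "(\<Sum>i<n. (r i)\<^sup>2) \<le> (\<Sum>i<n. (r i - t * 1)\<^sup>2)"
      using ols[unfolded is_ols_def, rule_format, of "a + t" b] by (simp add: r_def algebra_simps)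
    then show "0 \<le> t\<^sup>2 * (\<Sum>i<n. 1\<^sup>2) - 2 * t * (\<Sum>i<n. r i)" unfolding expand by simp
  qed
  show "(\<Sum>i<n. h k (x i) * r i) = 0" if k: "k \<in> S"
  proof (rule linear_term_zero)
    fix t :: real
    have "(\<Sum>j\<in>S. (b(k := b k + t)) j * h j (x i)) = (\<Sum>j\<in>S. b j * h j (x i)) + t * h k (x i)" for i
      using k fin by (subst (1 2) sum.remove[of _ k]) (auto simp: algebra_simps intro!: sum.cong)
    then have "(\<Sum>i<n. (r i)\<^sup>2) \<le> (\<Sum>i<n. (r i - t * h k (x i))\<^sup>2)"
      using ols[unfolded is_ols_def, rule_format, of a "b(k := b k + t)"] by (simp add: r_def algebra_simps)
    then show "0 \<le> t\<^sup>2 * (\<Sum>i<n. (h k (x i))\<^sup>2) - 2 * t * (\<Sum>i<n. h k (x i) * r i)"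
      unfolding expand by simp
  qed
qed

text \<open>Let \<open>d\<close> be the coefficient error and \<open>s\<close> its product with the
  mean of \<open>h\<close>. The first normal equation says \<open>a - p = eb - s\<close>; the others
  say that the empirical Gram matrix maps \<open>d\<close> to \<open>w - (a - p) mu\<close>. Pairing
  the latter with \<open>d\<close> and inserting the former leaves the product of \<open>d\<close>
  with \<open>w\<close>, minus \<open>eb * s\<close>, plus \<open>s^2\<close>. The square is the
  price of the uncentred Gram matrix and is absorbed because \<open>M\<close> is small.\<close>

lemma (in inverse_form) ols_intercept_error:
  fixes h :: "nat \<Rightarrow> 'a \<Rightarrow> real"
  defines "avg \<equiv> \<lambda>n x g. (\<Sum>i<n. g (x i :: 'a)) / real n"
  assumes ols: "is_ols f h x n S a b" and n: "n > 0"
    and model: "\<And>i. i < n \<Longrightarrow> f (x i) = p + (\<Sum>j\<in>S. \<beta> j * h j (x i)) + e (x i)"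
    and low: "\<And>d. 4 / 5 * bform S G d d \<le> bform S (\<lambda>j k. avg n x (\<lambda>y. h j y * h k y)) d d"
    and M: "sqrt (bform S K (\<lambda>j. avg n x (h j)) (\<lambda>j. avg n x (h j))) \<le> M" "M\<^sup>2 \<le> 3 / 10"
    and V: "sqrt (bform S K (\<lambda>j. avg n x (\<lambda>y. h j y * e y)) (\<lambda>j. avg n x (\<lambda>y. h j y * e y))) \<le> V"
    and E: "\<bar>avg n x e\<bar> \<le> E"
  shows "\<bar>a - p\<bar> \<le> E + 2 * M * (V + M * E)"
proof -
  define d where "d j = b j - \<beta> j" for j
  define mu where "mu j = avg n x (h j)" for j
  define w where "w j = avg n x (\<lambda>y. h j y * e y)" for j
  define eb where "eb = avg n x e"
  define r where "r i = f (x i) - a - (\<Sum>j\<in>S. b j * h j (x i))" for i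
  have r: "r i = e (x i) - (a - p) - (\<Sum>j\<in>S. d j * h j (x i))" if "i < n" for i
    using model[OF that] by (simp add: r_def d_def algebra_simps sum_subtractf)
  have "(\<Sum>i<n. r i) / real n = 0"
    using is_ols_normal_equations(1)[OF ols fin] by (simp add: r_def)
  moreover have "(\<Sum>i<n. r i) / real n = eb - (a - p) - (\<Sum>j\<in>S. d j * mu j)"
  proof -
    have "(\<Sum>i<n. \<Sum>j\<in>S. d j * h j (x i)) = (\<Sum>j\<in>S. d j * (\<Sum>i<n. h j (x i)))"
      by (subst sum.swap) (simp add: sum_distrib_left)
    then show ?thesis using n
      by (simp add: r sum_subtractf eb_def mu_def avg_def diff_divide_distrib sum_divide_distrib[of _ S])
  qed
  ultimately have a: "a - p = eb - (\<Sum>j\<in>S. d j * mu j)" by simp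
  have row: "(\<Sum>k\<in>S. avg n x (\<lambda>y. h j y * h k y) * d k) = w j - (a - p) * mu j" if j: "j \<in> S" for j
  proof -
    have "0 = (\<Sum>i<n. h j (x i) * r i) / real n"
      using is_ols_normal_equations(2)[OF ols fin j] by (simp add: r_def)
    also have "(\<Sum>i<n. h j (x i) * r i)
        = (\<Sum>i<n. h j (x i) * e (x i) - (a - p) * h j (x i) - (\<Sum>k\<in>S. h j (x i) * h k (x i) * d k))"
      by (intro sum.cong refl) (simp add: r algebra_simps sum_distrib_left)
    also have "\<dots> / real n = w j - (a - p) * mu j - (\<Sum>i<n. \<Sum>k\<in>S. h j (x i) * h k (x i) * d k) / real n"
      by (simp add: sum_subtractf w_def mu_def avg_def diff_divide_distrib flip: sum_distrib_left)
    also have "(\<Sum>i<n. \<Sum>k\<in>S. h j (x i) * h k (x i) * d k) / real n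
        = (\<Sum>k\<in>S. avg n x (\<lambda>y. h j y * h k y) * d k)"
      by (subst sum.swap) (simp add: avg_def sum_divide_distrib sum_distrib_right)
    finally show ?thesis by simp
  qed
  define D where "D = sqrt (bform S G d d)"
  define s where "s = (\<Sum>j\<in>S. d j * mu j)"
  have D0: "D \<ge> 0" by (simp add: D_def G_psd)
  have M0: "M \<ge> 0" and V0: "V \<ge> 0" and E0: "E \<ge> 0"
    using M(1) V E K_psd by (meson order_trans real_sqrt_ge_zero abs_ge_zero)+
  have s: "\<bar>s\<bar> \<le> D * M"
  proof -
    have "\<bar>s\<bar> \<le> D * sqrt (bform S K mu mu)" unfolding s_def D_def by (rule dual_norm_le)
    also have "\<dots> \<le> D * M" using M(1) D0 by (intro mult_left_mono) (simp_all add: mu_def[abs_def])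
    finally show ?thesis .
  qed
  have v: "\<bar>\<Sum>j\<in>S. d j * w j\<bar> \<le> D * V"
  proof -
    have "\<bar>\<Sum>j\<in>S. d j * w j\<bar> \<le> D * sqrt (bform S K w w)" unfolding D_def by (rule dual_norm_le)
    also have "\<dots> \<le> D * V" using V D0 by (intro mult_left_mono) (simp_all add: w_def[abs_def])
    finally show ?thesis .
  qed
  have "4 / 5 * D\<^sup>2 \<le> bform S (\<lambda>j k. avg n x (\<lambda>y. h j y * h k y)) d d"
    using low[of d] by (simp add: D_def G_psd)
  also have "\<dots> = (\<Sum>j\<in>S. d j * (w j - (a - p) * mu j))"
    by (simp add: bform_def row[symmetric] sum_distrib_left mult.assoc)
  also have "\<dots> = (\<Sum>j\<in>S. d j * w j) - (a - p) * s"
    by (simp add: s_def right_diff_distrib sum_subtractf sum_distrib_left mult.left_commute)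
  also have "\<dots> = (\<Sum>j\<in>S. d j * w j) - eb * s + s\<^sup>2"
    by (simp add: a s_def algebra_simps power2_eq_square)
  \<comment> \<open>The threshold \<open>3/10\<close> for \<open>M^2\<close> leaves
    \<open>4/5 - 3/10 = 1/2\<close> on the left, whence the factor 2 in the bound on
    \<open>D\<close>.\<close>
  also have "\<dots> \<le> D * V + E * (D * M) + 3 / 10 * D\<^sup>2"
  proof -
    have "\<bar>eb * s\<bar> \<le> E * (D * M)"
      unfolding abs_mult using E s E0 by (intro mult_mono) (auto simp: eb_def)
    moreover have "s\<^sup>2 \<le> (D * M)\<^sup>2" using s by (simp add: abs_le_square_iff[symmetric] D0 M0)
    moreover have "(D * M)\<^sup>2 \<le> D\<^sup>2 * (3 / 10)"
      unfolding power_mult_distrib using M(2) by (intro mult_left_mono) auto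
    ultimately show ?thesis using v by linarith
  qed
  finally have "D * D \<le> D * (2 * (V + M * E))" by (simp add: power2_eq_square algebra_simps)
  then have "D \<le> 2 * (V + M * E)"
    using D0 M0 V0 E0 by (cases "D = 0") (auto simp: mult_le_cancel_left)
  then have "\<bar>s\<bar> \<le> 2 * (V + M * E) * M" using s M0 by (meson mult_right_mono order_trans)
  then show ?thesis using a E by (simp add: s_def eb_def algebra_simps abs_le_iff)
qed

section \<open>Smallest eigenvalue and inverse of a Gram matrix\<close>

lemma bform_matrix:
  assumes "A \<in> carrier_mat n n" "x \<in> carrier_vec n" "y \<in> carrier_vec n"
  shows "scalar_prod x (A *\<^sub>v y) = bform {..<n} (\<lambda>i j. A $$ (i, j)) (($) x) (($) y)"
  using assms
  by (auto simp: bform_def scalar_prod_def mult_mat_vec_def row_def sum_distrib_left lessThan_atLeast0 mult.assoc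
      intro!: sum.cong)

text \<open>The infimum \<open>\<mu>\<close> of the Rayleigh quotient is shown to be an eigenvalue
  without a compactness argument. If \<open>A - \<mu> I\<close> were invertible, Cauchy-Schwarz for
  its semidefinite form would bound that form away from 0 on the unit sphere, so
  \<open>\<mu>\<close> could be raised. Hence \<open>min_eigenvalue A\<close> is at most
  \<open>\<mu>\<close>, which gives the lower bound, and definiteness at an eigenvector gives
  positivity.\<close>

lemma symmetric_min_eigenvalue:
  fixes A :: "real mat"
  assumes A: "A \<in> carrier_mat n n" and n: "n > 0"
    and sym: "\<And>i j. i < n \<Longrightarrow> j < n \<Longrightarrow> A $$ (i, j) = A $$ (j, i)"
    and pd: "\<And>x i. i < n \<Longrightarrow> x i \<noteq> 0 \<Longrightarrow> 0 < bform {..<n} (\<lambda>i j. A $$ (i, j)) x x"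
  shows "0 < min_eigenvalue A"
    and "min_eigenvalue A * (\<Sum>i<n. (x i)\<^sup>2) \<le> bform {..<n} (\<lambda>i j. A $$ (i, j)) x x"
proof -
  let ?q = "\<lambda>x. bform {..<n} (\<lambda>i j. A $$ (i, j)) x x"
  have psd: "0 \<le> ?q x" for x
  proof (cases "\<exists>i<n. x i \<noteq> 0")
    case True then show ?thesis using pd less_imp_le by blast
  next
    case False then show ?thesis by (simp add: bform_def)
  qed
  define R where "R = ?q ` {x. (\<Sum>i<n. (x i)\<^sup>2) = 1}"
  define \<mu> where "\<mu> = Inf R"
  have bdd: "bdd_below R" unfolding R_def by (rule bdd_belowI[of _ 0]) (auto simp: psd)
  have "(\<lambda>i. if i = 0 then 1 else 0) \<in> {x :: nat \<Rightarrow> real. (\<Sum>i<n. (x i)\<^sup>2) = 1}"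
    using n by (simp add: if_distrib[of "\<lambda>x. x\<^sup>2"] cong: if_cong)
  then have ne: "R \<noteq> {}" unfolding R_def image_is_empty by (metis empty_iff)
  have low: "\<mu> * (\<Sum>i<n. (x i)\<^sup>2) \<le> ?q x" for x
  proof (cases "(\<Sum>i<n. (x i)\<^sup>2) = 0")
    case True then show ?thesis using psd by simp
  next
    case False
    define s where "s = (\<Sum>i<n. (x i)\<^sup>2)"
    have s: "s > 0" using False by (simp add: s_def sum_nonneg less_le)
    have "(\<Sum>i<n. (1 / sqrt s * x i)\<^sup>2) = (1 / sqrt s)\<^sup>2 * s"
      unfolding s_def power_mult_distrib by (simp add: sum_distrib_left)
    also have "\<dots> = 1" using s by (simp add: power_divide)
    finally have "?q (\<lambda>i. 1 / sqrt s * x i) \<in> R" unfolding R_def by (intro imageI) simp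
    then have "\<mu> \<le> ?q (\<lambda>i. 1 / sqrt s * x i)" unfolding \<mu>_def using bdd by (rule cInf_lower)
    also have "\<dots> = ?q x / s" unfolding bform_scale using s by (simp add: power_divide)
    finally show ?thesis using s by (simp add: field_simps s_def)
  qed
  define M where "M = char_matrix A \<mu>"
  have M: "M \<in> carrier_mat n n" and Mij: "\<And>i j. i < n \<Longrightarrow> j < n \<Longrightarrow> M $$ (i, j) = A $$ (i, j) - (if i = j then \<mu> else 0)"
    using A by (auto simp: M_def char_matrix_def)
  let ?p = "\<lambda>x y. bform {..<n} (\<lambda>i j. M $$ (i, j)) x y"
  have p: "?p x x = ?q x - \<mu> * (\<Sum>i<n. (x i)\<^sup>2)" for x
  proof -
    have "?p x x = (\<Sum>i<n. \<Sum>j<n. x i * A $$ (i, j) * x j - (if i = j then \<mu> * (x i * x j) else 0))"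
      unfolding bform_def by (intro sum.cong refl) (auto simp: Mij algebra_simps)
    also have "\<dots> = ?q x - (\<Sum>i<n. \<mu> * (x i * x i))"
      by (simp add: bform_def sum_subtractf)
    finally show ?thesis by (simp add: power2_eq_square sum_distrib_left)
  qed
  have p_psd: "0 \<le> ?p x x" for x using low[of x] p by simp
  have p_comm: "?p x y = ?p y x" for x y
    by (rule bform_commute) (auto simp: Mij sym)
  have "det M = 0"
  proof (rule ccontr)
    assume "det M \<noteq> 0"
    from det_non_zero_imp_unit[OF M this, of "()"] obtain N where N: "N \<in> carrier_mat n n" "M * N = 1\<^sub>m n"
      unfolding Units_def ring_mat_def by auto
    \<comment> \<open>A crude bound for the form of the inverse \<open>N\<close> on the unit sphere,
      where every coordinate is at most 1 in absolute value.\<close>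
    define c where "c = (\<Sum>i<n. \<Sum>j<n. \<bar>N $$ (i, j)\<bar>)"
    \<comment> \<open>Cauchy-Schwarz for \<open>?p\<close> at \<open>v\<close> and
      \<open>N v\<close>: since \<open>M N = I\<close>, the mixed value is the squared norm of
      \<open>v\<close> and the value at \<open>N v\<close> is the form of \<open>N\<close> at
      \<open>v\<close>.\<close>
    have key: "1 \<le> ?p x x * c" if x: "(\<Sum>i<n. (x i)\<^sup>2) = 1" for x
    proof -
      define v where "v = vec n x"
      have v: "v \<in> carrier_vec n" and vi: "\<And>i. i < n \<Longrightarrow> v $ i = x i" by (auto simp: v_def)
      let ?y = "N *\<^sub>v v"
      have y: "?y \<in> carrier_vec n" using N v by simp
      have eq: "scalar_prod w (M *\<^sub>v ?y) = scalar_prod w v" for w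
        using N M v by (simp flip: assoc_mult_mat_vec)
      have "(scalar_prod v v)\<^sup>2 = (?p (($) v) (($) ?y))\<^sup>2"
        using bform_matrix[OF M v y] eq by simp
      also have "\<dots> \<le> ?p (($) v) (($) v) * ?p (($) ?y) (($) ?y)"
        by (rule bform_Cauchy_Schwarz[OF p_comm p_psd])
      also have "?p (($) ?y) (($) ?y) = scalar_prod ?y v" using bform_matrix[OF M y y] eq by simp
      also have "\<dots> = scalar_prod v ?y" using v y by (rule comm_scalar_prod[symmetric])
      also have "\<dots> = bform {..<n} (\<lambda>i j. N $$ (i, j)) x x"
        unfolding bform_matrix[OF N(1) v v] by (simp add: bform_def vi)
      also have "?p (($) v) (($) v) = ?p x x" by (simp add: bform_def vi)
      also have "scalar_prod v v = 1" using x by (simp add: scalar_prod_def vi v_def power2_eq_square lessThan_atLeast0)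
      finally have 1: "1 \<le> ?p x x * bform {..<n} (\<lambda>i j. N $$ (i, j)) x x" by simp
      have le1: "\<bar>x i\<bar> \<le> 1" if "i < n" for i
      proof -
        have "(x i)\<^sup>2 \<le> 1" unfolding x[symmetric] using that by (intro member_le_sum) auto
        then show ?thesis by (simp add: abs_square_le_1)
      qed
      have "bform {..<n} (\<lambda>i j. N $$ (i, j)) x x \<le> c"
        unfolding bform_def c_def
      proof (intro sum_mono)
        fix i j assume "i \<in> {..<n}" "j \<in> {..<n}"
        then have "\<bar>x i\<bar> * \<bar>N $$ (i, j)\<bar> * \<bar>x j\<bar> \<le> 1 * \<bar>N $$ (i, j)\<bar> * 1"
          using le1 by (intro mult_mono) auto
        then show "x i * N $$ (i, j) * x j \<le> \<bar>N $$ (i, j)\<bar>"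
          using abs_ge_self[of "x i * N $$ (i, j) * x j"] by (simp add: abs_mult)
      qed
      then show ?thesis using 1 p_psd[of x] by (meson mult_left_mono order_trans)
    qed
    have c0: "c \<ge> 0" by (simp add: c_def sum_nonneg)
    obtain z where "z \<in> R" using ne by blast
    then obtain x :: "nat \<Rightarrow> real" where "(\<Sum>i<n. (x i)\<^sup>2) = 1" by (auto simp: R_def)
    from key[OF this] have c: "c > 0" using c0 by (cases "c = 0") auto
    have "\<mu> + 1 / c \<le> z" if "z \<in> R" for z
    proof -
      from that obtain x where x: "z = ?q x" "(\<Sum>i<n. (x i)\<^sup>2) = 1" by (auto simp: R_def)
      from key[OF x(2)] have "1 / c \<le> ?p x x" using c by (simp add: field_simps)
      then show ?thesis using x p[of x] by simp
    qed
    then have "\<mu> + 1 / c \<le> \<mu>" unfolding \<mu>_def using ne by (intro cInf_greatest) auto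
    then show False using c by simp
  qed
  then have ev: "eigenvalue A \<mu>" using eigenvalue_det[OF A] by (simp add: M_def)
  \<comment> \<open>Finiteness and the eigenvalue \<open>\<mu>\<close> together make the
    \<open>Min\<close> in \<open>min_eigenvalue\<close> a true minimum.\<close>
  have fin: "finite {e. eigenvalue A e}"
    using degree_monic_char_poly[OF A] unfolding eigenvalue_root_char_poly[OF A]
    by (intro poly_roots_finite) auto
  have le: "min_eigenvalue A \<le> \<mu>" unfolding min_eigenvalue_def using fin ev by (intro Min_le) auto
  have "min_eigenvalue A * (\<Sum>i<n. (x i)\<^sup>2) \<le> \<mu> * (\<Sum>i<n. (x i)\<^sup>2)"
    using le by (intro mult_right_mono sum_nonneg) auto
  then show "min_eigenvalue A * (\<Sum>i<n. (x i)\<^sup>2) \<le> ?q x" using low[of x] by linarith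
  have "min_eigenvalue A \<in> {e. eigenvalue A e}"
    unfolding min_eigenvalue_def using fin ev by (intro Min_in) auto
  then obtain v where v: "v \<in> carrier_vec n" "v \<noteq> 0\<^sub>v n" "A *\<^sub>v v = min_eigenvalue A \<cdot>\<^sub>v v"
    using A by (auto simp: eigenvalue_def eigenvector_def)
  then obtain i where i: "i < n" "v $ i \<noteq> 0"
    by (metis carrier_vecD eq_vecI index_zero_vec)
  have "0 < ?q (($) v)" using pd i by blast
  also have "\<dots> = scalar_prod v (A *\<^sub>v v)" using bform_matrix[OF A v(1) v(1)] by simp
  also have "\<dots> = min_eigenvalue A * (scalar_prod v v)" using v by simp
  finally have "0 < min_eigenvalue A * (scalar_prod v v)" .
  moreover have "0 \<le> scalar_prod v v" by (auto simp: scalar_prod_def intro!: sum_nonneg)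
  ultimately show "0 < min_eigenvalue A" by (simp add: zero_less_mult_iff)
qed

lemma sum_idx: "finite S \<Longrightarrow> (\<Sum>i<card S. F (idx S ! i)) = (\<Sum>j\<in>S. F j)"
  using sum.reindex_bij_betw[OF bij_betw_nth, of "idx S" "{..<card S}" S F] by (simp add: idx_def)

text \<open>The bridge between forms over \<open>S\<close> and matrices, by transport along the
  increasing enumeration \<open>idx S\<close>. Definiteness rules out a kernel vector, so
  \<open>A\<close> is nonsingular and \<open>mat_inverse A\<close> is a proper \<open>Some\<close>;
  reindexing its entries by \<open>pos\<close> gives \<open>K\<close>.\<close>

lemma gram_matrix_form:
  fixes G :: "nat \<Rightarrow> nat \<Rightarrow> real"
  assumes S: "finite S" "S \<noteq> {}"
    and sym: "\<And>j k. j \<in> S \<Longrightarrow> k \<in> S \<Longrightarrow> G j k = G k j"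
    and pd: "\<And>x j. j \<in> S \<Longrightarrow> x j \<noteq> 0 \<Longrightarrow> 0 < bform S G x x"
  defines "A \<equiv> mat (card S) (card S) (\<lambda>(i, k). G (idx S ! i) (idx S ! k))"
  obtains K where "0 < min_eigenvalue A"
    and "\<And>x. min_eigenvalue A * (\<Sum>j\<in>S. (x j)\<^sup>2) \<le> bform S G x x"
    and "inverse_form S G K"
    and "\<And>x. scalar_prod (vec (card S) (\<lambda>i. x (idx S ! i))) (the (mat_inverse A) *\<^sub>v vec (card S) (\<lambda>i. x (idx S ! i)))
             = bform S K x x"
proof -
  define n where "n = card S"
  define pos where "pos = the_inv_into {..<n} (\<lambda>i. idx S ! i)"
  have bij: "bij_betw (\<lambda>i. idx S ! i) {..<n} S"
    using S by (intro bij_betw_nth) (auto simp: idx_def n_def)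
  have pos: "pos (idx S ! i) = i" if "i < n" for i
    using bij that by (simp add: pos_def bij_betw_def the_inv_into_f_f)
  have pos': "idx S ! pos j = j" "pos j < n" if "j \<in> S" for j
    using bij that the_inv_into_into[of "\<lambda>i. idx S ! i" "{..<n}" j "{..<n}"]
    by (auto simp: pos_def bij_betw_def f_the_inv_into_f)
  have inS: "idx S ! i \<in> S" if "i < n" for i using bij that by (auto simp: bij_betw_def)
  have A: "A \<in> carrier_mat n n" and Aij: "\<And>i k. i < n \<Longrightarrow> k < n \<Longrightarrow> A $$ (i, k) = G (idx S ! i) (idx S ! k)"
    by (auto simp: A_def n_def)
  have n0: "n > 0" using S by (simp add: n_def card_gt_0_iff)
  have tr: "bform {..<n} (\<lambda>i k. F (idx S ! i) (idx S ! k)) (\<lambda>i. x (idx S ! i)) (\<lambda>i. x (idx S ! i)) = bform S F x x"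
    for F :: "nat \<Rightarrow> nat \<Rightarrow> real" and x
    unfolding bform_def n_def
    by (simp add: sum_idx[OF S(1), of "\<lambda>k. x j * F j k * x k" for j] sum_idx[OF S(1), of "\<lambda>j. \<Sum>k\<in>S. x j * F j k * x k"])
  have trA: "bform {..<n} (\<lambda>i k. A $$ (i, k)) (\<lambda>i. x (idx S ! i)) (\<lambda>i. x (idx S ! i)) = bform S G x x" for x
    unfolding tr[symmetric] by (simp add: bform_def Aij)
  have Asym: "A $$ (i, j) = A $$ (j, i)" if "i < n" "j < n" for i j
    using that by (simp add: Aij sym inS)
  have Apd: "0 < bform {..<n} (\<lambda>i j. A $$ (i, j)) y y" if "i < n" "y i \<noteq> 0" for y i
  proof -
    have "bform {..<n} (\<lambda>i j. A $$ (i, j)) y y = bform S G (\<lambda>j. y (pos j)) (\<lambda>j. y (pos j))"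
      unfolding trA[symmetric] by (simp add: bform_def pos)
    also have "\<dots> > 0" using that by (intro pd[of "idx S ! i"]) (auto simp: pos inS)
    finally show ?thesis .
  qed
  have me: "0 < min_eigenvalue A"
    by (rule symmetric_min_eigenvalue(1)[OF A n0]) (use Asym Apd in blast)+
  have me': "min_eigenvalue A * (\<Sum>i<n. (y i)\<^sup>2) \<le> bform {..<n} (\<lambda>i j. A $$ (i, j)) y y" for y
    by (rule symmetric_min_eigenvalue(2)[OF A n0]) (use Asym Apd in blast)+
  have low: "min_eigenvalue A * (\<Sum>j\<in>S. (x j)\<^sup>2) \<le> bform S G x x" for x
    using me'[of "\<lambda>i. x (idx S ! i)"] unfolding trA by (simp add: n_def sum_idx[OF S(1), of "\<lambda>j. (x j)\<^sup>2"])
  have "det A \<noteq> 0"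
  proof
    assume "det A = 0"
    then obtain v where v: "v \<in> carrier_vec n" "v \<noteq> 0\<^sub>v n" "A *\<^sub>v v = 0\<^sub>v n"
      using det_0_iff_vec_prod_zero_field[OF A] by auto
    then obtain i where i: "i < n" "v $ i \<noteq> 0"
      by (metis carrier_vecD eq_vecI index_zero_vec)
    have "0 < scalar_prod v (A *\<^sub>v v)" unfolding bform_matrix[OF A v(1) v(1)] using Apd i by blast
    then show False using v by simp
  qed
  from det_non_zero_imp_unit[OF A this, of "()"] mat_inverse(1)[OF A, of "()"]
  obtain B where B: "mat_inverse A = Some B" by blast
  from mat_inverse(2)[OF A this] have AB: "A * B = 1\<^sub>m n" and Bc: "B \<in> carrier_mat n n" by auto
  define K where "K j k = B $$ (pos j, pos k)" for j k
  have "inverse_form S G K"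
  proof
    show "finite S" by fact
    show "G j k = G k j" if "j \<in> S" "k \<in> S" for j k using sym that by blast
    show "0 \<le> bform S G d d" for d
    proof -
      have "0 \<le> min_eigenvalue A * (\<Sum>j\<in>S. (d j)\<^sup>2)" using me by (simp add: sum_nonneg)
      then show ?thesis using low[of d] by linarith
    qed
    fix j k assume jk: "j \<in> S" "k \<in> S"
    have "(\<Sum>l\<in>S. G j l * K l k) = (\<Sum>i<n. A $$ (pos j, i) * B $$ (i, pos k))"
      unfolding n_def sum_idx[OF S(1), symmetric] using jk
      by (intro sum.cong refl) (simp add: K_def pos pos' Aij flip: n_def)
    also have "\<dots> = (A * B) $$ (pos j, pos k)"
      using A Bc pos'(2) jk by (simp add: scalar_prod_def lessThan_atLeast0)
    also have "\<dots> = (if j = k then 1 else 0)"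
      unfolding AB using pos' jk by (auto) metis
    finally show "(\<Sum>l\<in>S. G j l * K l k) = (if j = k then 1 else 0)" .
  qed
  moreover have "scalar_prod (vec (card S) (\<lambda>i. x (idx S ! i))) (the (mat_inverse A) *\<^sub>v vec (card S) (\<lambda>i. x (idx S ! i)))
      = bform S K x x" for x
  proof -
    have "scalar_prod (vec n (\<lambda>i. x (idx S ! i))) (B *\<^sub>v vec n (\<lambda>i. x (idx S ! i)))
      = bform {..<n} (\<lambda>i j. B $$ (i, j)) (\<lambda>i. x (idx S ! i)) (\<lambda>i. x (idx S ! i))"
      by (subst bform_matrix[OF Bc]) (auto simp: bform_def)
    also have "\<dots> = bform S K x x" unfolding tr[symmetric] by (simp add: bform_def K_def pos)
    finally show ?thesis by (simp add: B n_def)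
  qed
  ultimately show thesis using that me low by blast
qed

section \<open>Concentration of empirical means\<close>

lemma borel_measurable_component:
  assumes "g \<in> borel_measurable P" "i \<in> I"
  shows "(\<lambda>x. g (x i)) \<in> borel_measurable (PiM I (\<lambda>_. P))"
  using measurable_compose[OF measurable_component_singleton[OF assms(2), of "\<lambda>_. P"] assms(1)] by simp

text \<open>A supermartingale estimate: the last coordinate is integrated out first, with the sum of
  the others as the fixed \<open>s\<close> of the hypothesis \<open>step\<close>. Nonnegative
  integrals avoid integrability questions for \<open>\<Phi>\<close>.\<close>

lemma nn_integral_PiM_sum_le:
  fixes P :: "'a measure" and v :: "'a \<Rightarrow> 'i \<Rightarrow> real" and \<Phi> :: "('i \<Rightarrow> real) \<Rightarrow> real"
  assumes P: "prob_space P" and C: "0 \<le> C"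
    and step: "\<And>s. (\<integral>\<^sup>+y. ennreal (\<Phi> (\<lambda>j. s j + v y j)) \<partial>P) \<le> ennreal (C * \<Phi> s)"
    and meas: "\<And>k::nat. (\<lambda>x. \<Phi> (\<lambda>j. \<Sum>i<k. v (x i) j)) \<in> borel_measurable (PiM {..<k} (\<lambda>_. P))"
  shows "(\<integral>\<^sup>+x. ennreal (\<Phi> (\<lambda>j. \<Sum>i<k. v (x i) j)) \<partial>PiM {..<k} (\<lambda>_. P)) \<le> ennreal (C ^ k * \<Phi> (\<lambda>_. 0))"
proof (induction k)
  interpret product_sigma_finite "\<lambda>_. P"
    using P by (simp add: product_sigma_finite_def prob_space_imp_sigma_finite)
  case 0
  show ?case by (simp add: PiM_empty nn_integral_count_space_finite)
next
  interpret product_sigma_finite "\<lambda>_. P"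
    using P by (simp add: product_sigma_finite_def prob_space_imp_sigma_finite)
  case (Suc k)
  let ?F = "\<lambda>k x. ennreal (\<Phi> (\<lambda>j. \<Sum>i<k. v (x i) j))"
  have "(\<integral>\<^sup>+x. ?F (Suc k) x \<partial>PiM {..<Suc k} (\<lambda>_. P))
      = (\<integral>\<^sup>+x. (\<integral>\<^sup>+y. ?F (Suc k) (x(k := y)) \<partial>P) \<partial>PiM {..<k} (\<lambda>_. P))"
    unfolding lessThan_Suc
    by (rule product_nn_integral_insert) (use meas[of "Suc k"] in \<open>simp_all add: lessThan_Suc\<close>)
  also have "\<dots> \<le> (\<integral>\<^sup>+x. ennreal C * ?F k x \<partial>PiM {..<k} (\<lambda>_. P))"
  proof (intro nn_integral_mono)
    fix x :: "nat \<Rightarrow> 'a"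
    have "(\<lambda>j. \<Sum>i<Suc k. v ((x(k := y)) i) j) = (\<lambda>j. (\<Sum>i<k. v (x i) j) + v y j)" for y
      by (auto simp: fun_eq_iff)
    then show "(\<integral>\<^sup>+y. ?F (Suc k) (x(k := y)) \<partial>P) \<le> ennreal C * ?F k x"
      using step[of "\<lambda>j. \<Sum>i<k. v (x i) j"] C by (simp add: ennreal_mult')
  qed
  also have "\<dots> = ennreal C * (\<integral>\<^sup>+x. ?F k x \<partial>PiM {..<k} (\<lambda>_. P))"
    by (rule nn_integral_cmult) (use meas[of k] in measurable)
  also have "\<dots> \<le> ennreal C * ennreal (C ^ k * \<Phi> (\<lambda>_. 0))"
    by (intro mult_left_mono Suc.IH) auto
  also have "\<dots> = ennreal (C ^ Suc k * \<Phi> (\<lambda>_. 0))"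
    using C by (simp add: ennreal_mult' mult.assoc)
  finally show ?case .
qed

lemma subgaussian_integral_cosh:
  assumes "subgaussian P e s"
  shows "integrable P (\<lambda>x. cosh (c * e x))" "(\<integral>x. cosh (c * e x) \<partial>P) \<le> exp (c\<^sup>2 * s / 2)"
proof -
  have int: "integrable P (\<lambda>x. exp (c * e x))" "integrable P (\<lambda>x. exp (- c * e x))"
    and le: "(\<integral>x. exp (c * e x) \<partial>P) \<le> exp (c\<^sup>2 * s / 2)" "(\<integral>x. exp (- c * e x) \<partial>P) \<le> exp ((- c)\<^sup>2 * s / 2)"
    using assms unfolding subgaussian_def by blast+
  have eq: "(\<lambda>x. cosh (c * e x)) = (\<lambda>x. (exp (c * e x) + exp (- c * e x)) / 2)"
    by (simp add: cosh_field_def fun_eq_iff)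
  show "integrable P (\<lambda>x. cosh (c * e x))" unfolding eq using int by simp
  show "(\<integral>x. cosh (c * e x) \<partial>P) \<le> exp (c\<^sup>2 * s / 2)" unfolding eq using int le by simp
qed

lemma subgaussian_uminus: "subgaussian P e s \<Longrightarrow> subgaussian P (\<lambda>x. - e x) s"
  unfolding subgaussian_def
proof (intro allI)
  fix l assume "\<forall>l. integrable P (\<lambda>x. exp (l * e x)) \<and> (\<integral>x. exp (l * e x) \<partial>P) \<le> exp (l\<^sup>2 * s / 2)"
  from this[rule_format, of "-l"]
  show "integrable P (\<lambda>x. exp (l * - e x)) \<and> (\<integral>x. exp (l * - e x) \<partial>P) \<le> exp (l\<^sup>2 * s / 2)" by simp
qed

lemma integrable_mult_bounded:
  fixes e g :: "'a \<Rightarrow> real"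
  assumes "integrable P e" "g \<in> borel_measurable P" "\<And>x. x \<in> space P \<Longrightarrow> \<bar>g x\<bar> \<le> U"
  shows "integrable P (\<lambda>x. g x * e x)"
proof (rule Bochner_Integration.integrable_bound)
  show "integrable P (\<lambda>x. U * \<bar>e x\<bar>)" using assms by simp
  show "(\<lambda>x. g x * e x) \<in> borel_measurable P" using assms by measurable
  show "AE x in P. norm (g x * e x) \<le> norm (U * \<bar>e x\<bar>)"
  proof (rule AE_I2)
    fix x assume "x \<in> space P"
    then have "\<bar>g x\<bar> \<le> U" by (rule assms(3))
    then show "norm (g x * e x) \<le> norm (U * \<bar>e x\<bar>)" by (simp add: abs_mult mult_right_mono)
  qed
qed

text \<open>Hoeffding's lemma handles positive \<open>l\<close>; for negative \<open>l\<close> it is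
  applied to \<open>- g\<close>, which ranges over the reflected interval.\<close>

lemma subgaussian_bounded:
  assumes P: "prob_space P" and g: "g \<in> borel_measurable P"
    and bd: "\<And>x. x \<in> space P \<Longrightarrow> g x \<in> {a..b}" and mean: "(\<integral>x. g x \<partial>P) = 0"
  shows "subgaussian P g ((b - a)\<^sup>2 / 4)"
  unfolding subgaussian_def
proof (intro allI)
  fix l :: real
  interpret prob_space P by fact
  have nn: "(\<integral>\<^sup>+x. ennreal (exp (l * g x)) \<partial>P) \<le> ennreal (exp (l\<^sup>2 * ((b - a)\<^sup>2 / 4) / 2))"
  proof -
    consider "l > 0" | "l = 0" | "l < 0" by linarith
    then show ?thesis
    proof cases
      case 1
      interpret interval_bounded_random_variable P g a b
        by unfold_locales (use g bd in \<open>auto intro!: AE_I2\<close>)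
      show ?thesis using Hoeffdings_lemma_nn_integral_0[OF 1 mean] by simp
    next
      case 2 then show ?thesis by (simp add: emeasure_space_1)
    next
      case 3
      interpret interval_bounded_random_variable P "\<lambda>x. - g x" "- b" "- a"
        by unfold_locales (use g bd in \<open>auto intro!: AE_I2\<close>)
      show ?thesis using Hoeffdings_lemma_nn_integral_0[of "- l"] 3 mean by simp
    qed
  qed
  have meas: "(\<lambda>x. exp (l * g x)) \<in> borel_measurable P" using g by measurable
  have int: "integrable P (\<lambda>x. exp (l * g x))"
    by (rule integrableI_bounded) (use nn meas in \<open>auto simp: order_le_less_trans\<close>)
  have "ennreal (\<integral>x. exp (l * g x) \<partial>P) \<le> ennreal (exp (l\<^sup>2 * ((b - a)\<^sup>2 / 4) / 2))"
    using nn nn_integral_eq_integral[OF int] by simp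
  then show "integrable P (\<lambda>x. exp (l * g x)) \<and> (\<integral>x. exp (l * g x) \<partial>P) \<le> exp (l\<^sup>2 * ((b - a)\<^sup>2 / 4) / 2)"
    using int by simp
qed

text \<open>The bound \<open>exp z \<le> z + cosh (2 * z)\<close> turns the centring of \<open>g * e\<close> into a second-order
  bound; afterwards \<open>g\<close> may be replaced by its supremum because \<open>cosh\<close> is even and increasing in
  \<open>\<bar>z\<bar>\<close>, so no independence of \<open>g\<close> and \<open>e\<close> is needed.\<close>

lemma subgaussian_mult_bounded:
  assumes P: "prob_space P" and e: "subgaussian P e s" "integrable P e"
    and g: "g \<in> borel_measurable P" "\<And>x. x \<in> space P \<Longrightarrow> \<bar>g x\<bar> \<le> U" and mean: "(\<integral>x. g x * e x \<partial>P) = 0"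
  shows "subgaussian P (\<lambda>x. g x * e x) (4 * U\<^sup>2 * s)"
  unfolding subgaussian_def
proof (intro allI)
  fix l :: real
  have int: "integrable P (\<lambda>x. g x * e x)" using e(2) g by (rule integrable_mult_bounded)
  let ?r = "\<lambda>x. l * (g x * e x) + cosh (2 * l * U * e x)"
  have le: "exp (l * (g x * e x)) \<le> ?r x" if "x \<in> space P" for x
  proof -
    have "\<bar>2 * (l * (g x * e x))\<bar> \<le> \<bar>2 * l * U * e x\<bar>"
      using g(2)[OF that] by (simp add: abs_mult mult_left_mono mult_right_mono)
    then have "cosh (2 * (l * (g x * e x))) \<le> cosh (2 * l * U * e x)"
      by (metis abs_ge_zero cosh_real_abs cosh_real_nonneg_le_iff)
    then show ?thesis using exp_le_add_cosh[of "l * (g x * e x)"] by linarith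
  qed
  have int_r: "integrable P ?r" using int subgaussian_integral_cosh(1)[OF e(1)] by simp
  have int_exp: "integrable P (\<lambda>x. exp (l * (g x * e x)))"
  proof (rule Bochner_Integration.integrable_bound[OF int_r])
    show "(\<lambda>x. exp (l * (g x * e x))) \<in> borel_measurable P"
      using g(1) borel_measurable_integrable[OF e(2)] by measurable
    show "AE x in P. norm (exp (l * (g x * e x))) \<le> norm (?r x)"
      using le by (intro AE_I2) (fastforce simp: abs_real_def)
  qed
  have "(\<integral>x. exp (l * (g x * e x)) \<partial>P) \<le> (\<integral>x. ?r x \<partial>P)"
    by (rule integral_mono[OF int_exp int_r le])
  also have "\<dots> = (\<integral>x. cosh (2 * l * U * e x) \<partial>P)"
    using int subgaussian_integral_cosh(1)[OF e(1)] mean by simp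
  also have "\<dots> \<le> exp ((2 * l * U)\<^sup>2 * s / 2)" by (rule subgaussian_integral_cosh(2)[OF e(1)])
  \<comment> \<open>The factor 4 in the variance proxy is the square of the 2 inside
    \<open>cosh\<close>.\<close>
  also have "(2 * l * U)\<^sup>2 * s / 2 = l\<^sup>2 * (4 * U\<^sup>2 * s) / 2" by (simp add: power2_eq_square)
  finally show "integrable P (\<lambda>x. exp (l * (g x * e x))) \<and>
      (\<integral>x. exp (l * (g x * e x)) \<partial>P) \<le> exp (l\<^sup>2 * (4 * U\<^sup>2 * s) / 2)"
    using int_exp by blast
qed

locale iid_sample = P: prob_space P + Q: prob_space Q
  for P :: "'a measure" and Q :: "'b measure" +
  fixes X :: "nat \<Rightarrow> 'b \<Rightarrow> 'a" and n :: nat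
  assumes X_meas: "\<And>i. i < n \<Longrightarrow> X i \<in> measurable Q P"
    and X_indep: "Q.indep_vars (\<lambda>_. P) X {..<n}"
    and X_distr: "\<And>i. i < n \<Longrightarrow> distr Q P (X i) = P"
begin

text \<open>The length is a parameter because the LASSO sees a prefix of the sample that the least
  squares fit uses in full.\<close>

definition avg :: "nat \<Rightarrow> ('a \<Rightarrow> real) \<Rightarrow> 'b \<Rightarrow> real" where
  "avg k g \<omega> = (\<Sum>i<k. g (X i \<omega>)) / real k"

lemma avg_measurable [measurable]:
  "k \<le> n \<Longrightarrow> g \<in> borel_measurable P \<Longrightarrow> avg k g \<in> borel_measurable Q"
  unfolding avg_def using X_meas by (auto intro!: borel_measurable_divide borel_measurable_sum measurable_compose[of "X _" Q P g])

text \<open>Independence and equal laws identify the joint law of a prefix of the sample, so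
  expectations can be computed coordinate by coordinate with
  \<open>nn_integral_PiM_sum_le\<close>.\<close>

lemma distr_PiM:
  assumes "0 < k" "k \<le> n"
  shows "distr Q (PiM {..<k} (\<lambda>_. P)) (\<lambda>\<omega>. \<lambda>i\<in>{..<k}. X i \<omega>) = PiM {..<k} (\<lambda>_. P)"
proof -
  have "Q.indep_vars (\<lambda>_. P) X {..<k}" using Q.indep_vars_subset[OF X_indep] assms by auto
  then have "distr Q (PiM {..<k} (\<lambda>_. P)) (\<lambda>\<omega>. \<lambda>i\<in>{..<k}. X i \<omega>) = PiM {..<k} (\<lambda>i. distr Q P (X i))"
    using assms X_meas by (subst (asm) Q.indep_vars_iff_distr_eq_PiM') auto
  also have "\<dots> = PiM {..<k} (\<lambda>_. P)" using assms X_distr by (intro PiM_cong) auto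
  finally show ?thesis .
qed

text \<open>Markov's inequality for \<open>\<Phi>\<close> of the sum. A general
  \<open>\<Phi>\<close> serves both the scalar case, with an exponential, and the vector case, with
  \<open>cosh\<close> of a norm.\<close>

lemma sum_tail_bound:
  fixes v :: "'a \<Rightarrow> 'i \<Rightarrow> real" and \<Phi> :: "('i \<Rightarrow> real) \<Rightarrow> real"
  assumes k: "0 < (k::nat)" "k \<le> n" and C: "0 \<le> C" and T: "0 < T" and \<Phi>: "\<And>s. 0 \<le> \<Phi> s"
    and step: "\<And>s. (\<integral>\<^sup>+y. ennreal (\<Phi> (\<lambda>j. s j + v y j)) \<partial>P) \<le> ennreal (C * \<Phi> s)"
    and meas: "\<And>k::nat. (\<lambda>x. \<Phi> (\<lambda>j. \<Sum>i<k. v (x i) j)) \<in> borel_measurable (PiM {..<k} (\<lambda>_. P))"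
  shows "{\<omega> \<in> space Q. T \<le> \<Phi> (\<lambda>j. \<Sum>i<k. v (X i \<omega>) j)} \<in> sets Q"
    and "measure Q {\<omega> \<in> space Q. T \<le> \<Phi> (\<lambda>j. \<Sum>i<k. v (X i \<omega>) j)} \<le> C ^ k * \<Phi> (\<lambda>_. 0) / T"
proof -
  let ?r = "\<lambda>\<omega>. \<lambda>i\<in>{..<k}. X i \<omega>"
  let ?u = "\<lambda>\<omega>. \<Phi> (\<lambda>j. \<Sum>i<k. v (X i \<omega>) j)"
  have r: "?r \<in> measurable Q (PiM {..<k} (\<lambda>_. P))"
    using k X_meas by (intro measurable_restrict) auto
  have u: "?u \<in> borel_measurable Q"
    using measurable_compose[OF r meas[of k]] by simp
  then show sets: "{\<omega> \<in> space Q. T \<le> ?u \<omega>} \<in> sets Q" by measurable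
  have "(\<integral>\<^sup>+\<omega>. ennreal (?u \<omega>) \<partial>Q)
      = (\<integral>\<^sup>+x. ennreal (\<Phi> (\<lambda>j. \<Sum>i<k. v (x i) j)) \<partial>distr Q (PiM {..<k} (\<lambda>_. P)) ?r)"
    using meas[of k] by (subst nn_integral_distr[OF r]) auto
  also have "\<dots> \<le> ennreal (C ^ k * \<Phi> (\<lambda>_. 0))"
    unfolding distr_PiM[OF k] by (rule nn_integral_PiM_sum_le[OF P.prob_space_axioms C step meas])
  finally have nn: "(\<integral>\<^sup>+\<omega>. ennreal (?u \<omega>) \<partial>Q) \<le> ennreal (C ^ k * \<Phi> (\<lambda>_. 0))" .
  have "emeasure Q {\<omega> \<in> space Q. T \<le> ?u \<omega>}
      = emeasure Q {\<omega> \<in> space Q. 1 \<le> ennreal (1 / T) * ennreal (?u \<omega>)}"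
    using T \<Phi> by (intro arg_cong[of _ _ "emeasure Q"]) (auto simp: field_simps simp flip: ennreal_mult ennreal_1)
  also have "\<dots> \<le> ennreal (1 / T) * (\<integral>\<^sup>+\<omega>. ennreal (?u \<omega>) * indicator (space Q) \<omega> \<partial>Q)"
    using u by (intro nn_integral_Markov_inequality) auto
  also have "(\<integral>\<^sup>+\<omega>. ennreal (?u \<omega>) * indicator (space Q) \<omega> \<partial>Q) = (\<integral>\<^sup>+\<omega>. ennreal (?u \<omega>) \<partial>Q)"
    by (intro nn_integral_cong) simp
  also have "ennreal (1 / T) * \<dots> \<le> ennreal (1 / T) * ennreal (C ^ k * \<Phi> (\<lambda>_. 0))"
    using nn by (rule mult_left_mono) simp
  also have "\<dots> = ennreal (C ^ k * \<Phi> (\<lambda>_. 0) / T)"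
    using T C \<Phi> by (simp flip: ennreal_mult)
  finally show "measure Q {\<omega> \<in> space Q. T \<le> ?u \<omega>} \<le> C ^ k * \<Phi> (\<lambda>_. 0) / T"
    using T C \<Phi> unfolding Q.emeasure_eq_measure by (subst (asm) ennreal_le_iff) auto
qed

lemma subgaussian_upper_tail:
  assumes k: "0 < k" "k \<le> n" and g: "g \<in> borel_measurable P" "subgaussian P g s" and s: "0 < s" and L: "0 < L"
  shows "measure Q {\<omega> \<in> space Q. sqrt (2 * s * L / real k) \<le> avg k g \<omega>} \<le> exp (- L)"
proof -
  define t where "t = sqrt (2 * s * L / real k)"
  \<comment> \<open>The Chernoff parameter minimising \<open>l^2 * s / 2 - l * t\<close>; the
    minimum is \<open>- t^2 / (2 * s)\<close>.\<close>
  define l where "l = t / s"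
  have t: "t > 0" "t\<^sup>2 = 2 * s * L / real k" using s L k by (auto simp: t_def)
  have l: "l > 0" using t s by (simp add: l_def)
  have *: "{\<omega> \<in> space Q. t \<le> avg k g \<omega>}
      = {\<omega> \<in> space Q. exp (l * (t * real k)) \<le> exp (l * (\<Sum>i<k. g (X i \<omega>)))}"
    using k l by (auto simp: avg_def field_simps)
  have "measure Q {\<omega> \<in> space Q. exp (l * (t * real k)) \<le> exp (l * (\<Sum>i<k. g (X i \<omega>)))}
      \<le> exp (l\<^sup>2 * s / 2) ^ k * exp (l * 0) / exp (l * (t * real k))"
  \<comment> \<open>A scalar sum is treated as a vector with the one-element index type
    \<open>unit\<close>.\<close>
  proof (rule sum_tail_bound(2)[of k _ _ "\<lambda>u. exp (l * u ())" "\<lambda>y _. g y", OF k])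
    fix u :: "unit \<Rightarrow> real"
    have i: "integrable P (\<lambda>y. exp (l * g y))" and le: "(\<integral>y. exp (l * g y) \<partial>P) \<le> exp (l\<^sup>2 * s / 2)"
      using g(2) unfolding subgaussian_def by blast+
    have "(\<integral>\<^sup>+y. ennreal (exp (l * (u () + g y))) \<partial>P) = (\<integral>\<^sup>+y. ennreal (exp (l * u ()) * exp (l * g y)) \<partial>P)"
      by (simp add: exp_add distrib_left)
    also have "\<dots> = ennreal (\<integral>y. exp (l * u ()) * exp (l * g y) \<partial>P)"
      using i by (intro nn_integral_eq_integral) auto
    also have "\<dots> \<le> ennreal (exp (l\<^sup>2 * s / 2) * exp (l * u ()))"
      using le i by (intro ennreal_leI) (simp add: mult.commute)
    finally show "(\<integral>\<^sup>+y. ennreal (exp (l * (u () + g y))) \<partial>P) \<le> ennreal (exp (l\<^sup>2 * s / 2) * exp (l * u ()))" .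
  next
    show "(\<lambda>x. exp (l * (\<Sum>i<k. g (x i)))) \<in> borel_measurable (PiM {..<k} (\<lambda>_. P))" for k
    proof -
      have "(\<lambda>x. \<Sum>i<k. g (x i)) \<in> borel_measurable (PiM {..<k} (\<lambda>_. P))"
        by (intro borel_measurable_sum borel_measurable_component g(1))
      then show ?thesis by measurable
    qed
  qed auto
  also have "\<dots> = exp (real k * (l\<^sup>2 * s / 2) - l * (t * real k))"
    by (simp add: exp_diff flip: exp_of_nat_mult)
  also have "real k * (l\<^sup>2 * s / 2) - l * (t * real k) = - (real k * t\<^sup>2 / (2 * s))"
    using s by (simp add: l_def field_simps power2_eq_square)
  also have "\<dots> = - L" unfolding t(2) using s k by simp
  finally show ?thesis unfolding * t_def[symmetric] .
qed

lemma subgaussian_tail: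
  assumes k: "0 < k" "k \<le> n" and g: "g \<in> borel_measurable P" "subgaussian P g s" and s: "0 < s" and L: "0 < L"
  shows "measure Q {\<omega> \<in> space Q. sqrt (2 * s * L / real k) \<le> \<bar>avg k g \<omega>\<bar>} \<le> 2 * exp (- L)"
proof -
  let ?t = "sqrt (2 * s * L / real k)"
  have neg: "avg k (\<lambda>x. - g x) \<omega> = - avg k g \<omega>" for \<omega> by (simp add: avg_def sum_negf)
  have "{\<omega> \<in> space Q. ?t \<le> \<bar>avg k g \<omega>\<bar>}
      = {\<omega> \<in> space Q. ?t \<le> avg k g \<omega>} \<union> {\<omega> \<in> space Q. ?t \<le> avg k (\<lambda>x. - g x) \<omega>}"
    unfolding neg by (auto simp: abs_real_def)
  then have "measure Q {\<omega> \<in> space Q. ?t \<le> \<bar>avg k g \<omega>\<bar>}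
      \<le> measure Q {\<omega> \<in> space Q. ?t \<le> avg k g \<omega>} + measure Q {\<omega> \<in> space Q. ?t \<le> avg k (\<lambda>x. - g x) \<omega>}"
    using k g by (auto intro!: measure_Un_le) measurable
  also have "\<dots> \<le> exp (- L) + exp (- L)"
    using k g s L by (intro add_mono subgaussian_upper_tail) (auto intro: subgaussian_uminus)
  finally show ?thesis by simp
qed

text \<open>Pinelis' argument for sums in a Hilbert space, here the space with squared norm
  \<open>bform S K\<close>: \<open>cosh (l * norm)\<close> grows in expectation by at most the factor \<open>C\<close> in every step,
  whatever the dimension.\<close>

lemma vector_tail:
  fixes S :: "nat set" and v :: "'a \<Rightarrow> nat \<Rightarrow> real" and K :: "nat \<Rightarrow> nat \<Rightarrow> real"
  defines "nrm \<equiv> \<lambda>u. sqrt (bform S K u u)"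
  assumes k: "0 < k" "k \<le> n" and l: "0 < l"
    and psd: "\<And>u. 0 \<le> bform S K u u" and comm: "\<And>u w. bform S K u w = bform S K w u"
    and v: "\<And>j. j \<in> S \<Longrightarrow> integrable P (\<lambda>y. v y j)" "\<And>j. j \<in> S \<Longrightarrow> (\<integral>y. v y j \<partial>P) = 0"
    and int: "integrable P (\<lambda>y. exp (l * nrm (v y)) - l * nrm (v y))"
    and le: "(\<integral>y. exp (l * nrm (v y)) - l * nrm (v y) \<partial>P) \<le> exp c"
  shows "{\<omega> \<in> space Q. t \<le> nrm (\<lambda>j. avg k (\<lambda>y. v y j) \<omega>)} \<in> sets Q"
    and "measure Q {\<omega> \<in> space Q. t \<le> nrm (\<lambda>j. avg k (\<lambda>y. v y j) \<omega>)} \<le> 2 * exp (real k * (c - l * t))"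
proof -
  define \<Phi> where "\<Phi> u = cosh (l * nrm u)" for u
  have fin: "nrm u \<ge> 0" for u by (simp add: nrm_def psd)
  have bf: "l\<^sup>2 * bform S K u u \<ge> 0" for u using psd by simp
  have sq: "sqrt (l\<^sup>2 * bform S K u u) = l * nrm u" for u using l by (simp add: nrm_def real_sqrt_mult)
  have meas: "(\<lambda>x. \<Phi> (\<lambda>j. \<Sum>i<k. v (x i) j)) \<in> borel_measurable (PiM {..<k} (\<lambda>_. P))" for k
  proof -
    have 1: "(\<lambda>x. \<Sum>i<k. v (x i) j) \<in> borel_measurable (PiM {..<k} (\<lambda>_. P))" if "j \<in> S" for j
      by (intro borel_measurable_sum borel_measurable_component
          borel_measurable_integrable[OF v(1)[OF that]])
    have "(\<lambda>x. bform S K (\<lambda>j. \<Sum>i<k. v (x i) j) (\<lambda>j. \<Sum>i<k. v (x i) j)) \<in> borel_measurable (PiM {..<k} (\<lambda>_. P))"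
      unfolding bform_def
      by (rule borel_measurable_sum, rule borel_measurable_sum)
        (intro borel_measurable_times 1 borel_measurable_const)
    then show ?thesis unfolding \<Phi>_def nrm_def cosh_field_def by measurable
  qed
  have step: "(\<integral>\<^sup>+y. ennreal (\<Phi> (\<lambda>j. s j + v y j)) \<partial>P) \<le> ennreal (exp c * \<Phi> s)" for s
  proof -
    \<comment> \<open>The coefficient of the inner product of \<open>s\<close> and
      \<open>v y\<close> in \<open>cosh_sqrt_add_le\<close>. That term integrates to 0 because
      \<open>v\<close> is centred.\<close>
    define \<psi> where "\<psi> = sinh (l * nrm s) / (l * nrm s)"
    let ?r = "\<lambda>y. l\<^sup>2 * bform S K s (v y) * \<psi> + \<Phi> s * (exp (l * nrm (v y)) - l * nrm (v y))"
    have pw: "\<Phi> (\<lambda>j. s j + v y j) \<le> ?r y" for y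
    proof -
      have "(l\<^sup>2 * bform S K s (v y))\<^sup>2 \<le> (l\<^sup>2 * l\<^sup>2) * (bform S K s s * bform S K (v y) (v y))"
        using mult_left_mono[OF bform_Cauchy_Schwarz[OF comm psd, of s "v y"], of "l\<^sup>2 * l\<^sup>2"]
        by (simp add: power_mult_distrib power2_eq_square[of "l\<^sup>2"])
      then have "(l\<^sup>2 * bform S K s (v y))\<^sup>2 \<le> (l\<^sup>2 * bform S K s s) * (l\<^sup>2 * bform S K (v y) (v y))"
        by (simp add: mult_ac)
      from cosh_sqrt_add_le[OF bf bf this]
      have "cosh (sqrt (l\<^sup>2 * bform S K s s + 2 * (l\<^sup>2 * bform S K s (v y)) + l\<^sup>2 * bform S K (v y) (v y))) \<le> ?r y"
        unfolding sq \<psi>_def \<Phi>_def .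
      also have "l\<^sup>2 * bform S K s s + 2 * (l\<^sup>2 * bform S K s (v y)) + l\<^sup>2 * bform S K (v y) (v y)
          = l\<^sup>2 * bform S K (\<lambda>j. s j + v y j) (\<lambda>j. s j + v y j)"
        using bform_line[OF comm[of s "v y"], of 1] by (simp add: algebra_simps)
      finally show ?thesis unfolding sq \<Phi>_def .
    qed
    have ib: "integrable P (\<lambda>y. bform S K s (v y))" and ib0: "(\<integral>y. bform S K s (v y) \<partial>P) = 0"
      unfolding bform_def using v by (auto intro!: Bochner_Integration.integrable_sum simp: Bochner_Integration.integral_sum)
    have ir: "integrable P ?r" using ib int by simp
    have "(\<integral>\<^sup>+y. ennreal (\<Phi> (\<lambda>j. s j + v y j)) \<partial>P) \<le> (\<integral>\<^sup>+y. ennreal (?r y) \<partial>P)"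
      by (intro nn_integral_mono ennreal_leI pw)
    also have "\<dots> = ennreal (\<integral>y. ?r y \<partial>P)"
    proof (rule nn_integral_eq_integral[OF ir], rule AE_I2)
      fix y show "0 \<le> ?r y" using pw[of y] cosh_real_pos by (metis \<Phi>_def less_imp_le order_trans)
    qed
    also have "(\<integral>y. ?r y \<partial>P) = \<Phi> s * (\<integral>y. exp (l * nrm (v y)) - l * nrm (v y) \<partial>P)"
      using ib ib0 int by simp
    also have "\<dots> \<le> \<Phi> s * exp c" using le by (intro mult_left_mono) (simp_all add: \<Phi>_def)
    finally show ?thesis by (simp add: mult.commute ennreal_leI)
  qed
  define T where "T = t * real k"
  have nrm_avg: "nrm (\<lambda>j. avg k (\<lambda>y. v y j) \<omega>) = nrm (\<lambda>j. \<Sum>i<k. v (X i \<omega>) j) / real k" for \<omega>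
    using bform_scale[of S K "1 / real k" "\<lambda>j. \<Sum>i<k. v (X i \<omega>) j"] k
    by (simp add: nrm_def avg_def real_sqrt_mult real_sqrt_divide power_divide)
  show "{\<omega> \<in> space Q. t \<le> nrm (\<lambda>j. avg k (\<lambda>y. v y j) \<omega>)} \<in> sets Q"
  proof -
    have "(\<lambda>\<omega>. bform S K (\<lambda>j. avg k (\<lambda>y. v y j) \<omega>) (\<lambda>j. avg k (\<lambda>y. v y j) \<omega>)) \<in> borel_measurable Q"
      unfolding bform_def
      by (intro borel_measurable_sum borel_measurable_times borel_measurable_const avg_measurable
          borel_measurable_integrable[OF v(1)] k)
    then have "(\<lambda>\<omega>. nrm (\<lambda>j. avg k (\<lambda>y. v y j) \<omega>)) \<in> borel_measurable Q"
      unfolding nrm_def by measurable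
    then show ?thesis by measurable
  qed
  show "measure Q {\<omega> \<in> space Q. t \<le> nrm (\<lambda>j. avg k (\<lambda>y. v y j) \<omega>)} \<le> 2 * exp (real k * (c - l * t))"
  \<comment> \<open>For nonpositive \<open>t\<close> the bound exceeds 1, because
    \<open>exp z - z\<close> is at least 1 and therefore \<open>c\<close> is nonnegative. Positive
    \<open>t\<close> is needed to rewrite the event by monotonicity of \<open>cosh\<close>.\<close>
  proof (cases "t \<le> 0")
    case True
    have "1 \<le> exp c"
    proof -
      have "1 \<le> (\<integral>y. exp (l * nrm (v y)) - l * nrm (v y) \<partial>P)"
      proof -
        have "(\<integral>y. 1 \<partial>P) \<le> (\<integral>y. exp (l * nrm (v y)) - l * nrm (v y) \<partial>P)"
        proof (rule integral_mono[OF _ int])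
          fix y show "1 \<le> exp (l * nrm (v y)) - l * nrm (v y)"
            using exp_ge_add_one_self[of "l * nrm (v y)"] by linarith
        qed simp
        then show ?thesis by (simp add: P.prob_space)
      qed
      then show ?thesis using le by linarith
    qed
    then have "0 \<le> c" by simp
    then have "1 \<le> exp (real k * (c - l * t))"
      using True l by (simp add: mult_nonneg_nonneg mult_nonneg_nonpos order_trans[of "l * t" 0 c])
    then show ?thesis using Q.prob_le_1[of "{\<omega> \<in> space Q. t \<le> nrm (\<lambda>j. avg k (\<lambda>y. v y j) \<omega>)}"] by linarith
  next
    case False
    have eq: "{\<omega> \<in> space Q. t \<le> nrm (\<lambda>j. avg k (\<lambda>y. v y j) \<omega>)}
        = {\<omega> \<in> space Q. cosh (l * T) \<le> \<Phi> (\<lambda>j. \<Sum>i<k. v (X i \<omega>) j)}"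
      unfolding nrm_avg \<Phi>_def T_def using k l False fin
      by (subst cosh_real_nonneg_le_iff) (auto simp: field_simps)
    have "measure Q {\<omega> \<in> space Q. t \<le> nrm (\<lambda>j. avg k (\<lambda>y. v y j) \<omega>)}
        \<le> exp c ^ k * \<Phi> (\<lambda>_. 0) / cosh (l * T)"
      unfolding eq by (rule sum_tail_bound(2)[OF k _ _ _ step meas]) (auto simp: \<Phi>_def)
    also have "\<dots> = exp (real k * c) / cosh (l * T)"
      by (simp add: \<Phi>_def nrm_def bform_def flip: exp_of_nat_mult)
    \<comment> \<open>Bounding \<open>cosh\<close> below by half an exponential produces the factor
      2, whatever the dimension.\<close>
    also have "\<dots> \<le> exp (real k * c) / (exp (l * T) / 2)"
      by (intro divide_left_mono) (auto simp: cosh_field_def intro!: mult_pos_pos add_pos_pos)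
    also have "\<dots> = 2 * exp (real k * (c - l * t))"
      by (simp add: T_def exp_diff algebra_simps)
    finally show ?thesis .
  qed
qed

end

section \<open>The control variate model\<close>

text \<open>An entrywise error \<open>\<eta>\<close> changes the form by at most
  \<open>\<eta>\<close> times the squared \<open>l1\<close> norm, which costs a factor
  \<open>card S\<close> when passing to the Euclidean norm.\<close>

lemma bform_entrywise_ge:
  assumes "finite S" "S \<noteq> {}" and eta: "\<And>j k. j \<in> S \<Longrightarrow> k \<in> S \<Longrightarrow> \<bar>C j k - G j k\<bar> \<le> \<eta>"
  shows "bform S G d d - \<eta> * real (card S) * (\<Sum>j\<in>S. (d j)\<^sup>2) \<le> bform S C d d"
proof -
  have eta0: "0 \<le> \<eta>" using assms by (metis abs_ge_zero all_not_in_conv order_trans)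
  have "bform S G d d - bform S C d d = (\<Sum>j\<in>S. \<Sum>k\<in>S. - (d j * (C j k - G j k) * d k))"
    by (simp add: bform_def algebra_simps flip: sum_subtractf)
  also have "\<dots> \<le> (\<Sum>j\<in>S. \<Sum>k\<in>S. \<bar>d j\<bar> * \<eta> * \<bar>d k\<bar>)"
  proof (intro sum_mono)
    fix j k assume "j \<in> S" "k \<in> S"
    then have "\<bar>d j\<bar> * \<bar>C j k - G j k\<bar> * \<bar>d k\<bar> \<le> \<bar>d j\<bar> * \<eta> * \<bar>d k\<bar>"
      using eta by (intro mult_right_mono mult_left_mono) auto
    then show "- (d j * (C j k - G j k) * d k) \<le> \<bar>d j\<bar> * \<eta> * \<bar>d k\<bar>"
      using abs_ge_minus_self[of "d j * (C j k - G j k) * d k"] by (simp only: abs_mult)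
  qed
  also have "\<dots> = \<eta> * (\<Sum>j\<in>S. \<bar>d j\<bar>)\<^sup>2"
    by (simp add: power2_eq_square sum_product sum_distrib_left mult_ac)
  also have "\<dots> \<le> \<eta> * (sqrt (real (card S)) * sqrt (\<Sum>j\<in>S. (d j)\<^sup>2))\<^sup>2"
    by (intro mult_left_mono power_mono sum_abs_le_sqrt_card sum_nonneg eta0) auto
  also have "\<dots> = \<eta> * real (card S) * (\<Sum>j\<in>S. (d j)\<^sup>2)"
    by (simp add: power_mult_distrib sum_nonneg)
  finally show ?thesis by linarith
qed

text \<open>The probabilistic model; the level \<open>delta\<close>, the subsample size and the
  penalty enter only with the statements that need them.\<close>

locale control_variates = iid_sample P Q X n
  for P :: "'a measure" and Q :: "'b measure" and X :: "nat \<Rightarrow> 'b \<Rightarrow> 'a" and n :: nat +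
  fixes f :: "'a \<Rightarrow> real" and h :: "nat \<Rightarrow> 'a \<Rightarrow> real" and m :: nat and bstar :: "nat \<Rightarrow> real"
    and tau :: real
  assumes f_meas: "f \<in> borel_measurable P" and f_L2: "integrable P (\<lambda>x. (f x)\<^sup>2)"
    and h_meas: "\<And>j. j < m \<Longrightarrow> h j \<in> borel_measurable P"
    and h_centered: "\<And>j. j < m \<Longrightarrow> (\<integral>x. h j x \<partial>P) = 0"
    and bstar_min: "\<And>b. (\<integral>x. (f x - (\<integral>y. f y \<partial>P) - (\<Sum>j<m. bstar j * h j x))\<^sup>2 \<partial>P)
                         \<le> (\<integral>x. (f x - (\<integral>y. f y \<partial>P) - (\<Sum>j<m. b j * h j x))\<^sup>2 \<partial>P)"
    and S_ne: "supp_m m bstar \<noteq> {}"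
    and tau_pos: "tau > 0"
    and eps_subg: "subgaussian P (\<lambda>x. f x - (\<integral>y. f y \<partial>P) - (\<Sum>j<m. bstar j * h j x)) (tau\<^sup>2)"
    and h_bdd: "\<exists>U. \<forall>j<m. \<forall>x\<in>space P. \<bar>h j x\<bar> \<le> U"
    and lin_indep: "\<And>c. (AE x in P. (\<Sum>k\<in>supp_m m bstar. c k * h k x) = 0)
                         \<Longrightarrow> (\<forall>k\<in>supp_m m bstar. c k = 0)"
    and orth: "\<And>j k. j < m \<Longrightarrow> j \<notin> supp_m m bstar \<Longrightarrow> k \<in> supp_m m bstar
                     \<Longrightarrow> (\<integral>x. h j x * h k x \<partial>P) = 0"
begin

definition "S = supp_m m bstar"
definition "mean_f = (\<integral>x. f x \<partial>P)"
definition "eps x = f x - (\<integral>y. f y \<partial>P) - (\<Sum>j<m. bstar j * h j x)"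
definition "G j k = (\<integral>x. h j x * h k x \<partial>P)"
definition "U = U_h P h m"
definition "\<gamma> = min_eigenvalue (gram_mat P h S)"
definition "B = B_star P h S"
definition "sparsity = real (card S)"

lemma S_sub: "S \<subseteq> {..<m}" and S_fin: "finite S" and S_nonempty: "S \<noteq> {}"
  and bstar_S: "\<And>j. j < m \<Longrightarrow> j \<notin> S \<Longrightarrow> bstar j = 0"
  using S_ne by (auto simp: S_def supp_m_def)

lemma in_S_less: "j \<in> S \<Longrightarrow> j < m" using S_sub by auto

lemma sparsity_ge_1: "1 \<le> sparsity" and sparsity_le_m: "sparsity \<le> real m"
proof -
  have "card S > 0" using S_fin S_nonempty by (simp add: card_gt_0_iff)
  then show "1 \<le> sparsity" by (simp add: sparsity_def)
  have "card S \<le> card {..<m}" using S_sub by (intro card_mono) auto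
  then show "sparsity \<le> real m" by (simp add: sparsity_def)
qed

lemma h_le_U: "j < m \<Longrightarrow> x \<in> space P \<Longrightarrow> \<bar>h j x\<bar> \<le> U"
proof -
  assume jx: "j < m" "x \<in> space P"
  from h_bdd obtain M where "\<forall>j<m. \<forall>x\<in>space P. \<bar>h j x\<bar> \<le> M" by blast
  then have "bdd_above ((\<lambda>jx. \<bar>h (fst jx) (snd jx)\<bar>) ` ({..<m} \<times> space P))"
    by (intro bdd_aboveI2[of _ _ M]) auto
  then show ?thesis
    unfolding U_def U_h_def using jx cSUP_upper[of "(j, x)" "{..<m} \<times> space P" "\<lambda>jx. \<bar>h (fst jx) (snd jx)\<bar>"] by simp
qed

lemma sum_bstar: "(\<Sum>j<m. bstar j * h j x) = (\<Sum>j\<in>S. bstar j * h j x)"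
  using S_sub bstar_S by (intro sum.mono_neutral_right) auto

lemma model: "f x = mean_f + (\<Sum>j\<in>S. bstar j * h j x) + eps x"
  by (simp add: eps_def mean_f_def sum_bstar)

lemma integrable_h: "j < m \<Longrightarrow> integrable P (h j)"
  by (rule P.integrable_const_bound[where B = U]) (use h_le_U h_meas in \<open>auto intro!: AE_I2\<close>)

lemma integrable_f: "integrable P f"
  using f_meas f_L2 by (rule P.square_integrable_imp_integrable)

lemma eps_meas: "eps \<in> borel_measurable P"
  unfolding eps_def[abs_def] using f_meas h_meas
  by (intro borel_measurable_diff borel_measurable_sum borel_measurable_times) auto

lemma integrable_eps: "integrable P eps"
  unfolding eps_def[abs_def] using integrable_f integrable_h
  by (intro Bochner_Integration.integrable_diff Bochner_Integration.integrable_sum) auto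

lemma eps_mean: "(\<integral>x. eps x \<partial>P) = 0"
proof -
  have "(\<integral>x. (\<Sum>j<m. bstar j * h j x) \<partial>P) = 0"
    using integrable_h h_centered by (subst Bochner_Integration.integral_sum) auto
  moreover have "integrable P (\<lambda>x. \<Sum>j<m. bstar j * h j x)"
    using integrable_h by (intro Bochner_Integration.integrable_sum) auto
  ultimately show ?thesis
    unfolding eps_def using integrable_f by (simp add: P.prob_space)
qed

lemma subgaussian_eps: "subgaussian P eps (tau\<^sup>2)"
  using eps_subg by (simp add: eps_def[abs_def])

lemma integrable_h_eps: "j < m \<Longrightarrow> integrable P (\<lambda>x. h j x * eps x)"
  using integrable_mult_bounded[OF integrable_eps h_meas h_le_U] .

lemma integrable_h_h: "j < m \<Longrightarrow> k < m \<Longrightarrow> integrable P (\<lambda>x. h j x * h k x)"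
  using integrable_mult_bounded[OF integrable_h h_meas h_le_U] .

text \<open>The exponential moments dominate the square, by the quadratic Taylor bound
  \<open>u^2 \<le> 4 * cosh u\<close>.\<close>

lemma integrable_eps_sq: "integrable P (\<lambda>x. (eps x)\<^sup>2)"
proof (rule Bochner_Integration.integrable_bound)
  show "integrable P (\<lambda>x. 4 * cosh (1 * eps x))"
    using subgaussian_integral_cosh(1)[OF subgaussian_eps, of 1] by simp
  show "(\<lambda>x. (eps x)\<^sup>2) \<in> borel_measurable P" using eps_meas by measurable
  have "u\<^sup>2 \<le> 4 * cosh u" for u :: real
  proof -
    have "1 + \<bar>u\<bar> + \<bar>u\<bar>\<^sup>2 / 2 \<le> exp \<bar>u\<bar>" by (rule exp_lower_Taylor_quadratic) simp
    moreover have "2 * cosh u = exp \<bar>u\<bar> + exp (- \<bar>u\<bar>)"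
      using cosh_real_abs[of u] by (simp add: cosh_field_def)
    moreover have "0 < exp (- \<bar>u\<bar>)" by simp
    ultimately have "1 + \<bar>u\<bar> + u\<^sup>2 / 2 \<le> 2 * cosh u" unfolding power2_abs by linarith
    then show ?thesis by simp
  qed
  then show "AE x in P. norm ((eps x)\<^sup>2) \<le> norm (4 * cosh (1 * eps x))" by simp
qed

text \<open>The population normal equation: minimality of \<open>bstar\<close> is tested by moving
  the coefficient \<open>j\<close> alone. It supplies the centring of \<open>h j * eps\<close> on
  which the concentration bounds rest.\<close>

lemma h_eps_mean: assumes j: "j < m" shows "(\<integral>x. h j x * eps x \<partial>P) = 0"
proof (rule linear_term_zero)
  fix t :: real
  have upd: "(\<Sum>k<m. (bstar(j := bstar j + t)) k * h k x) = (\<Sum>k<m. bstar k * h k x) + t * h j x" for x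
    using j by (subst (1 2) sum.remove[of _ j]) (auto simp: algebra_simps intro!: sum.cong)
  have "(\<integral>x. (eps x)\<^sup>2 \<partial>P) \<le> (\<integral>x. (eps x - t * h j x)\<^sup>2 \<partial>P)"
    using bstar_min[of "bstar(j := bstar j + t)"] unfolding upd eps_def by (simp add: algebra_simps)
  also have "\<dots> = (\<integral>x. (eps x)\<^sup>2 + (t\<^sup>2 * (h j x * h j x) - 2 * t * (h j x * eps x)) \<partial>P)"
    by (intro Bochner_Integration.integral_cong refl) (simp add: power2_eq_square algebra_simps)
  also have "\<dots> = (\<integral>x. (eps x)\<^sup>2 \<partial>P) + (t\<^sup>2 * (\<integral>x. h j x * h j x \<partial>P) - 2 * t * (\<integral>x. h j x * eps x \<partial>P))"
    using integrable_eps_sq integrable_h_h[OF j j] integrable_h_eps[OF j] by simp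
  finally show "0 \<le> t\<^sup>2 * (\<integral>x. h j x * h j x \<partial>P) - 2 * t * (\<integral>x. h j x * eps x \<partial>P)" by simp
qed

lemma G_commute: "G j k = G k j" by (simp add: G_def mult.commute)

lemma bform_G: "bform S G d d = (\<integral>x. (\<Sum>j\<in>S. d j * h j x)\<^sup>2 \<partial>P)"
proof -
  have "(\<integral>x. (\<Sum>j\<in>S. d j * h j x)\<^sup>2 \<partial>P) = (\<integral>x. (\<Sum>j\<in>S. \<Sum>k\<in>S. d j * d k * (h j x * h k x)) \<partial>P)"
    by (simp add: power2_eq_square sum_product mult_ac)
  also have "\<dots> = (\<Sum>j\<in>S. \<Sum>k\<in>S. d j * d k * G j k)"
    unfolding G_def using integrable_h_h in_S_less
    by (simp add: Bochner_Integration.integral_sum Bochner_Integration.integrable_sum)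
  finally show ?thesis by (simp add: bform_def mult_ac)
qed

text \<open>A vanishing second moment makes the combination zero almost everywhere, which
  \<open>lin_indep\<close> excludes.\<close>

lemma G_pos_def: assumes "j \<in> S" "d j \<noteq> 0" shows "0 < bform S G d d"
proof -
  have int: "integrable P (\<lambda>x. (\<Sum>j\<in>S. d j * h j x)\<^sup>2)"
    unfolding power2_eq_square sum_product using integrable_h_h in_S_less
    by (intro Bochner_Integration.integrable_sum) (simp add: mult.assoc mult.left_commute)
  have "bform S G d d \<noteq> 0"
  proof
    assume "bform S G d d = 0"
    then have "AE x in P. (\<Sum>j\<in>S. d j * h j x)\<^sup>2 = 0"
      unfolding bform_G using int by (subst (asm) integral_nonneg_eq_0_iff_AE) auto
    then have "\<forall>k\<in>S. d k = 0" unfolding S_def by (intro lin_indep) simp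
    then show False using assms by blast
  qed
  moreover have "0 \<le> bform S G d d" unfolding bform_G by simp
  ultimately show ?thesis by simp
qed

lemma gram_inverse:
  obtains K where "0 < \<gamma>" "\<And>d. \<gamma> * (\<Sum>j\<in>S. (d j)\<^sup>2) \<le> bform S G d d"
    "inverse_form S G K"
    "\<And>x. scalar_prod (h_vec h S x) (the (mat_inverse (gram_mat P h S)) *\<^sub>v h_vec h S x)
        = bform S K (\<lambda>j. h j x) (\<lambda>j. h j x)"
proof (rule gram_matrix_form[of S G, OF S_fin S_nonempty])
  show "G j k = G k j" for j k by (rule G_commute)
  show "0 < bform S G x x" if "j \<in> S" "x j \<noteq> 0" for x j using that by (rule G_pos_def)
next
  let ?A = "mat (card S) (card S) (\<lambda>(i, k). G (idx S ! i) (idx S ! k))"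
  have A: "?A = gram_mat P h S" by (simp add: gram_mat_def G_def)
  fix K
  assume 1: "0 < min_eigenvalue ?A"
    and 2: "\<And>x. min_eigenvalue ?A * (\<Sum>j\<in>S. (x j)\<^sup>2) \<le> bform S G x x" and 3: "inverse_form S G K"
    and inv: "\<And>x. scalar_prod (vec (card S) (\<lambda>i. x (idx S ! i)))
        (the (mat_inverse ?A) *\<^sub>v vec (card S) (\<lambda>i. x (idx S ! i))) = bform S K x x"
  have "scalar_prod (h_vec h S x) (the (mat_inverse (gram_mat P h S)) *\<^sub>v h_vec h S x)
      = bform S K (\<lambda>j. h j x) (\<lambda>j. h j x)" for x
    using inv[of "\<lambda>j. h j x"] unfolding A h_vec_def .
  with 1 2 3 show thesis unfolding A \<gamma>_def[symmetric] by (intro that)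
qed

lemma \<gamma>_pos: "0 < \<gamma>" and \<gamma>_le: "\<gamma> * (\<Sum>j\<in>S. (d j)\<^sup>2) \<le> bform S G d d"
  using gram_inverse by metis+

lemma G_psd: "0 \<le> bform S G d d" unfolding bform_G by simp

lemma G_le: assumes "j < m" "k < m" shows "\<bar>G j k\<bar> \<le> U\<^sup>2"
proof -
  have "\<bar>h j x * h k x\<bar> \<le> U\<^sup>2" if "x \<in> space P" for x
    unfolding power2_eq_square abs_mult using h_le_U[OF assms(1) that] h_le_U[OF assms(2) that]
    by (intro mult_mono) auto
  then have b: "- (U\<^sup>2) \<le> h j x * h k x" "h j x * h k x \<le> U\<^sup>2" if "x \<in> space P" for x
    using that abs_le_iff by (metis minus_le_iff)+
  have "(\<integral>x. - (U\<^sup>2) \<partial>P) \<le> G j k" "G j k \<le> (\<integral>x. U\<^sup>2 \<partial>P)"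
    unfolding G_def using b integrable_h_h[OF assms] by (intro integral_mono; simp)+
  then show ?thesis by (simp add: P.prob_space abs_le_iff)
qed

text \<open>The lower bound \<open>\<gamma>_le\<close> tested on a coordinate vector, where the form
  is a diagonal entry of \<open>G\<close>. It yields \<open>U > 0\<close> and
  \<open>\<xi>_ge\<close>.\<close>

lemma \<gamma>_le_U: "\<gamma> \<le> U\<^sup>2"
proof -
  obtain j where j: "j \<in> S" using S_nonempty by blast
  let ?d = "\<lambda>k. if k = j then 1 else 0 :: real"
  have sq: "(?d k)\<^sup>2 = ?d k" for k by simp
  have "\<gamma> \<le> bform S G ?d ?d" using \<gamma>_le[of ?d] j S_fin unfolding sq by simp
  also have "\<dots> = G j j" using j S_fin
    by (simp add: bform_def if_distrib[of "\<lambda>x. x * _"] if_distrib[of "\<lambda>x. _ * x"] cong: if_cong)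
  also have "\<dots> \<le> U\<^sup>2" using G_le[of j j] in_S_less[OF j] by simp
  finally show ?thesis .
qed

lemma U_pos: "0 < U"
proof -
  obtain j where j: "j \<in> S" using S_nonempty by blast
  obtain x where "x \<in> space P" using P.not_empty by blast
  then have "0 \<le> U" using h_le_U[OF in_S_less[OF j]] abs_ge_zero order_trans by blast
  moreover have "U \<noteq> 0" using \<gamma>_pos \<gamma>_le_U by auto
  ultimately show ?thesis by simp
qed

definition "\<xi> = sparsity * U\<^sup>2 / \<gamma>"

lemma \<xi>_ge: "sparsity \<le> \<xi>"
proof -
  have "sparsity * 1 \<le> sparsity * (U\<^sup>2 / \<gamma>)" using \<gamma>_pos \<gamma>_le_U sparsity_ge_1 by (intro mult_left_mono) auto
  then show ?thesis by (simp add: \<xi>_def)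
qed

text \<open>The leverage is the squared \<open>K\<close>-norm of the control variates at a point. It
  is at most \<open>\<xi>\<close> because the squared Euclidean norm is at most
  \<open>sparsity * U^2\<close>; its mean is the trace of \<open>K G\<close>, that is
  \<open>sparsity\<close>; and a mean is at most the supremum, so \<open>sparsity\<close> is at most
  \<open>B\<close>.\<close>

lemma
  assumes K: "inverse_form S G K"
    and KB: "\<And>x. scalar_prod (h_vec h S x) (the (mat_inverse (gram_mat P h S)) *\<^sub>v h_vec h S x)
        = bform S K (\<lambda>j. h j x) (\<lambda>j. h j x)"
  shows leverage_le_B: "\<And>x. x \<in> space P \<Longrightarrow> bform S K (\<lambda>j. h j x) (\<lambda>j. h j x) \<le> B"
    and B_le_\<xi>: "B \<le> \<xi>"
    and integrable_leverage: "integrable P (\<lambda>x. bform S K (\<lambda>j. h j x) (\<lambda>j. h j x))"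
    and integral_leverage: "(\<integral>x. bform S K (\<lambda>j. h j x) (\<lambda>j. h j x) \<partial>P) = sparsity"
    and sparsity_le_B: "sparsity \<le> B"
proof -
  interpret inverse_form S G K by fact
  let ?q = "\<lambda>x. bform S K (\<lambda>j. h j x) (\<lambda>j. h j x)"
  have ub: "?q x \<le> \<xi>" if "x \<in> space P" for x
  proof -
    have "?q x \<le> (\<Sum>j\<in>S. (h j x)\<^sup>2) / \<gamma>" by (rule K_le_of_G_ge[OF \<gamma>_pos \<gamma>_le])
    also have "\<dots> \<le> (\<Sum>j\<in>S. U\<^sup>2) / \<gamma>"
      using h_le_U[OF in_S_less that] \<gamma>_pos U_pos
      by (intro divide_right_mono sum_mono) (auto simp flip: abs_le_square_iff)
    finally show ?thesis by (simp add: \<xi>_def sparsity_def)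
  qed
  have B: "B = (SUP x\<in>space P. ?q x)" unfolding B_def B_star_def KB ..
  show leB: "?q x \<le> B" if "x \<in> space P" for x
    unfolding B using ub that by (intro cSUP_upper bdd_aboveI2) auto
  show "B \<le> \<xi>" unfolding B using ub P.not_empty by (intro cSUP_least) auto
  have q: "?q x = (\<Sum>j\<in>S. \<Sum>k\<in>S. K j k * (h j x * h k x))" for x by (simp add: bform_def mult_ac)
  show int: "integrable P ?q"
    unfolding q using integrable_h_h in_S_less by (intro Bochner_Integration.integrable_sum) simp
  have "(\<integral>x. ?q x \<partial>P) = (\<Sum>j\<in>S. \<Sum>k\<in>S. K j k * G j k)"
    unfolding q G_def using integrable_h_h in_S_less
    by (simp add: Bochner_Integration.integral_sum Bochner_Integration.integrable_sum)
  then show eq: "(\<integral>x. ?q x \<partial>P) = sparsity" using trace_K_G by (simp add: sparsity_def)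
  have "(\<integral>x. ?q x \<partial>P) \<le> (\<integral>x. B \<partial>P)" using leB int by (intro integral_mono) auto
  then show "sparsity \<le> B" unfolding eq by (simp add: P.prob_space)
qed

text \<open>For arguments in the unit interval \<open>exp z - z\<close> is at most
  \<open>1 + z^2\<close>, so the growth per step is governed by the mean leverage
  \<open>sparsity\<close> instead of its supremum. \<open>B\<close> is used only to keep the
  argument below 1, which is the second condition on \<open>L\<close>.\<close>

lemma vector_tail_h:
  assumes K: "inverse_form S G K"
    and KB: "\<And>x. scalar_prod (h_vec h S x) (the (mat_inverse (gram_mat P h S)) *\<^sub>v h_vec h S x)
        = bform S K (\<lambda>j. h j x) (\<lambda>j. h j x)"
    and k: "0 < k" "k \<le> n" and L: "0 < L" "2 * L * B \<le> sparsity * real k"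
  defines "E \<equiv> {\<omega> \<in> space Q. sqrt (8 * sparsity * L / real k) \<le> sqrt (bform S K (\<lambda>j. avg k (h j) \<omega>) (\<lambda>j. avg k (h j) \<omega>))}"
  shows "E \<in> sets Q" "measure Q E \<le> 2 * exp (- (2 * L))"
proof -
  interpret inverse_form S G K by fact
  note lev = leverage_le_B[OF K KB] integrable_leverage[OF K KB] integral_leverage[OF K KB]
  define t where "t = sqrt (8 * sparsity * L / real k)"
  \<comment> \<open>The minimiser of \<open>l^2 * sparsity - l * t\<close>, with minimum
    \<open>- t^2 / (4 * sparsity) = - 2 * L / k\<close>.\<close>
  define l where "l = t / (2 * sparsity)"
  have pos: "sparsity > 0" "real k > 0" using sparsity_ge_1 k by auto
  have t: "t > 0" "t\<^sup>2 = 8 * sparsity * L / real k" using pos L by (auto simp: t_def)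
  have l: "l > 0" using t pos by (simp add: l_def)
  let ?q = "\<lambda>x. bform S K (\<lambda>j. h j x) (\<lambda>j. h j x)"
  have l2: "l\<^sup>2 = 2 * L / (sparsity * real k)"
    using pos unfolding l_def power_divide t(2) by (simp add: field_simps power2_eq_square)
  have small: "l * sqrt (?q x) \<le> 1" if "x \<in> space P" for x
  proof -
    have "(l * sqrt (?q x))\<^sup>2 = l\<^sup>2 * ?q x" by (simp add: power_mult_distrib K_psd)
    also have "\<dots> \<le> l\<^sup>2 * B" using lev(1)[OF that] by (intro mult_left_mono) auto
    also have "\<dots> \<le> 1" using L pos unfolding l2 by (simp add: field_simps)
    finally have "(l * sqrt (?q x))\<^sup>2 \<le> 1\<^sup>2" by simp
    then show ?thesis by (rule power2_le_imp_le) simp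
  qed
  let ?F = "\<lambda>x. exp (l * sqrt (?q x)) - l * sqrt (?q x)"
  have F: "0 \<le> ?F x" "?F x \<le> 1 + l\<^sup>2 * ?q x" if "x \<in> space P" for x
    using exp_sub_self_nonneg exp_bound[OF _ small[OF that]] l K_psd
    by (auto simp: power_mult_distrib algebra_simps)
  have meas: "?F \<in> borel_measurable P" using borel_measurable_integrable[OF lev(2)] by measurable
  have ir: "integrable P (\<lambda>x. 1 + l\<^sup>2 * ?q x)" using lev(2) by simp
  have int: "integrable P ?F"
    by (rule Bochner_Integration.integrable_bound[OF ir meas]) (use F in \<open>auto intro!: AE_I2 simp: K_psd\<close>)
  have "(\<integral>x. ?F x \<partial>P) \<le> (\<integral>x. 1 + l\<^sup>2 * ?q x \<partial>P)" using int ir F by (intro integral_mono) auto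
  also have "\<dots> = 1 + l\<^sup>2 * sparsity" using lev by (simp add: P.prob_space)
  also have "\<dots> \<le> exp (l\<^sup>2 * sparsity)" by (rule exp_ge_add_one_self)
  finally have le: "(\<integral>x. ?F x \<partial>P) \<le> exp (l\<^sup>2 * sparsity)" .
  note vt = vector_tail[OF k l K_psd bform_K_commute _ _ int le, of t]
  have hs: "\<And>j. j \<in> S \<Longrightarrow> integrable P (\<lambda>y. h j y)" "\<And>j. j \<in> S \<Longrightarrow> (\<integral>y. h j y \<partial>P) = 0"
    using integrable_h h_centered in_S_less by auto
  show "E \<in> sets Q" unfolding E_def t_def[symmetric] by (rule vt(1)[OF hs])
  have "measure Q E \<le> 2 * exp (real k * (l\<^sup>2 * sparsity - l * t))" unfolding E_def t_def[symmetric] by (rule vt(2)[OF hs])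
  also have "real k * (l\<^sup>2 * sparsity - l * t) = - (2 * L)"
  proof -
    have "l * t = 4 * L / real k" using pos t(2) by (simp add: l_def power2_eq_square field_simps)
    then show ?thesis unfolding l2 using pos by (simp add: field_simps)
  qed
  finally show "measure Q E \<le> 2 * exp (- (2 * L))" .
qed

text \<open>The \<open>K\<close>-norm of \<open>h * eps\<close> is at most \<open>sqrt B\<close>
  times \<open>\<bar>eps\<bar>\<close>, and \<open>exp z - z \<le> cosh (2 * z)\<close> reduces the
  step to the \<open>cosh\<close> moment of the sub-Gaussian noise. This holds for every
  \<open>l\<close>, so the sample size is not constrained.\<close>

lemma vector_tail_h_eps:
  assumes K: "inverse_form S G K"
    and KB: "\<And>x. scalar_prod (h_vec h S x) (the (mat_inverse (gram_mat P h S)) *\<^sub>v h_vec h S x)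
        = bform S K (\<lambda>j. h j x) (\<lambda>j. h j x)"
    and k: "0 < k" "k \<le> n" and L: "0 < L"
  defines "E \<equiv> {\<omega> \<in> space Q. 4 * tau * sqrt (B * L / real k)
    \<le> sqrt (bform S K (\<lambda>j. avg k (\<lambda>y. h j y * eps y) \<omega>) (\<lambda>j. avg k (\<lambda>y. h j y * eps y) \<omega>))}"
  shows "E \<in> sets Q" "measure Q E \<le> 2 * exp (- (2 * L))"
proof -
  interpret inverse_form S G K by fact
  note lev = leverage_le_B[OF K KB] integrable_leverage[OF K KB]
  have B: "B > 0" using sparsity_le_B[OF K KB] sparsity_ge_1 by simp
  define t where "t = 4 * tau * sqrt (B * L / real k)"
  \<comment> \<open>The minimiser of \<open>2 * l^2 * B * tau^2 - l * t\<close>, with minimum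
    \<open>- t^2 / (8 * B * tau^2) = - 2 * L / k\<close>.\<close>
  define l where "l = t / (4 * B * tau\<^sup>2)"
  have t: "t > 0" "t\<^sup>2 = 16 * tau\<^sup>2 * (B * L / real k)"
    using B L k tau_pos by (auto simp: t_def power_mult_distrib)
  have l: "l > 0" using t B tau_pos by (simp add: l_def)
  let ?q = "\<lambda>x. bform S K (\<lambda>j. h j x) (\<lambda>j. h j x)"
  let ?R = "\<lambda>x. sqrt (bform S K (\<lambda>j. h j x * eps x) (\<lambda>j. h j x * eps x))"
  have R: "?R x = \<bar>eps x\<bar> * sqrt (?q x)" for x
    using bform_scale[of S K "eps x" "\<lambda>j. h j x"] by (simp add: real_sqrt_mult mult.commute)
  let ?F = "\<lambda>x. exp (l * ?R x) - l * ?R x"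
  have F: "0 \<le> ?F x" "?F x \<le> cosh (2 * l * sqrt B * eps x)" if "x \<in> space P" for x
  proof -
    have "l * ?R x \<le> l * (\<bar>eps x\<bar> * sqrt B)"
      unfolding R using lev(1)[OF that] l by (intro mult_left_mono) auto
    then have "\<bar>2 * (l * ?R x)\<bar> \<le> \<bar>2 * l * sqrt B * eps x\<bar>"
      using l B K_psd by (simp add: abs_mult mult_ac)
    then have "cosh (2 * (l * ?R x)) \<le> cosh (2 * l * sqrt B * eps x)"
      by (metis abs_ge_zero cosh_real_abs cosh_real_nonneg_le_iff)
    then show "?F x \<le> cosh (2 * l * sqrt B * eps x)" using exp_le_add_cosh[of "l * ?R x"] by linarith
    show "0 \<le> ?F x" by (rule exp_sub_self_nonneg)
  qed
  note ir = subgaussian_integral_cosh[OF subgaussian_eps, of "2 * l * sqrt B"]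
  have meas: "?F \<in> borel_measurable P"
    unfolding R using borel_measurable_integrable[OF lev(2)] eps_meas by measurable
  have int: "integrable P ?F"
    by (rule Bochner_Integration.integrable_bound[OF ir(1) meas]) (use F in \<open>auto intro!: AE_I2\<close>)
  have "(\<integral>x. ?F x \<partial>P) \<le> (\<integral>x. cosh (2 * l * sqrt B * eps x) \<partial>P)" using int ir(1) F by (intro integral_mono) auto
  also have "\<dots> \<le> exp ((2 * l * sqrt B)\<^sup>2 * tau\<^sup>2 / 2)" by (rule ir(2))
  also have "(2 * l * sqrt B)\<^sup>2 * tau\<^sup>2 / 2 = 2 * l\<^sup>2 * B * tau\<^sup>2" using B by (simp add: power_mult_distrib)
  finally have le: "(\<integral>x. ?F x \<partial>P) \<le> exp (2 * l\<^sup>2 * B * tau\<^sup>2)" .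
  note vt = vector_tail[OF k l K_psd bform_K_commute _ _ int le, of t]
  have hs: "\<And>j. j \<in> S \<Longrightarrow> integrable P (\<lambda>y. h j y * eps y)" "\<And>j. j \<in> S \<Longrightarrow> (\<integral>y. h j y * eps y \<partial>P) = 0"
    using integrable_h_eps h_eps_mean in_S_less by auto
  show "E \<in> sets Q" unfolding E_def t_def[symmetric] by (rule vt(1)[OF hs])
  have "measure Q E \<le> 2 * exp (real k * (2 * l\<^sup>2 * B * tau\<^sup>2 - l * t))" unfolding E_def t_def[symmetric] by (rule vt(2)[OF hs])
  also have "real k * (2 * l\<^sup>2 * B * tau\<^sup>2 - l * t) = - (real k * t\<^sup>2 / (8 * B * tau\<^sup>2))"
    using B tau_pos by (simp add: l_def field_simps power2_eq_square)
  also have "\<dots> = - (2 * L)" unfolding t(2) using B tau_pos k by (simp add: field_simps)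
  finally show "measure Q E \<le> 2 * exp (- (2 * L))" .
qed

end

section \<open>Support recovery from bounds on empirical averages\<close>

lemma mean_centered_product:
  fixes u v :: "nat \<Rightarrow> real"
  assumes "N > 0"
  shows "(\<Sum>i<N. (u i - (\<Sum>i<N. u i) / real N) * (v i - (\<Sum>i<N. v i) / real N)) / real N
       = (\<Sum>i<N. u i * v i) / real N - (\<Sum>i<N. u i) / real N * ((\<Sum>i<N. v i) / real N)"
proof -
  define a b where "a = (\<Sum>i<N. u i) / real N" and "b = (\<Sum>i<N. v i) / real N"
  have ab: "(\<Sum>i<N. u i) = real N * a" "(\<Sum>i<N. v i) = real N * b" using assms by (auto simp: a_def b_def)
  have "(\<Sum>i<N. (u i - a) * (v i - b)) = (\<Sum>i<N. u i * v i - a * v i - b * u i + a * b)"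
    by (intro sum.cong refl) (simp add: algebra_simps)
  also have "\<dots> = (\<Sum>i<N. u i * v i) - a * (\<Sum>i<N. v i) - b * (\<Sum>i<N. u i) + real N * (a * b)"
    by (simp add: sum.distrib sum_subtractf sum_distrib_left)
  also have "\<dots> = (\<Sum>i<N. u i * v i) - real N * (a * b)" unfolding ab by (simp add: algebra_simps)
  finally have "(\<Sum>i<N. (u i - a) * (v i - b)) = (\<Sum>i<N. u i * v i) - real N * (a * b)" .
  then show ?thesis unfolding a_def[symmetric] b_def[symmetric] using assms
    by (simp add: diff_divide_distrib)
qed

context control_variates
begin

text \<open>Centring removes the intercept from the model, so the data fit the scheme of
  \<open>lasso_support\<close>. Each centred entry is an uncentred average minus a product of two
  means, and the hypotheses bound these separately.\<close>

lemma lasso_selects_support: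
  assumes N: "N > 0" and lasso: "is_lasso f h m (\<lambda>i. X i \<omega>) N lam b" and lam: "lam > 0"
    and big: "\<And>k. k \<in> S \<Longrightarrow> 3 * sqrt sparsity * lam \<le> \<gamma> * \<bar>bstar k\<bar>"
    and gram: "\<And>j k. j < m \<Longrightarrow> k \<in> S \<Longrightarrow> \<bar>avg N (\<lambda>x. h j x * h k x) \<omega> - G j k\<bar> \<le> \<gamma> / (6 * sparsity)"
    and mean: "\<And>j. j < m \<Longrightarrow> \<bar>avg N (h j) \<omega>\<bar> \<le> \<mu>\<^sub>0" "\<mu>\<^sub>0\<^sup>2 \<le> \<gamma> / (30 * sparsity)"
    and noise: "\<And>j. j < m \<Longrightarrow> \<bar>avg N (\<lambda>x. h j x * eps x) \<omega> - avg N (h j) \<omega> * avg N eps \<omega>\<bar> \<le> lam / 4"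
  shows "supp_m m b = S"
proof -
  define Z where "Z i j = h j (X i \<omega>) - (\<Sum>i'<N. h j (X i' \<omega>)) / real N" for i j
  define e where "e i = eps (X i \<omega>) - (\<Sum>i'<N. eps (X i' \<omega>)) / real N" for i
  define y where "y i = f (X i \<omega>) - (\<Sum>i'<N. f (X i' \<omega>)) / real N" for i
  define C where "C j k = (\<Sum>i<N. Z i j * Z i k) / real N" for j k
  define W where "W j = (\<Sum>i<N. Z i j * e i) / real N" for j
  define \<rho> where "\<rho> j = (\<Sum>i<N. Z i j * (y i - (\<Sum>j<m. Z i j * b j))) / real N" for j
  have y: "y i = (\<Sum>k<m. Z i k * bstar k) + e i" for i
  proof -
    have f: "f x = mean_f + (\<Sum>k<m. bstar k * h k x) + eps x" for x by (simp add: eps_def mean_f_def)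
    have "(\<Sum>i<N. \<Sum>k<m. bstar k * h k (X i \<omega>)) = (\<Sum>k<m. bstar k * (\<Sum>i<N. h k (X i \<omega>)))"
      by (subst sum.swap) (simp add: sum_distrib_left)
    then have "(\<Sum>i<N. f (X i \<omega>)) / real N = mean_f + (\<Sum>k<m. bstar k * ((\<Sum>i<N. h k (X i \<omega>)) / real N))
        + (\<Sum>i<N. eps (X i \<omega>)) / real N"
      using N by (subst f) (simp add: sum.distrib add_divide_distrib sum_divide_distrib[of _ "{..<m}"])
    then show ?thesis
      unfolding y_def Z_def e_def by (simp add: f[of "X i \<omega>"] algebra_simps sum_subtractf)
  qed
  have min: "1 / (2 * real N) * (\<Sum>i<N. (y i - (\<Sum>j<m. Z i j * b j))\<^sup>2) + lam * (\<Sum>j<m. \<bar>b j\<bar>)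
      \<le> 1 / (2 * real N) * (\<Sum>i<N. (y i - (\<Sum>j<m. Z i j * b' j))\<^sup>2) + lam * (\<Sum>j<m. \<bar>b' j\<bar>)" for b'
    using lasso unfolding is_lasso_def lasso_obj_def y_def Z_def by blast
  have kkt: "\<bar>\<rho> j\<bar> \<le> lam" "b j * \<rho> j = lam * \<bar>b j\<bar>" if "j < m" for j
    unfolding \<rho>_def using lasso_stationarity[OF min that N] lam by auto
  have \<rho>: "\<rho> j = W j - (\<Sum>k<m. C j k * (b k - bstar k))" for j
  proof -
    have "(\<Sum>i<N. Z i j * (y i - (\<Sum>k<m. Z i k * b k)))
        = (\<Sum>i<N. Z i j * e i - (\<Sum>k<m. Z i j * Z i k * (b k - bstar k)))"
      by (intro sum.cong refl) (simp add: y algebra_simps sum_distrib_left sum_subtractf)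
    also have "\<dots> = (\<Sum>i<N. Z i j * e i) - (\<Sum>k<m. (\<Sum>i<N. Z i j * Z i k) * (b k - bstar k))"
    proof -
      have "(\<Sum>i<N. \<Sum>k<m. Z i j * Z i k * (b k - bstar k))
          = (\<Sum>k<m. (\<Sum>i<N. Z i j * Z i k) * (b k - bstar k))"
        by (subst sum.swap) (simp add: sum_distrib_right)
      then show ?thesis by (simp add: sum_subtractf)
    qed
    finally show ?thesis
      by (simp add: \<rho>_def W_def C_def diff_divide_distrib sum_divide_distrib[of _ "{..<m}"])
  qed
  have C: "C j k = avg N (\<lambda>x. h j x * h k x) \<omega> - avg N (h j) \<omega> * avg N (h k) \<omega>" for j k
    unfolding C_def Z_def avg_def by (rule mean_centered_product[OF N])
  have W: "W j = avg N (\<lambda>x. h j x * eps x) \<omega> - avg N (h j) \<omega> * avg N eps \<omega>" for j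
    unfolding W_def Z_def e_def avg_def by (rule mean_centered_product[OF N])
  \<comment> \<open>The error budget is \<open>1/6\<close> for the uncentred entry and
    \<open>1/30\<close> for the product of means, together \<open>1/5\<close>.\<close>
  have CG: "\<bar>C j k - G j k\<bar> \<le> \<gamma> / (5 * sparsity)" if "j < m" "k \<in> S" for j k
  proof -
    have "\<bar>avg N (h j) \<omega> * avg N (h k) \<omega>\<bar> \<le> \<mu>\<^sub>0 * \<mu>\<^sub>0"
      unfolding abs_mult using mean(1)[OF that(1)] mean(1)[OF in_S_less[OF that(2)]] by (intro mult_mono) auto
    also have "\<dots> \<le> \<gamma> / (30 * sparsity)" using mean(2) by (simp add: power2_eq_square)
    finally have "\<bar>C j k - G j k\<bar> \<le> \<gamma> / (6 * sparsity) + \<gamma> / (30 * sparsity)"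
      using gram[OF that] unfolding C by linarith
    also have "\<dots> = \<gamma> / (5 * sparsity)" by (simp add: field_simps)
    finally show ?thesis .
  qed
  have psd: "0 \<le> (\<Sum>j<m. \<Sum>k<m. d j * C j k * d k)" for d
  proof -
    have "(\<Sum>j<m. \<Sum>k<m. d j * C j k * d k) = (\<Sum>j<m. \<Sum>k<m. \<Sum>i<N. (d j * Z i j) * (d k * Z i k)) / real N"
      by (simp add: C_def sum_distrib_left sum_distrib_right sum_divide_distrib mult_ac)
    also have "(\<Sum>j<m. \<Sum>k<m. \<Sum>i<N. (d j * Z i j) * (d k * Z i k)) = (\<Sum>i<N. (\<Sum>j<m. d j * Z i j)\<^sup>2)"
      unfolding power2_eq_square sum_product by (subst (2) sum.swap, subst sum.swap) simp
    finally show ?thesis by (simp add: sum_nonneg)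
  qed
  have low: "4 / 5 * \<gamma> * (\<Sum>j\<in>S. (d j)\<^sup>2) \<le> (\<Sum>j\<in>S. \<Sum>k\<in>S. d j * C j k * d k)" for d
  proof -
    have "bform S G d d - \<gamma> / (5 * sparsity) * real (card S) * (\<Sum>j\<in>S. (d j)\<^sup>2) \<le> bform S C d d"
      using CG in_S_less by (intro bform_entrywise_ge S_fin S_nonempty) auto
    also have "\<gamma> / (5 * sparsity) * real (card S) = \<gamma> / 5"
      using sparsity_ge_1 by (simp add: sparsity_def)
    finally show ?thesis using \<gamma>_le[of d] by (simp add: bform_def)
  qed
  have "{j. j < m \<and> b j \<noteq> 0} = S"
  proof (rule lasso_support[where C = C and W = W and \<beta> = bstar and \<mu> = lam and \<gamma> = \<gamma> and \<rho> = \<rho>])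
    \<comment> \<open>Here \<open>orth\<close> makes the population entry zero, so \<open>CG\<close>
      bounds the empirical entry itself.\<close>
    show "\<bar>C j k\<bar> \<le> \<gamma> / (5 * real (card S))" if "j < m" "j \<notin> S" "k \<in> S" for j k
      using CG[of j k] orth[of j k] that by (simp add: G_def S_def sparsity_def)
    show "C j k = C k j" for j k by (simp add: C_def mult.commute)
    show "3 * sqrt (real (card S)) * lam \<le> \<gamma> * \<bar>bstar k\<bar>" if "k \<in> S" for k
      using big[OF that] by (simp add: sparsity_def)
    show "\<bar>W j\<bar> \<le> lam / 4" if "j < m" for j unfolding W by (rule noise[OF that])
  qed (use S_sub S_nonempty bstar_S lam \<gamma>_pos kkt \<rho> psd low in auto)
  then show ?thesis by (simp add: supp_m_def)
qed

section \<open>Scalar tail bounds, the favourable event and the final estimate\<close>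

lemma avg_diff_const: "k > 0 \<Longrightarrow> avg k (\<lambda>x. g x - c) \<omega> = avg k g \<omega> - c"
  by (simp add: avg_def sum_subtractf diff_divide_distrib)

lemma gram_tail:
  assumes "j < m" "i < m" "0 < k" "k \<le> n" "0 < L"
  shows "measure Q {\<omega> \<in> space Q. sqrt (2 * U ^ 4 * L / real k) \<le> \<bar>avg k (\<lambda>x. h j x * h i x - G j i) \<omega>\<bar>} \<le> 2 * exp (- L)"
proof (rule subgaussian_tail)
  have "subgaussian P (\<lambda>x. h j x * h i x - G j i) (((U\<^sup>2 - G j i) - (- (U\<^sup>2) - G j i))\<^sup>2 / 4)"
  proof (rule subgaussian_bounded[OF P.prob_space_axioms])
    show "(\<lambda>x. h j x * h i x - G j i) \<in> borel_measurable P" using assms h_meas by measurable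
    show "h j x * h i x - G j i \<in> {- (U\<^sup>2) - G j i..U\<^sup>2 - G j i}" if "x \<in> space P" for x
    proof -
      have "\<bar>h j x * h i x\<bar> \<le> U\<^sup>2" unfolding power2_eq_square abs_mult
        using h_le_U[of j x] h_le_U[of i x] assms that by (intro mult_mono) auto
      then show ?thesis by (simp add: abs_le_iff)
    qed
    show "(\<integral>x. h j x * h i x - G j i \<partial>P) = 0"
      using integrable_h_h[of j i] assms by (simp add: G_def P.prob_space)
  qed
  moreover have "((U\<^sup>2 - G j i) - (- (U\<^sup>2) - G j i))\<^sup>2 / 4 = U ^ 4" by (simp add: power2_eq_square eval_nat_numeral)
  ultimately show "subgaussian P (\<lambda>x. h j x * h i x - G j i) (U ^ 4)" by simp
  show "(\<lambda>x. h j x * h i x - G j i) \<in> borel_measurable P" using assms h_meas by measurable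
qed (use assms U_pos in auto)

lemma h_tail:
  assumes "j < m" "0 < k" "k \<le> n" "0 < L"
  shows "measure Q {\<omega> \<in> space Q. sqrt (2 * U\<^sup>2 * L / real k) \<le> \<bar>avg k (h j) \<omega>\<bar>} \<le> 2 * exp (- L)"
proof (rule subgaussian_tail)
  have "subgaussian P (h j) ((U - (- U))\<^sup>2 / 4)"
    using assms h_meas h_centered h_le_U[of j]
    by (intro subgaussian_bounded[OF P.prob_space_axioms]) (auto simp: abs_le_iff minus_le_iff)
  then show "subgaussian P (h j) (U\<^sup>2)" by (simp add: power2_eq_square)
qed (use assms U_pos h_meas in auto)

lemma h_eps_tail:
  assumes "j < m" "0 < k" "k \<le> n" "0 < L"
  shows "measure Q {\<omega> \<in> space Q. sqrt (2 * (4 * U\<^sup>2 * tau\<^sup>2) * L / real k) \<le> \<bar>avg k (\<lambda>x. h j x * eps x) \<omega>\<bar>} \<le> 2 * exp (- L)"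
proof (rule subgaussian_tail)
  show "subgaussian P (\<lambda>x. h j x * eps x) (4 * U\<^sup>2 * tau\<^sup>2)"
    using assms h_meas h_le_U[of j] h_eps_mean
    by (intro subgaussian_mult_bounded[OF P.prob_space_axioms subgaussian_eps integrable_eps]) auto
  show "(\<lambda>x. h j x * eps x) \<in> borel_measurable P" using assms h_meas eps_meas by measurable
qed (use assms U_pos tau_pos in auto)

lemma eps_tail:
  assumes "0 < k" "k \<le> n" "0 < L"
  shows "measure Q {\<omega> \<in> space Q. sqrt (2 * tau\<^sup>2 * L / real k) \<le> \<bar>avg k eps \<omega>\<bar>} \<le> 2 * exp (- L)"
  by (rule subgaussian_tail) (use assms tau_pos eps_meas subgaussian_eps in auto)

lemma measure_UN_le_card:
  assumes "finite I" "\<And>i. i \<in> I \<Longrightarrow> F i \<in> sets Q" "\<And>i. i \<in> I \<Longrightarrow> measure Q (F i) \<le> p"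
  shows "measure Q (\<Union>i\<in>I. F i) \<le> real (card I) * p"
proof -
  have "measure Q (\<Union>i\<in>I. F i) \<le> (\<Sum>i\<in>I. measure Q (F i))"
    using assms by (intro Q.finite_measure_subadditive_finite) auto
  also have "\<dots> \<le> (\<Sum>i\<in>I. p)" by (intro sum_mono assms)
  finally show ?thesis by simp
qed

text \<open>The sample-size and penalty conditions are first turned into thresholds for the
  averages. A union bound then gives the favourable event, on which
  \<open>lasso_selects_support\<close> and \<open>ols_intercept_error\<close> apply
  pointwise.\<close>

lemma lslasso_error:
  assumes delta: "0 < delta" "delta < 1" and N: "1 \<le> N" "N \<le> n"
    and N_large: "real N \<ge> 75 * \<xi>\<^sup>2 * ln (20 * sparsity * real m / delta)"
    and lam_lower: "13 * U * sqrt (ln (20 * real m / delta)) * tau / sqrt (real N) \<le> lam"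
    and lam_upper: "lam \<le> \<gamma> / (3 * sqrt sparsity) * Min ((\<lambda>k. \<bar>bstar k\<bar>) ` S)"
  shows "\<exists>A\<in>sets Q. measure Q A \<ge> 1 - delta \<and>
           (\<forall>\<omega>\<in>A. \<forall>blasso a b.
              is_lasso f h m (\<lambda>i. X i \<omega>) N lam blasso \<longrightarrow>
              is_ols f h (\<lambda>i. X i \<omega>) n (supp_m m blasso) a b \<longrightarrow>
              \<bar>a - mean_f\<bar> \<le> sqrt (2 * ln (16 / delta)) * tau / sqrt (real n)
                  + 58 * sqrt (B * sparsity * ln (16 * sparsity / delta) * ln (8 / delta)) * tau / real n)"
proof -
  obtain K where K: "inverse_form S G K"
    and KB: "\<And>x. scalar_prod (h_vec h S x) (the (mat_inverse (gram_mat P h S)) *\<^sub>v h_vec h S x)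
        = bform S K (\<lambda>j. h j x) (\<lambda>j. h j x)"
    by (rule gram_inverse) (rule that)
  interpret K: inverse_form S G K by fact
  define L L1 L8 L16 where "L = ln (20 * sparsity * real m / delta)" and "L1 = ln (20 * real m / delta)"
    and "L8 = ln (8 / delta)" and "L16 = ln (16 / delta)"
  have s1: "1 \<le> sparsity" and sm: "sparsity \<le> real m" and m1: "1 \<le> real m"
    using sparsity_ge_1 sparsity_le_m by auto
  have smm: "real m \<le> sparsity * real m" "1 \<le> sparsity * real m"
    using s1 m1 mult_right_mono[of 1 sparsity "real m"] by linarith+
  have Lpos: "0 < L1" "0 < L8" "0 < L16"
    using delta m1 by (auto simp: L1_def L8_def L16_def intro!: ln_gt_zero)
  \<comment> \<open>One logarithm dominates all others, so the single lower bound on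
    \<open>N\<close> serves every threshold.\<close>
  have Lle: "L1 \<le> L" "L8 \<le> L" "L16 \<le> L"
  proof -
    have "20 * real m \<le> 20 * sparsity * real m" "8 \<le> 20 * sparsity * real m" "16 \<le> 20 * sparsity * real m"
      using smm unfolding mult.assoc by linarith+
    then show "L1 \<le> L" "L8 \<le> L" "L16 \<le> L"
      unfolding L_def L1_def L8_def L16_def using delta m1
      by (auto intro!: ln_mono divide_right_mono divide_pos_pos)
  qed
  have L: "0 < L" using Lpos Lle by linarith
  have N0: "0 < N" "0 < n" using N by auto
  have Nn: "real N \<le> real n" using N by simp
  have B: "0 < B" "B \<le> \<xi>" "sparsity \<le> B"
    using B_le_\<xi>[OF K KB] sparsity_le_B[OF K KB] s1 by auto
  have xi: "1 \<le> \<xi>" "sparsity \<le> \<xi>" using \<xi>_ge s1 by auto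
  have xi2: "\<xi> \<le> \<xi>\<^sup>2" "1 \<le> \<xi>\<^sup>2" using xi mult_right_mono[of 1 \<xi> \<xi>] unfolding power2_eq_square by linarith+
  have large: "75 * \<xi>\<^sup>2 * L \<le> real N" "75 * \<xi>\<^sup>2 * L \<le> real n" using N_large Nn by (auto simp: L_def)
  have large1: "75 * \<xi> * L \<le> real n" "75 * L \<le> real N" "75 * L \<le> real n" "75 * \<xi> * L \<le> real N"
  proof -
    have "75 * \<xi> * L \<le> 75 * \<xi>\<^sup>2 * L" "75 * L \<le> 75 * \<xi>\<^sup>2 * L" using xi2 L by auto
    then show "75 * \<xi> * L \<le> real n" "75 * L \<le> real N" "75 * L \<le> real n" "75 * \<xi> * L \<le> real N" using large by auto
  qed
  have xiU: "\<xi> * \<gamma> = sparsity * U\<^sup>2" using \<gamma>_pos by (simp add: \<xi>_def)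
  \<comment> \<open>Squaring requires \<open>k\<close> to be at least \<open>2 * 36 = 72\<close>
    times \<open>\<xi>^2 * L\<close>; this is where the sample-size constant 75 is nearly
    exhausted.\<close>
  have gram_thr: "sqrt (2 * U ^ 4 * L / real k) \<le> \<gamma> / (6 * sparsity)"
    if "75 * \<xi>\<^sup>2 * L \<le> real k" "0 < k" for k
  proof (rule real_le_lsqrt)
    have "72 * (sparsity\<^sup>2 * U ^ 4 * L) \<le> 75 * (sparsity\<^sup>2 * U ^ 4 * L)" using s1 L by simp
    also have "sparsity\<^sup>2 * U ^ 4 = (\<xi> * \<gamma>)\<^sup>2" unfolding xiU by (simp add: power_mult_distrib)
    also have "75 * ((\<xi> * \<gamma>)\<^sup>2 * L) = \<gamma>\<^sup>2 * (75 * \<xi>\<^sup>2 * L)" by (simp add: power_mult_distrib)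
    also have "\<dots> \<le> \<gamma>\<^sup>2 * real k" using that by (intro mult_left_mono) auto
    finally have "72 * ((\<xi> * \<gamma>)\<^sup>2 * L) \<le> \<gamma>\<^sup>2 * real k" .
    moreover have "(\<xi> * \<gamma>)\<^sup>2 = sparsity\<^sup>2 * U ^ 4" unfolding xiU by (simp add: power_mult_distrib)
    ultimately have *: "72 * (sparsity\<^sup>2 * U ^ 4 * L) \<le> \<gamma>\<^sup>2 * real k" by simp
    show "2 * U ^ 4 * L / real k \<le> (\<gamma> / (6 * sparsity))\<^sup>2"
      using * that s1 by (simp add: power_divide power_mult_distrib divide_le_eq le_divide_eq mult_ac)
  qed (use \<gamma>_pos s1 in auto)
  have mean_thr: "2 * U\<^sup>2 * L1 / real N \<le> \<gamma> / (30 * sparsity)"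
  proof -
    have "60 * (sparsity * U\<^sup>2) * L1 \<le> 75 * (sparsity * U\<^sup>2) * L"
      using Lle(1) Lpos(1) s1 by (intro mult_mono) auto
    also have "\<dots> = \<gamma> * (75 * \<xi> * L)" by (simp flip: xiU)
    also have "\<dots> \<le> \<gamma> * real N" using large1(4) \<gamma>_pos by (intro mult_left_mono) auto
    finally show ?thesis using s1 N0 by (simp add: field_simps)
  qed
  define r where "r = sqrt (L1 / real N)"
  have r: "0 < r" "r \<le> 1 / 8"
  proof -
    show "0 < r" using Lpos N0 by (simp add: r_def)
    have "L1 / real N \<le> (1 / 8)\<^sup>2" using large1(2) Lle(1) L N0 by (simp add: field_simps power2_eq_square)
    then show "r \<le> 1 / 8" unfolding r_def by (intro real_le_lsqrt) auto
  qed
  have lam13: "13 * U * tau * r \<le> lam"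
    using lam_lower by (simp add: r_def L1_def real_sqrt_divide mult_ac)
  have lam: "0 < lam" using lam13 U_pos tau_pos r by (smt (verit) mult_pos_pos)
  \<comment> \<open>Source of the constant 13: in units of \<open>U * tau * r\<close> the first term
    is at most 3, from \<open>sqrt 8\<close>, and the second at most \<open>2 * r\<close>, hence
    \<open>1/4\<close>. The sum is \<open>13/4\<close>.\<close>
  have noise_thr: "sqrt (2 * (4 * U\<^sup>2 * tau\<^sup>2) * L1 / real N)
      + sqrt (2 * U\<^sup>2 * L1 / real N) * sqrt (2 * tau\<^sup>2 * L1 / real N) \<le> lam / 4"
  proof -
    have "sqrt (2 * (4 * U\<^sup>2 * tau\<^sup>2) * L1 / real N) = sqrt ((U * tau)\<^sup>2 * 8 * (L1 / real N))"
      by (simp add: power_mult_distrib)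
    also have "\<dots> = U * tau * sqrt 8 * r"
      using U_pos tau_pos by (simp only: real_sqrt_mult real_sqrt_abs r_def) simp
    also have "\<dots> \<le> U * tau * 3 * r"
      using U_pos tau_pos r by (intro mult_right_mono mult_left_mono real_le_lsqrt) auto
    finally have 1: "sqrt (2 * (4 * U\<^sup>2 * tau\<^sup>2) * L1 / real N) \<le> U * tau * r * 3" by (simp add: mult_ac)
    have "sqrt (2 * U\<^sup>2 * L1 / real N) * sqrt (2 * tau\<^sup>2 * L1 / real N)
        = sqrt ((2 * U * tau)\<^sup>2 * (L1 / real N)\<^sup>2)"
      unfolding real_sqrt_mult[symmetric] by (simp add: power2_eq_square)
    also have "\<dots> = 2 * U * tau * (L1 / real N)"
      using U_pos tau_pos Lpos by (simp add: real_sqrt_mult)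
    also have "L1 / real N = r * r" using Lpos by (simp add: r_def)
    also have "2 * U * tau * (r * r) \<le> 2 * U * tau * (r * (1 / 8))"
      using U_pos tau_pos r by (intro mult_left_mono) auto
    finally have "sqrt (2 * U\<^sup>2 * L1 / real N) * sqrt (2 * tau\<^sup>2 * L1 / real N) \<le> U * tau * r / 4" by (simp add: mult_ac)
    with 1 lam13 show ?thesis by linarith
  qed
  have big: "3 * sqrt sparsity * lam \<le> \<gamma> * \<bar>bstar k\<bar>" if "k \<in> S" for k
  proof -
    have "3 * sqrt sparsity * lam \<le> 3 * sqrt sparsity * (\<gamma> / (3 * sqrt sparsity) * Min ((\<lambda>k. \<bar>bstar k\<bar>) ` S))"
      using lam_upper s1 by (intro mult_left_mono) auto
    also have "\<dots> = \<gamma> * Min ((\<lambda>k. \<bar>bstar k\<bar>) ` S)" using s1 by simp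
    also have "\<dots> \<le> \<gamma> * \<bar>bstar k\<bar>" using \<gamma>_pos that S_fin by (intro mult_left_mono Min_le) auto
    finally show ?thesis .
  qed

  define D where "D k g t = {\<omega> \<in> space Q. t \<le> \<bar>avg k g \<omega>\<bar>}" for k g t
  have D_sets: "D k g t \<in> sets Q" if "k \<le> n" "g \<in> borel_measurable P" for k g t
    unfolding D_def using avg_measurable[OF that] by measurable
  \<comment> \<open>The Gram event depends on the sample size because it is needed twice: at
    \<open>N\<close> for the selection and at \<open>n\<close> for least squares.\<close>
  define E1 where "E1 = (\<lambda>k. \<Union>p\<in>{..<m} \<times> S. D k (\<lambda>x. h (fst p) x * h (snd p) x - G (fst p) (snd p)) (sqrt (2 * U ^ 4 * L / real k)))"
  define E2 where "E2 = (\<Union>j\<in>{..<m}. D N (h j) (sqrt (2 * U\<^sup>2 * L1 / real N)))"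
  define E3 where "E3 = (\<Union>j\<in>{..<m}. D N (\<lambda>x. h j x * eps x) (sqrt (2 * (4 * U\<^sup>2 * tau\<^sup>2) * L1 / real N)))"
  define E4 where "E4 = D N eps (sqrt (2 * tau\<^sup>2 * L1 / real N))"
  define E6 where "E6 = D n eps (sqrt (2 * tau\<^sup>2 * L16 / real n))"
  define E7 where "E7 = {\<omega> \<in> space Q. sqrt (8 * sparsity * L8 / real n)
      \<le> sqrt (bform S K (\<lambda>j. avg n (h j) \<omega>) (\<lambda>j. avg n (h j) \<omega>))}"
  define E8 where "E8 = {\<omega> \<in> space Q. 4 * tau * sqrt (B * L8 / real n)
    \<le> sqrt (bform S K (\<lambda>j. avg n (\<lambda>y. h j y * eps y) \<omega>) (\<lambda>j. avg n (\<lambda>y. h j y * eps y) \<omega>))}"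
  have exps: "2 * exp (- L) = delta / (10 * sparsity * real m)" "2 * exp (- L1) = delta / (10 * real m)"
    "2 * exp (- L16) = delta / 8" "2 * exp (- (2 * L8)) \<le> delta / 32"
  proof -
    show "2 * exp (- L) = delta / (10 * sparsity * real m)" "2 * exp (- L1) = delta / (10 * real m)"
      "2 * exp (- L16) = delta / 8"
      using delta s1 m1 smm by (auto simp: L_def L1_def L16_def exp_minus field_simps)
    have "2 * exp (- (2 * L8)) = 2 * (exp (- L8) * exp (- L8))" by (simp flip: exp_add)
    also have "exp (- L8) = delta / 8" using delta by (simp add: L8_def exp_minus field_simps)
    also have "2 * (delta / 8 * (delta / 8)) \<le> delta / 32" using delta by (simp add: field_simps)
    finally show "2 * exp (- (2 * L8)) \<le> delta / 32" .
  qed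
  have E1: "E1 k \<in> sets Q" "measure Q (E1 k) \<le> delta / 10" if "0 < k" "k \<le> n" for k
  proof -
    have meas: "D k (\<lambda>x. h (fst p) x * h (snd p) x - G (fst p) (snd p)) (sqrt (2 * U ^ 4 * L / real k)) \<in> sets Q"
      if "p \<in> {..<m} \<times> S" for p
    proof -
      have "h (fst p) \<in> borel_measurable P" "h (snd p) \<in> borel_measurable P"
        using that in_S_less by (auto intro!: h_meas)
      then show ?thesis using \<open>k \<le> n\<close>
        by (intro D_sets borel_measurable_diff borel_measurable_times borel_measurable_const)
    qed
    show "E1 k \<in> sets Q" unfolding E1_def using S_fin meas by (intro sets.finite_UN) auto
    have "measure Q (E1 k) \<le> real (card ({..<m} \<times> S)) * (2 * exp (- L))"
      unfolding E1_def
    proof (rule measure_UN_le_card)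
      fix p assume "p \<in> {..<m} \<times> S"
      then show "measure Q (D k (\<lambda>x. h (fst p) x * h (snd p) x - G (fst p) (snd p)) (sqrt (2 * U ^ 4 * L / real k))) \<le> 2 * exp (- L)"
        unfolding D_def using that in_S_less L by (intro gram_tail) auto
    qed (use meas S_fin in auto)
    also have "real (card ({..<m} \<times> S)) = sparsity * real m" by (simp add: card_cartesian_product sparsity_def)
    also have "sparsity * real m * (2 * exp (- L)) = delta / 10" unfolding exps using s1 m1 by simp
    finally show "measure Q (E1 k) \<le> delta / 10" .
  qed
  have E2: "E2 \<in> sets Q" "measure Q E2 \<le> delta / 10"
  proof -
    show "E2 \<in> sets Q" unfolding E2_def using N h_meas by (intro sets.finite_UN D_sets) auto
    have "measure Q E2 \<le> real (card {..<m}) * (2 * exp (- L1))"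
      unfolding E2_def using N N0 h_meas Lpos
      by (intro measure_UN_le_card D_sets) (auto simp: D_def intro!: h_tail)
    also have "\<dots> = delta / 10" unfolding exps using m1 by simp
    finally show "measure Q E2 \<le> delta / 10" .
  qed
  have E3: "E3 \<in> sets Q" "measure Q E3 \<le> delta / 10"
  proof -
    have meas: "D N (\<lambda>x. h j x * eps x) t \<in> sets Q" if "j < m" for j t
      using h_meas[OF that] eps_meas N by (intro D_sets) measurable
    show "E3 \<in> sets Q" unfolding E3_def using meas by (intro sets.finite_UN) auto
    have "measure Q E3 \<le> real (card {..<m}) * (2 * exp (- L1))"
      unfolding E3_def
    proof (rule measure_UN_le_card)
      fix j assume "j \<in> {..<m}"
      then show "measure Q (D N (\<lambda>x. h j x * eps x) (sqrt (2 * (4 * U\<^sup>2 * tau\<^sup>2) * L1 / real N))) \<le> 2 * exp (- L1)"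
        unfolding D_def using N N0 Lpos by (intro h_eps_tail) auto
    qed (use meas in auto)
    also have "\<dots> = delta / 10" unfolding exps using m1 by simp
    finally show "measure Q E3 \<le> delta / 10" .
  qed
  have E4: "E4 \<in> sets Q" "measure Q E4 \<le> delta / 10"
  proof -
    show "E4 \<in> sets Q" unfolding E4_def using N eps_meas by (intro D_sets) auto
    have "measure Q E4 \<le> 2 * exp (- L1)"
      unfolding E4_def D_def using N N0 Lpos by (intro eps_tail) auto
    also have "\<dots> \<le> delta / 10" unfolding exps using m1 delta by (intro divide_left_mono) auto
    finally show "measure Q E4 \<le> delta / 10" .
  qed
  have E6: "E6 \<in> sets Q" "measure Q E6 \<le> delta / 8"
    unfolding E6_def exps(3)[symmetric] using N0 eps_meas Lpos eps_tail[of n L16] D_sets by (auto simp: D_def[abs_def])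
  \<comment> \<open>The smallness condition of \<open>vector_tail_h\<close>, from
    \<open>B \<le> \<xi>\<close> and the sample size.\<close>
  have "2 * L8 * B \<le> sparsity * real n"
  proof -
    have "2 * L8 * B \<le> 2 * L * \<xi>" using Lle(2) Lpos B by (intro mult_mono) auto
    also have "\<dots> \<le> 75 * \<xi> * L" using xi L by simp
    also have "\<dots> \<le> 1 * real n" using large1 by simp
    also have "\<dots> \<le> sparsity * real n" using s1 by (intro mult_right_mono) auto
    finally show ?thesis .
  qed
  from vector_tail_h[OF K KB N0(2) order_refl Lpos(2) this]
  have E7: "E7 \<in> sets Q" "measure Q E7 \<le> delta / 32" using exps(4) by (auto simp: E7_def)
  from vector_tail_h_eps[OF K KB N0(2) order_refl Lpos(2)]
  have E8: "E8 \<in> sets Q" "measure Q E8 \<le> delta / 32" using exps(4) by (auto simp: E8_def)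
  define Bad where "Bad = E1 N \<union> (E1 n \<union> (E2 \<union> (E3 \<union> (E4 \<union> (E6 \<union> (E7 \<union> E8))))))"
  note E1N = E1[OF N0(1) N(2)] and E1n = E1[OF N0(2) order_refl]
  have un: "measure Q (F \<union> F') \<le> p + p'" if "F \<in> sets Q" "F' \<in> sets Q" "measure Q F \<le> p" "measure Q F' \<le> p'" for F F' p p'
    using measure_Un_le[OF that(1,2)] that(3,4) by linarith
  have Bad: "Bad \<in> sets Q" unfolding Bad_def using E1N E1n E2 E3 E4 E6 E7 E8 by auto
  \<comment> \<open>The total is \<open>11/16\<close> of \<open>delta\<close>.\<close>
  have "measure Q Bad \<le> delta / 10 + (delta / 10 + (delta / 10 + (delta / 10 + (delta / 10 + (delta / 8 + (delta / 32 + delta / 32))))))"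
    unfolding Bad_def by (intro un sets.Un E1N E1n E2 E3 E4 E6 E7 E8)
  also have "\<dots> \<le> delta" using delta by simp
  finally have Bad_le: "measure Q Bad \<le> delta" .
  show ?thesis
  proof (intro bexI conjI ballI allI impI)
    show "space Q - Bad \<in> sets Q" using Bad by auto
    show "1 - delta \<le> measure Q (space Q - Bad)" using Q.prob_compl[OF Bad] Bad_le by simp
    fix \<omega> bl a b
    assume \<omega>: "\<omega> \<in> space Q - Bad" and lasso: "is_lasso f h m (\<lambda>i. X i \<omega>) N lam bl"
      and ols: "is_ols f h (\<lambda>i. X i \<omega>) n (supp_m m bl) a b"
    have notD: "\<bar>avg k g \<omega>\<bar> \<le> t" if "\<omega> \<notin> D k g t" for k g t
      using that \<omega> by (simp add: D_def)
    have gram: "\<bar>avg k (\<lambda>x. h j x * h i x) \<omega> - G j i\<bar> \<le> \<gamma> / (6 * sparsity)"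
      if "\<omega> \<notin> E1 k" "75 * \<xi>\<^sup>2 * L \<le> real k" "0 < k" "j < m" "i \<in> S" for k j i
    proof -
      have "\<omega> \<notin> D k (\<lambda>x. h j x * h i x - G j i) (sqrt (2 * U ^ 4 * L / real k))"
        using that by (force simp: E1_def)
      from notD[OF this] gram_thr[OF that(2,3)] show ?thesis using avg_diff_const[OF that(3)] by simp
    qed
    have mean: "\<bar>avg N (h j) \<omega>\<bar> \<le> sqrt (2 * U\<^sup>2 * L1 / real N)" if "j < m" for j
      using \<omega> that by (intro notD) (auto simp: Bad_def E2_def)
    have hE: "\<bar>avg N (\<lambda>x. h j x * eps x) \<omega>\<bar> \<le> sqrt (2 * (4 * U\<^sup>2 * tau\<^sup>2) * L1 / real N)" if "j < m" for j
      using \<omega> that by (intro notD) (auto simp: Bad_def E3_def)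
    have eN: "\<bar>avg N eps \<omega>\<bar> \<le> sqrt (2 * tau\<^sup>2 * L1 / real N)"
      using \<omega> by (intro notD) (auto simp: Bad_def E4_def)
    have supp: "supp_m m bl = S"
    proof (rule lasso_selects_support[OF N0(1) lasso lam big])
      show "\<bar>avg N (\<lambda>x. h j x * h k x) \<omega> - G j k\<bar> \<le> \<gamma> / (6 * sparsity)" if "j < m" "k \<in> S" for j k
        using \<omega> that large N0 by (intro gram) (auto simp: Bad_def)
      show "(sqrt (2 * U\<^sup>2 * L1 / real N))\<^sup>2 \<le> \<gamma> / (30 * sparsity)"
        using mean_thr Lpos by simp
      fix j assume j: "j < m"
      have "\<bar>avg N (h j) \<omega> * avg N eps \<omega>\<bar> \<le> sqrt (2 * U\<^sup>2 * L1 / real N) * sqrt (2 * tau\<^sup>2 * L1 / real N)"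
        unfolding abs_mult using mean[OF j] eN Lpos by (intro mult_mono) auto
      then show "\<bar>avg N (\<lambda>x. h j x * eps x) \<omega> - avg N (h j) \<omega> * avg N eps \<omega>\<bar> \<le> lam / 4"
        using hE[OF j] noise_thr by linarith
    qed (use mean in auto)
    define M V E where "M = sqrt (8 * sparsity * L8 / real n)" and "V = 4 * tau * sqrt (B * L8 / real n)"
      and "E = sqrt (2 * tau\<^sup>2 * L16 / real n)"
    have pos: "0 \<le> M" "0 \<le> V" "0 \<le> E" using s1 Lpos B tau_pos by (auto simp: M_def V_def E_def)
    have M2: "M\<^sup>2 = 8 * sparsity * L8 / real n" using s1 Lpos by (simp add: M_def)
    have "sparsity * L8 \<le> \<xi> * L" using xi s1 Lle Lpos by (intro mult_mono) auto
    then have sn: "75 * (sparsity * L8) \<le> real n" using large1(1) by linarith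
    have bound: "\<bar>a - mean_f\<bar> \<le> E + 2 * M * (V + M * E)"
    proof (rule K.ols_intercept_error[OF ols[unfolded supp] N0(2)])
      show "f (X i \<omega>) = mean_f + (\<Sum>j\<in>S. bstar j * h j (X i \<omega>)) + eps (X i \<omega>)" for i by (rule model)
      \<comment> \<open>The entrywise error costs one sixth of \<open>\<gamma>\<close> times the
        squared norm, hence at most one sixth of the form of \<open>G\<close>; the remaining
        \<open>5/6\<close> exceeds \<open>4/5\<close>.\<close>
      show "4 / 5 * bform S G d d \<le> bform S (\<lambda>j k. (\<Sum>i<n. h j (X i \<omega>) * h k (X i \<omega>)) / real n) d d" for d
      proof -
        have "bform S G d d - \<gamma> / (6 * sparsity) * real (card S) * (\<Sum>j\<in>S. (d j)\<^sup>2)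
            \<le> bform S (\<lambda>j k. avg n (\<lambda>x. h j x * h k x) \<omega>) d d"
          using \<omega> large N0 in_S_less by (intro bform_entrywise_ge S_fin S_nonempty gram) (auto simp: Bad_def)
        also have "\<gamma> / (6 * sparsity) * real (card S) = \<gamma> / 6" using s1 by (simp add: sparsity_def)
        finally show ?thesis using \<gamma>_le[of d] G_psd[of d] by (simp add: avg_def)
      qed
      show "sqrt (bform S K (\<lambda>j. (\<Sum>i<n. h j (X i \<omega>)) / real n) (\<lambda>j. (\<Sum>i<n. h j (X i \<omega>)) / real n)) \<le> M"
        using \<omega> by (auto simp: Bad_def E7_def M_def avg_def)
      show "M\<^sup>2 \<le> 3 / 10" unfolding M2 using sn N0 by (simp add: field_simps)
      show "sqrt (bform S K (\<lambda>j. (\<Sum>i<n. h j (X i \<omega>) * eps (X i \<omega>)) / real n)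
          (\<lambda>j. (\<Sum>i<n. h j (X i \<omega>) * eps (X i \<omega>)) / real n)) \<le> V"
        using \<omega> by (auto simp: Bad_def E8_def V_def avg_def)
      show "\<bar>(\<Sum>i<n. eps (X i \<omega>)) / real n\<bar> \<le> E"
        using \<omega> notD[of n eps E] by (auto simp: Bad_def E6_def E_def avg_def)
    qed
    have E_eq: "E = sqrt (2 * ln (16 / delta)) * tau / sqrt (real n)"
      using tau_pos by (simp add: E_def L16_def real_sqrt_divide real_sqrt_mult)
    \<comment> \<open>In units of \<open>w * L8 * tau / n\<close>, the product \<open>M * V\<close>
      contributes at most \<open>4 * 3 = 12\<close> and \<open>M^2 * E\<close> at most
      \<open>8/6 = 4/3\<close>. Twice their sum is \<open>80/3\<close>, well below 58.\<close>
    have "2 * M * (V + M * E) \<le> 58 * sqrt (B * sparsity * ln (16 * sparsity / delta) * ln (8 / delta)) * tau / real n"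
    proof -
      have n0: "0 < real n" using N0 by simp
      \<comment> \<open>A constant bound on \<open>E\<close> suffices, since \<open>M^2\<close>
        already has order \<open>1 / n\<close>.\<close>
      have E6: "E \<le> tau / 6"
      proof (unfold E_def, rule real_le_lsqrt)
        have "tau\<^sup>2 * (72 * L16) \<le> tau\<^sup>2 * real n"
          using large1(3) Lle(3) Lpos L by (intro mult_left_mono) auto
        then show "2 * tau\<^sup>2 * L16 / real n \<le> (tau / 6)\<^sup>2"
          using n0 by (simp add: power_divide field_simps)
      qed (use tau_pos in auto)
      define w where "w = sqrt (B * sparsity)"
      have ws: "sparsity \<le> w"
        unfolding w_def using B s1 by (intro real_le_rsqrt) (simp add: power2_eq_square)
      have "M * V = 4 * tau * (sqrt (8 * sparsity * L8 / real n) * sqrt (B * L8 / real n))"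
        by (simp add: M_def V_def)
      also have "sqrt (8 * sparsity * L8 / real n) * sqrt (B * L8 / real n) = sqrt (8 * (B * sparsity) * (L8 / real n)\<^sup>2)"
        unfolding real_sqrt_mult[symmetric] by (simp add: power2_eq_square)
      also have "\<dots> = sqrt 8 * w * (L8 / real n)"
        using Lpos by (simp add: real_sqrt_mult w_def)
      also have "4 * tau * (sqrt 8 * w * (L8 / real n)) \<le> 4 * tau * (3 * w * (L8 / real n))"
        using tau_pos ws s1 Lpos by (intro mult_left_mono mult_right_mono real_le_lsqrt) auto
      finally have MV: "M * V \<le> 12 * (w * L8 * tau / real n)" by (simp add: mult_ac)
      have "M * M * E \<le> M\<^sup>2 * (tau / 6)" unfolding power2_eq_square using E6 by (intro mult_left_mono) auto
      also have "\<dots> = 4 / 3 * (sparsity * (L8 * tau / real n))" unfolding M2 by simp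
      also have "\<dots> \<le> 4 / 3 * (w * (L8 * tau / real n))"
        using ws Lpos tau_pos by (intro mult_left_mono mult_right_mono) auto
      finally have MME: "M * M * E \<le> 4 / 3 * (w * L8 * tau / real n)" by (simp add: mult_ac)
      have w0: "0 \<le> w * L8 * tau / real n" using ws s1 Lpos tau_pos by simp
      have "2 * M * (V + M * E) = 2 * (M * V) + 2 * (M * M * E)" by (simp add: algebra_simps)
      also have "\<dots> \<le> 58 * (w * L8 * tau / real n)" proof -
        have "2 * p + 2 * q \<le> 58 * z" if "p \<le> 12 * z" "q \<le> 4 / 3 * z" "0 \<le> z" for p q z :: real
          using that by linarith
        from this[OF MV MME w0] show ?thesis .
      qed
      \<comment> \<open>The argument gives \<open>L8\<close> twice under the root; one copy is
        enlarged to match the stated logarithm.\<close>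
      also have "\<dots> \<le> 58 * (sqrt (B * sparsity * ln (16 * sparsity / delta) * L8) * tau / real n)"
      proof -
        have "L8 \<le> ln (16 * sparsity / delta)"
          unfolding L8_def using delta s1 by (intro ln_mono divide_right_mono) auto
        then have "B * sparsity * L8 * L8 \<le> B * sparsity * ln (16 * sparsity / delta) * L8"
          using B s1 Lpos by (intro mult_right_mono mult_left_mono) auto
        then have "sqrt (B * sparsity * L8 * L8) \<le> sqrt (B * sparsity * ln (16 * sparsity / delta) * L8)"
          by (rule real_sqrt_le_mono)
        moreover have "sqrt (B * sparsity * L8 * L8) = w * L8"
          using Lpos by (simp add: w_def real_sqrt_mult)
        ultimately have "w * L8 \<le> sqrt (B * sparsity * ln (16 * sparsity / delta) * L8)" by simp
        then show ?thesis using tau_pos by (intro mult_left_mono divide_right_mono mult_right_mono) auto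
      qed
      finally show ?thesis by (simp add: L8_def)
    qed
    with bound show "\<bar>a - mean_f\<bar> \<le> sqrt (2 * ln (16 / delta)) * tau / sqrt (real n)
        + 58 * sqrt (B * sparsity * ln (16 * sparsity / delta) * ln (8 / delta)) * tau / real n"
      unfolding E_eq[symmetric] by (rule order_trans[OF _ add_left_mono])
  qed
qed

end

text \<open>The probability statement is a measurable event on which the bound holds for all LASSO
  and least squares minimisers at once. Hence neither uniqueness nor a measurable choice of the
  estimators is at issue.\<close>

theorem theorem4:
  fixes P :: "'a measure" and Q :: "'b measure"
    and f :: "'a \<Rightarrow> real" and h :: "nat \<Rightarrow> 'a \<Rightarrow> real"
    and m n N :: nat and bstar :: "nat \<Rightarrow> real"
    and tau delta lam :: real and X :: "nat \<Rightarrow> 'b \<Rightarrow> 'a"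
  assumes P: "prob_space P"
    and f_meas: "f \<in> borel_measurable P" and f_L2: "integrable P (\<lambda>x. (f x)\<^sup>2)"
    and h_meas: "\<And>j. j < m \<Longrightarrow> h j \<in> borel_measurable P"
    and h_L2: "\<And>j. j < m \<Longrightarrow> integrable P (\<lambda>x. (h j x)\<^sup>2)"
    and h_centered: "\<And>j. j < m \<Longrightarrow> (\<integral>x. h j x \<partial>P) = 0"
    and bstar_min: "\<And>b. (\<integral>x. (f x - (\<integral>y. f y \<partial>P) - (\<Sum>j<m. bstar j * h j x))\<^sup>2 \<partial>P)
                         \<le> (\<integral>x. (f x - (\<integral>y. f y \<partial>P) - (\<Sum>j<m. b j * h j x))\<^sup>2 \<partial>P)"
    and S_ne: "supp_m m bstar \<noteq> {}"
    and tau_pos: "tau > 0"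
    and eps_subg: "subgaussian P (\<lambda>x. f x - (\<integral>y. f y \<partial>P) - (\<Sum>j<m. bstar j * h j x)) (tau\<^sup>2)"
    and h_bdd: "\<exists>U. \<forall>j<m. \<forall>x\<in>space P. \<bar>h j x\<bar> \<le> U"
    and lin_indep: "\<And>c. (AE x in P. (\<Sum>k\<in>supp_m m bstar. c k * h k x) = 0)
                         \<Longrightarrow> (\<forall>k\<in>supp_m m bstar. c k = 0)"
    and orth: "\<And>j k. j < m \<Longrightarrow> j \<notin> supp_m m bstar \<Longrightarrow> k \<in> supp_m m bstar
                     \<Longrightarrow> (\<integral>x. h j x * h k x \<partial>P) = 0"
    and Q: "prob_space Q"
    and X_meas: "\<And>i. i < n \<Longrightarrow> X i \<in> measurable Q P"
    and X_indep: "prob_space.indep_vars Q (\<lambda>_. P) X {..<n}"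
    and X_distr: "\<And>i. i < n \<Longrightarrow> distr Q P (X i) = P"
    and delta: "0 < delta" "delta < 1"
    and N: "1 \<le> N" "N \<le> n"
    and N_large: "real N \<ge> 75 * (real (card (supp_m m bstar)) * (U_h P h m)\<^sup>2
                       / min_eigenvalue (gram_mat P h (supp_m m bstar)))\<^sup>2
                     * ln (20 * real (card (supp_m m bstar)) * real m / delta)"
    and lam_lower: "13 * U_h P h m * sqrt (ln (20 * real m / delta)) * tau / sqrt (real N) \<le> lam"
    and lam_upper: "lam \<le> min_eigenvalue (gram_mat P h (supp_m m bstar))
                     / (3 * sqrt (real (card (supp_m m bstar))))
                     * Min ((\<lambda>k. \<bar>bstar k\<bar>) ` supp_m m bstar)"
  shows "\<exists>A\<in>sets Q. measure Q A \<ge> 1 - delta \<and>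
           (\<forall>\<omega>\<in>A. \<forall>blasso a b.
              is_lasso f h m (\<lambda>i. X i \<omega>) N lam blasso \<longrightarrow>
              is_ols f h (\<lambda>i. X i \<omega>) n (supp_m m blasso) a b \<longrightarrow>
              \<bar>a - (\<integral>x. f x \<partial>P)\<bar>
                \<le> sqrt (2 * ln (16 / delta)) * tau / sqrt (real n)
                  + 58 * sqrt (B_star P h (supp_m m bstar) * real (card (supp_m m bstar))
                               * ln (16 * real (card (supp_m m bstar)) / delta) * ln (8 / delta))
                    * tau / real n)"
proof -
  interpret control_variates P Q X n f h m bstar tau
    using assms by (simp add: control_variates_def control_variates_axioms_def iid_sample_def iid_sample_axioms_def)
  show ?thesis
    using lslasso_error[OF delta N] N_large lam_lower lam_upper
    by (simp add: \<xi>_def sparsity_def U_def \<gamma>_def B_def S_def mean_f_def)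
qed

end
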